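(* Let $M=\mathrm{SE}(3)$ with the left invariant metric for which the left invariant vector fields $e_1,\dots,e_6$ (given in the context) are orthonormal, and let $\widehat M=\mathfrak{se}(3)=T_1\mathrm{SE}(3)$ with the inner product induced at the identity, so $\widehat M\cong\mathbb{R}^6$ with the Euclidean metric. Then $Q$ has dimension 27, and for every $q_0\in Q$ the set $\mathcal O_{q_0}$ of all points of $Q$ that can be connected to $q_0$ by an intrinsic rolling of $\mathrm{SE}(3)$ on $\mathfrak{se}(3)$ is an immersed submanifold of dimension 12, so that $Q$ is foliated by submanifolds of dimension 12. In particular, the system is not controllable: there are points of $Q$ that cannot be joined by an intrinsic rolling.
   Context: $\mathrm{SE}(3)$ is the group of orientation preserving isometries of $\mathbb{R}^3$; $x=(C,r)$ with $C=(c_{ij})\in\mathrm{SO}(3)$, $r\in\mathbb{R}^3$ acts by $x(y)=Cy+r$. The left invariant frame is $$e_1=\tfrac1{\sqrt2}\sum_{j=1}^3\left(c_{j1}\tfrac{\partial}{\partial c_{j2}}-c_{j2}\tfrac{\partial}{\partial c_{j1}}\right),\quad e_2=\tfrac1{\sqrt2}\sum_{j=1}^3\left(c_{j1}\tfrac{\partial}{\partial c_{j3}}-c_{j3}\tfrac{\partial}{\partial c_{j1}}\right),$$ $$e_3=\tfrac1{\sqrt2}\sum_{j=1}^3\left(c_{j2}\tfrac{\partial}{\partial c_{j3}}-c_{j3}\tfrac{\partial}{\partial c_{j2}}\right),\quad e_{3+k}=\sum_{j=1}^3c_{jk}\tfrac{\partial}{\partial r_j}\ (k=1,2,3).$$ $\mathrm{SE}(3)$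 is oriented by $e_1,\dots,e_6$, and $\mathfrak{se}(3)$ is identified with $\mathbb{R}^6$ by $\sum_j\widehat x_je_j(1)\mapsto(\widehat x_1,\dots,\widehat x_6)$. For oriented connected Riemannian manifolds $M,\widehat M$ of equal dimension, $Q=\{q\in\mathrm{Isom}_0^+(T_xM,T_{\widehat x}\widehat M): x\in M,\widehat x\in\widehat M\}$, where $\mathrm{Isom}_0^+$ denotes linear orientation preserving isometries. An intrinsic rolling is an absolutely continuous curve $q:[0,\tau]\to Q$ with projections $x(t),\widehat x(t)$ to $M,\widehat M$ such that (I') $\dot{\widehat x}(t)=q(t)\dot x(t)$ for almost all $t$; (II') a tangent vector field $Z(t)$ is parallel along $x(t)$ if and only if $q(t)Z(t)$ is parallel along $\widehat x(t)$, where parallel means absolutely continuous with covariant derivative (Levi-Civita) vanishing a.e. *)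

theory Defs
  imports "HOL-Analysis.Analysis"
begin

section \<open>Smooth maps, submanifolds and foliations in Euclidean spaces\<close>

primrec C_k_on :: "nat \<Rightarrow> 'a::euclidean_space set \<Rightarrow> ('a \<Rightarrow> 'b::euclidean_space) \<Rightarrow> bool" where
  "C_k_on 0 U f \<longleftrightarrow> continuous_on U f"
| "C_k_on (Suc n) U f \<longleftrightarrow>
     (\<forall>x\<in>U. f differentiable (at x)) \<and>
     (\<forall>v. C_k_on n U (\<lambda>x. frechet_derivative f (at x) v))"

text \<open>Smoothness of maps on an open set \<open>U\<close>.\<close>

definition smooth_on :: "'a::euclidean_space set \<Rightarrow> ('a \<Rightarrow> 'b::euclidean_space) \<Rightarrow> bool" where
  "smooth_on U f \<longleftrightarrow> (\<forall>n. C_k_on n U f)"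

text \<open>
  Smoothness of maps on an arbitrary subset \<open>S\<close>: local smooth extendability. For an embedded
  submanifold \<open>S\<close> this is smoothness on the manifold \<open>S\<close>.
\<close>

definition smooth_map_on :: "'a::euclidean_space set \<Rightarrow> ('a \<Rightarrow> 'b::euclidean_space) \<Rightarrow> bool" where
  "smooth_map_on S f \<longleftrightarrow>
     (\<forall>p\<in>S. \<exists>U g. open U \<and> p \<in> U \<and> smooth_on U g \<and> (\<forall>x\<in>S \<inter> U. g x = f x))"

text \<open>
  A local parametrization (inverse of a chart) of the set underlying \<open>T\<close>, where \<open>T\<close> need not be
  the subspace topology: a smooth immersion of an open subset \<open>U\<close> of the model space into the
  ambient space that is a homeomorphism onto a \<open>T\<close>-open set.
\<close>

definition local_parametrization ::
    "'a::euclidean_space topology \<Rightarrow> 'm::euclidean_space set \<Rightarrow> ('m \<Rightarrow> 'a) \<Rightarrow> bool" where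
  "local_parametrization T U \<phi> \<longleftrightarrow>
     open U \<and> smooth_on U \<phi> \<and> (\<forall>u\<in>U. inj (frechet_derivative \<phi> (at u))) \<and>
     openin T (\<phi> ` U) \<and>
     homeomorphic_map (top_of_set U) (subtopology T (\<phi> ` U)) \<phi>"

text \<open>
  \<open>topspace T\<close> with topology \<open>T\<close> is a smooth manifold modelled on \<open>'m\<close> (so of dimension
  \<open>DIM('m)\<close>), smoothly immersed into the ambient space by the inclusion. Coordinate changes
  between local parametrizations are automatically smooth, since these are immersions
  and homeomorphisms onto \<open>T\<close>-open sets.
\<close>

definition immersed_structure ::
    "'m::euclidean_space itself \<Rightarrow> 'a::euclidean_space topology \<Rightarrow> bool" where
  "immersed_structure m T \<longleftrightarrow>
     Hausdorff_space T \<and> second_countable T \<and>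
     (\<forall>p\<in>topspace T. \<exists>(U :: 'm set) \<phi>. local_parametrization T U \<phi> \<and> p \<in> \<phi> ` U)"

definition embedded_submanifold ::
    "'m::euclidean_space itself \<Rightarrow> 'a::euclidean_space set \<Rightarrow> bool" where
  "embedded_submanifold m N \<longleftrightarrow> immersed_structure m (top_of_set N)"

text \<open>
  Immersed submanifolds of \<open>M\<close>; \<open>M\<close> is meant to be an embedded submanifold of the ambient space,
  so that a smooth immersion into the ambient space with image in \<open>M\<close> is one into \<open>M\<close>.
\<close>

definition immersed_submanifold ::
    "'m::euclidean_space itself \<Rightarrow> 'a::euclidean_space set \<Rightarrow> 'a set \<Rightarrow> bool" where
  "immersed_submanifold m M N \<longleftrightarrow>
     N \<subseteq> M \<and> (\<exists>T. topspace T = N \<and> immersed_structure m T)"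

definition connected_immersed_submanifold ::
    "'m::euclidean_space itself \<Rightarrow> 'a::euclidean_space set \<Rightarrow> 'a set \<Rightarrow> bool" where
  "connected_immersed_submanifold m M N \<longleftrightarrow>
     N \<subseteq> M \<and> (\<exists>T. topspace T = N \<and> connected_space T \<and> immersed_structure m T)"

text \<open>
  A foliation of \<open>M\<close> with leaf dimension \<open>DIM('l)\<close> and codimension \<open>DIM('t)\<close>: a partition into
  connected immersed submanifolds such that every point has a flat chart, in which every leaf is
  a countable (possibly empty) union of slices.
\<close>

definition foliation ::
    "'l::euclidean_space itself \<Rightarrow> 't::euclidean_space itself \<Rightarrow>
     'a::euclidean_space set \<Rightarrow> 'a set set \<Rightarrow> bool" where
  "foliation l t M F \<longleftrightarrow>
     partition_on M F \<and>
     (\<forall>L\<in>F. connected_immersed_submanifold l M L) \<and>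
     (\<forall>p\<in>M. \<exists>(a::'l) b (c::'t) d \<phi>.
        local_parametrization (top_of_set M) (box a b \<times> box c d) \<phi> \<and>
        p \<in> \<phi> ` (box a b \<times> box c d) \<and>
        (\<forall>L\<in>F. \<exists>K. countable K \<and> K \<subseteq> box c d \<and>
           L \<inter> \<phi> ` (box a b \<times> box c d) = \<phi> ` (box a b \<times> K)))"

section \<open>Levi-Civita connection and parallel vector fields\<close>

text \<open>In this section \<open>S\<close> is an embedded submanifold and \<open>g\<close> a Riemannian metric on \<open>S\<close>,
  not necessarily the one induced by the ambient inner product.\<close>

definition smooth_curve_through ::
    "'a::euclidean_space set \<Rightarrow> 'a \<Rightarrow> 'a \<Rightarrow> (real \<Rightarrow> 'a) \<Rightarrow> bool" where
  "smooth_curve_through S p v \<gamma> \<longleftrightarrow>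
     (\<exists>\<epsilon>>0. smooth_on {-\<epsilon><..<\<epsilon>} \<gamma> \<and> \<gamma> ` {-\<epsilon><..<\<epsilon>} \<subseteq> S) \<and>
     \<gamma> 0 = p \<and> (\<gamma> has_vector_derivative v) (at 0)"

definition tangent_space :: "'a::euclidean_space set \<Rightarrow> 'a \<Rightarrow> 'a set" where
  "tangent_space S p = {v. \<exists>\<gamma>. smooth_curve_through S p v \<gamma>}"

text \<open>Derivative at \<open>p\<close> of a map defined on \<open>S\<close> in the direction of a tangent vector \<open>v\<close>.\<close>

definition dir_deriv ::
    "'a::euclidean_space set \<Rightarrow> ('a \<Rightarrow> 'b::euclidean_space) \<Rightarrow> 'a \<Rightarrow> 'a \<Rightarrow> 'b" where
  "dir_deriv S f p v =
     (THE d. \<forall>\<gamma>. smooth_curve_through S p v \<gamma> \<longrightarrow> ((f \<circ> \<gamma>) has_vector_derivative d) (at 0))"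

definition vector_fields :: "'a::euclidean_space set \<Rightarrow> ('a \<Rightarrow> 'a) set" where
  "vector_fields S = {X. smooth_map_on S X \<and> (\<forall>p\<in>S. X p \<in> tangent_space S p)}"

definition lie_bracket ::
    "'a::euclidean_space set \<Rightarrow> ('a \<Rightarrow> 'a) \<Rightarrow> ('a \<Rightarrow> 'a) \<Rightarrow> 'a \<Rightarrow> 'a" where
  "lie_bracket S X Y p = dir_deriv S Y p (X p) - dir_deriv S X p (Y p)"

definition affine_connection ::
    "'a::euclidean_space set \<Rightarrow> (('a \<Rightarrow> 'a) \<Rightarrow> ('a \<Rightarrow> 'a) \<Rightarrow> 'a \<Rightarrow> 'a) \<Rightarrow> bool" where
  "affine_connection S D \<longleftrightarrow>
     (\<forall>X\<in>vector_fields S. \<forall>Y\<in>vector_fields S. D X Y \<in> vector_fields S) \<and>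
     (\<forall>X\<in>vector_fields S. \<forall>Y\<in>vector_fields S. \<forall>Z\<in>vector_fields S. \<forall>p\<in>S.
        D (\<lambda>x. X x + Y x) Z p = D X Z p + D Y Z p \<and>
        D X (\<lambda>x. Y x + Z x) p = D X Y p + D X Z p) \<and>
     (\<forall>f. smooth_map_on S f \<longrightarrow>
       (\<forall>X\<in>vector_fields S. \<forall>Y\<in>vector_fields S. \<forall>p\<in>S.
          D (\<lambda>x. f x *\<^sub>R X x) Y p = f p *\<^sub>R D X Y p \<and>
          D X (\<lambda>x. f x *\<^sub>R Y x) p = dir_deriv S f p (X p) *\<^sub>R Y p + f p *\<^sub>R D X Y p))"

definition is_levi_civita ::
    "'a::euclidean_space set \<Rightarrow> ('a \<Rightarrow> 'a \<Rightarrow> 'a \<Rightarrow> real) \<Rightarrow>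
     (('a \<Rightarrow> 'a) \<Rightarrow> ('a \<Rightarrow> 'a) \<Rightarrow> 'a \<Rightarrow> 'a) \<Rightarrow> bool" where
  "is_levi_civita S g D \<longleftrightarrow>
     affine_connection S D \<and>
     (\<forall>X\<in>vector_fields S. \<forall>Y\<in>vector_fields S. \<forall>p\<in>S.
        D X Y p - D Y X p = lie_bracket S X Y p) \<and>
     (\<forall>X\<in>vector_fields S. \<forall>Y\<in>vector_fields S. \<forall>Z\<in>vector_fields S. \<forall>p\<in>S.
        dir_deriv S (\<lambda>x. g x (Y x) (Z x)) p (X p) = g p (D X Y p) (Z p) + g p (Y p) (D X Z p))"

text \<open>By the fundamental theorem of Riemannian geometry the choice is determined, as far as
  smooth vector fields and points of \<open>S\<close> are concerned.\<close>

definition levi_civita ::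
    "'a::euclidean_space set \<Rightarrow> ('a \<Rightarrow> 'a \<Rightarrow> 'a \<Rightarrow> real) \<Rightarrow>
     ('a \<Rightarrow> 'a) \<Rightarrow> ('a \<Rightarrow> 'a) \<Rightarrow> 'a \<Rightarrow> 'a" where
  "levi_civita S g = (SOME D. is_levi_civita S g D)"

text \<open>Coordinates of a tangent vector at \<open>p\<close> with respect to a global frame \<open>E\<close>.\<close>

definition frame_coords :: "('i::finite \<Rightarrow> 'a::euclidean_space \<Rightarrow> 'a) \<Rightarrow> 'a \<Rightarrow> 'a \<Rightarrow> real^'i" where
  "frame_coords E p v = (THE c. v = (\<Sum>i\<in>UNIV. c $ i *\<^sub>R E i p))"

text \<open>
  Covariant derivative of a vector field \<open>Z = \<Sum>\<^sub>j z\<^sub>j E\<^sub>j\<close> along a curve \<open>x\<close> with velocity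
  \<open>\<Sum>\<^sub>i u\<^sub>i E\<^sub>i\<close>, namely \<open>\<Sum>\<^sub>j z\<^sub>j' E\<^sub>j + \<Sum>\<^sub>i\<^sub>j u\<^sub>i z\<^sub>j \<nabla>\<^bsub>E\<^sub>i\<^esub> E\<^sub>j\<close>; \<open>E\<close> is a smooth global frame of \<open>S\<close>.
  The value is independent of the frame.
\<close>

definition has_covariant_derivative ::
    "'a::euclidean_space set \<Rightarrow> ('a \<Rightarrow> 'a \<Rightarrow> 'a \<Rightarrow> real) \<Rightarrow> ('i::finite \<Rightarrow> 'a \<Rightarrow> 'a) \<Rightarrow>
     (real \<Rightarrow> 'a) \<Rightarrow> (real \<Rightarrow> 'a) \<Rightarrow> 'a \<Rightarrow> real \<Rightarrow> real set \<Rightarrow> bool" where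
  "has_covariant_derivative S g E x Z w t I \<longleftrightarrow>
     (\<exists>(u :: real^'i) (z' :: real^'i).
        (x has_vector_derivative (\<Sum>i\<in>UNIV. u $ i *\<^sub>R E i (x t))) (at t within I) \<and>
        ((\<lambda>s. frame_coords E (x s) (Z s)) has_vector_derivative z') (at t within I) \<and>
        w = (\<Sum>j\<in>UNIV. z' $ j *\<^sub>R E j (x t)) +
            (\<Sum>i\<in>UNIV. \<Sum>j\<in>UNIV.
               (u $ i * frame_coords E (x t) (Z t) $ j) *\<^sub>R levi_civita S g (E i) (E j) (x t)))"

definition abs_continuous_on :: "real set \<Rightarrow> (real \<Rightarrow> 'a::euclidean_space) \<Rightarrow> bool" where
  "abs_continuous_on I f \<longleftrightarrow>
     (\<forall>\<epsilon>>0. \<exists>\<delta>>0. \<forall>P. finite P \<longrightarrow>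
        (\<forall>(a, b)\<in>P. a \<le> b \<and> {a..b} \<subseteq> I) \<longrightarrow>
        disjoint_family_on (\<lambda>(a, b). {a<..<b}) P \<longrightarrow>
        (\<Sum>(a, b)\<in>P. b - a) < \<delta> \<longrightarrow>
        (\<Sum>(a, b)\<in>P. norm (f b - f a)) < \<epsilon>)"

definition parallel_along ::
    "'a::euclidean_space set \<Rightarrow> ('a \<Rightarrow> 'a \<Rightarrow> 'a \<Rightarrow> real) \<Rightarrow> ('i::finite \<Rightarrow> 'a \<Rightarrow> 'a) \<Rightarrow>
     real \<Rightarrow> (real \<Rightarrow> 'a) \<Rightarrow> (real \<Rightarrow> 'a) \<Rightarrow> bool" where
  "parallel_along S g E \<tau> x Z \<longleftrightarrow>
     abs_continuous_on {0..\<tau>} Z \<and>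
     (AE t in lborel. t \<in> {0..\<tau>} \<longrightarrow> has_covariant_derivative S g E x Z 0 t {0..\<tau>})"

section \<open>The rolling of SE(3) on its Lie algebra\<close>

type_synonym se3_ambient = "(real^3^3) \<times> (real^3)"

text \<open>The pair \<open>(C, r)\<close> stands for the isometry \<open>y \<mapsto> C y + r\<close>, and \<open>C $ i $ j\<close> is the
  entry \<open>c\<^sub>i\<^sub>j\<close>.\<close>

definition SE3 :: "se3_ambient set" where
  "SE3 = {(C, r). orthogonal_matrix C \<and> det C = 1}"

text \<open>The derivation \<open>2\<^sup>-\<^sup>1\<^sup>/\<^sup>2 \<Sum>\<^sub>j (c\<^sub>j\<^sub>a \<partial>/\<partial>c\<^sub>j\<^sub>b - c\<^sub>j\<^sub>b \<partial>/\<partial>c\<^sub>j\<^sub>a)\<close> (for \<open>a \<noteq> b\<close>) as a tangent vector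
  in the ambient space.\<close>

definition rotation_field :: "3 \<Rightarrow> 3 \<Rightarrow> se3_ambient \<Rightarrow> se3_ambient" where
  "rotation_field a b = (\<lambda>(C, r).
     ((1 / sqrt 2) *\<^sub>R (\<chi> j k. if k = b then C $ j $ a else if k = a then - C $ j $ b else 0), 0))"

definition translation_field :: "3 \<Rightarrow> se3_ambient \<Rightarrow> se3_ambient" where
  "translation_field k = (\<lambda>(C, r). (0, \<chi> j. C $ j $ k))"

text \<open>The elements of the index type \<open>6\<close> are \<open>1, ..., 6\<close> (with \<open>6 = 0\<close>).\<close>

definition se3_frame :: "6 \<Rightarrow> se3_ambient \<Rightarrow> se3_ambient" where
  "se3_frame i =
     (if i = 1 then rotation_field 1 2
      else if i = 2 then rotation_field 1 3
      else if i = 3 then rotation_field 2 3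
      else if i = 4 then translation_field 1
      else if i = 5 then translation_field 2
      else translation_field 3)"

text \<open>The metric for which the left invariant frame is orthonormal.\<close>

definition se3_metric :: "se3_ambient \<Rightarrow> se3_ambient \<Rightarrow> se3_ambient \<Rightarrow> real" where
  "se3_metric x v w = frame_coords se3_frame x v \<bullet> frame_coords se3_frame x w"

text \<open>The Lie algebra, identified with Euclidean \<open>\<real>\<^sup>6\<close> through the frame at the identity, carries
  the standard metric, frame and orientation.\<close>

definition euclidean_metric :: "real^6 \<Rightarrow> real^6 \<Rightarrow> real^6 \<Rightarrow> real" where
  "euclidean_metric p v w = v \<bullet> w"

definition euclidean_frame :: "6 \<Rightarrow> real^6 \<Rightarrow> real^6" where
  "euclidean_frame i p = axis i 1"

text \<open>The matrix of \<open>q : T\<^sub>xSE(3) \<rightarrow> \<real>\<^sup>6\<close> with respect to the two frames.\<close>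

definition frame_matrix :: "se3_ambient \<Rightarrow> (se3_ambient \<Rightarrow> real^6) \<Rightarrow> real^6^6" where
  "frame_matrix x q = (\<chi> i j. q (se3_frame j x) $ i)"

text \<open>Linear orientation preserving isometries \<open>T\<^sub>xSE(3) \<rightarrow> \<real>\<^sup>6\<close>. Functions are total, so they are
  given the value \<open>undefined\<close> outside \<open>T\<^sub>xSE(3)\<close> to make each isometry a single object.\<close>

definition Isom0 :: "se3_ambient \<Rightarrow> (se3_ambient \<Rightarrow> real^6) set" where
  "Isom0 x = {q \<in> extensional (tangent_space SE3 x).
     (\<forall>v\<in>tangent_space SE3 x. \<forall>w\<in>tangent_space SE3 x. q (v + w) = q v + q w) \<and>
     (\<forall>c. \<forall>v\<in>tangent_space SE3 x. q (c *\<^sub>R v) = c *\<^sub>R q v) \<and>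
     (\<forall>v\<in>tangent_space SE3 x. \<forall>w\<in>tangent_space SE3 x. q v \<bullet> q w = se3_metric x v w) \<and>
     det (frame_matrix x q) > 0}"

type_synonym configuration = "se3_ambient \<times> (real^6) \<times> (se3_ambient \<Rightarrow> real^6)"

definition Q :: "configuration set" where
  "Q = {(x, xh, q). x \<in> SE3 \<and> q \<in> Isom0 x}"

text \<open>
  The trivialization \<open>Q \<cong> SE(3) \<times> \<real>\<^sup>6 \<times> SO(6)\<close> given by the global orthonormal frames. It is
  injective on \<open>Q\<close>, and the smooth structure of the bundle \<open>Q\<close> is the one it transports from the
  embedded submanifold \<open>Q_coords ` Q\<close>.
\<close>

definition Q_coords :: "configuration \<Rightarrow> se3_ambient \<times> (real^6) \<times> (real^6^6)" where
  "Q_coords = (\<lambda>(x, xh, q). (x, xh, frame_matrix x q))"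

definition intrinsic_rolling :: "real \<Rightarrow> (real \<Rightarrow> configuration) \<Rightarrow> bool" where
  "intrinsic_rolling \<tau> \<gamma> \<longleftrightarrow>
     (let x = (\<lambda>t. fst (\<gamma> t)); xh = (\<lambda>t. fst (snd (\<gamma> t))); q = (\<lambda>t. snd (snd (\<gamma> t))) in
        \<gamma> ` {0..\<tau>} \<subseteq> Q \<and>
        abs_continuous_on {0..\<tau>} (Q_coords \<circ> \<gamma>) \<and>
        (AE t in lborel. t \<in> {0..\<tau>} \<longrightarrow>
           (\<exists>v. (x has_vector_derivative v) (at t within {0..\<tau>}) \<and>
                (xh has_vector_derivative q t v) (at t within {0..\<tau>}))) \<and>
        (\<forall>Z. (\<forall>t\<in>{0..\<tau>}. Z t \<in> tangent_space SE3 (x t)) \<longrightarrow>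
           (parallel_along SE3 se3_metric se3_frame \<tau> x Z \<longleftrightarrow>
            parallel_along UNIV euclidean_metric euclidean_frame \<tau> xh (\<lambda>t. q t (Z t)))))"

definition orbit :: "configuration \<Rightarrow> configuration set" where
  "orbit q0 = {q1. \<exists>\<tau>>0. \<exists>\<gamma>. intrinsic_rolling \<tau> \<gamma> \<and> \<gamma> 0 = q0 \<and> \<gamma> \<tau> = q1}"

end

theory Submission
  imports Defs
begin

text \<open>
  The metric is the one induced by the ambient Euclidean space, so the Levi-Civita connection is
  the tangential projection of the ambient derivative, and \<open>SE(3) = SO(3) \<times> \<real>\<^sup>3\<close> splits as a
  Riemannian product with flat second factor. Write a configuration as \<open>x = (C, r)\<close>, \<open>xh\<close> and the
  matrix \<open>A \<in> SO(6)\<close> of the isometry, and let \<open>A\<^sub>2\<close> be its last three columns. The constant fields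
  \<open>(0, k)\<close> are parallel, hence so are their images, which makes \<open>W = A\<^sub>2 C\<^sup>T\<close> and then also
  \<open>W\<^sup>T xh - r\<close> constant along every rolling. Conversely a rolling joins any two configurations on
  which these invariants agree: turning about a fixed axis by \<open>4\<pi>\<close>, \<open>2\<pi>\<close> and \<open>\<pi>\<close> displaces \<open>xh\<close>,
  applies a half-turn to the rotational block of \<open>A\<close>, and applies a half-turn to \<open>C\<close>, respectively,
  and half-turns generate \<open>SO(3)\<close>. So the orbits are the fibres of a submersion onto
  \<open>V\<^sub>3(\<real>\<^sup>6) \<times> \<real>\<^sup>3\<close>, and Cayley transforms give rational charts, with rational inverses, in which the
  fibres are slices.
\<close>

section \<open>Calculus of smooth maps\<close>

text \<open>The two turning rates come from the connection. In a left invariant direction it acts on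
  rotational fields by half a commutator, but on the frame vectors \<open>C k\<close> of the flat
  factor by the full skew matrix, since these turn with \<open>C\<close>. Hence a turn of
  \<open>C\<close> by an angle \<theta> turns the rotational block of \<open>A\<close> only by half
  of it, and closing up \<open>C\<close> leaves a half-turn behind. The factor
  \<open>1 / sqrt 2\<close> makes the frame orthonormal for the ambient inner product. A rolling is
  only absolutely continuous, and its no-twist condition quantifies over all fields
  \<open>Z\<close>. Invariance uses this condition for chosen fields, together with the constancy of
  absolutely continuous functions whose derivative vanishes almost everywhere. Existence of rollings
  needs it for every \<open>Z\<close>; in frame coordinates both parallel conditions become the same
  linear equation. The dimensions are 27 = 6 + 6 + 15 for the configurations and 12 + 3 = 15 for the
  invariants. The remaining 12 are four triples: attitude, \<open>r\<close>, rotational block, and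
  the component of \<open>xh\<close> in rotational directions.\<close>

lemma C_k_on_subset: "C_k_on n U f \<Longrightarrow> V \<subseteq> U \<Longrightarrow> C_k_on n V f"
  by (induction n arbitrary: f) (auto intro: continuous_on_subset)

text \<open>\<open>frechet_derivative\<close> chooses from the set of all derivatives at a point,
  and two functions that agree on an open set have the same set at each of its points. This carries
  the induction through the derivative clause.\<close>

lemma C_k_on_cong:
  assumes "open U" "\<And>x. x \<in> U \<Longrightarrow> f x = g x"
  shows "C_k_on n U f \<longleftrightarrow> C_k_on n U g"
  using assms
proof (induction n arbitrary: f g)
  case 0
  then show ?case by (auto intro: continuous_on_cong)
next
  case (Suc n)
  have d: "(f has_derivative D) (at x) \<longleftrightarrow> (g has_derivative D) (at x)" if "x \<in> U" for x D
    using has_derivative_transform_within_open[of f D x UNIV U g]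
      has_derivative_transform_within_open[of g D x UNIV U f] that Suc.prems by auto
  have 1: "f differentiable (at x) \<longleftrightarrow> g differentiable (at x)" if "x \<in> U" for x
    using d[OF that] by (simp add: differentiable_def)
  have 2: "frechet_derivative f (at x) v = frechet_derivative g (at x) v" if "x \<in> U" for x v
    using d[OF that] by (simp add: frechet_derivative_def)
  have "C_k_on n U (\<lambda>x. frechet_derivative f (at x) v) \<longleftrightarrow>
      C_k_on n U (\<lambda>x. frechet_derivative g (at x) v)" for v
    by (rule Suc.IH) (auto simp: Suc.prems 2)
  with 1 show ?case by simp
qed

lemma C_k_on_imp_continuous_on: "C_k_on n U f \<Longrightarrow> continuous_on U f"
  by (cases n) (auto intro!: continuous_at_imp_continuous_on differentiable_imp_continuous_within)

lemma C_k_on_Suc_lower: "C_k_on (Suc n) U f \<Longrightarrow> C_k_on n U f"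
proof (induction n arbitrary: f)
  case 0
  then show ?case using C_k_on_imp_continuous_on[of "Suc 0"] by auto
next
  case (Suc n)
  then show ?case using C_k_on.simps(2) by blast
qed

text \<open>Lets the rules below supply an explicit derivative in place of the choice term
  \<open>frechet_derivative\<close>.\<close>

lemma C_k_on_SucI:
  assumes "open U" "\<And>x. x \<in> U \<Longrightarrow> (f has_derivative f' x) (at x)"
    "\<And>v. C_k_on n U (\<lambda>x. f' x v)"
  shows "C_k_on (Suc n) U f"
proof -
  have "C_k_on n U (\<lambda>x. frechet_derivative f (at x) v) \<longleftrightarrow> C_k_on n U (\<lambda>x. f' x v)" for v
    by (rule C_k_on_cong[OF assms(1)]) (metis assms(2) frechet_derivative_at)
  then show ?thesis using assms by (auto simp: differentiable_def)
qed

lemma C_k_on_derivative: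
  assumes "C_k_on (Suc n) U f" "x \<in> U"
  shows "(f has_derivative frechet_derivative f (at x)) (at x)"
  using assms by (simp add: frechet_derivative_works)

lemma C_k_on_const: "C_k_on n U (\<lambda>x. c)"
  by (induction n arbitrary: c) (auto simp: frechet_derivative_const)

lemma C_k_on_bounded_linear:
  assumes "open U" "bounded_linear L"
  shows "C_k_on n U L"
proof (cases n)
  case 0
  then show ?thesis using assms by (simp add: linear_continuous_on)
next
  case (Suc m)
  then show ?thesis
    using C_k_on_SucI[OF assms(1), of L "\<lambda>x. L" m] assms
    by (simp add: bounded_linear_imp_has_derivative C_k_on_const)
qed

lemma C_k_on_add:
  assumes "open U" "C_k_on n U f" "C_k_on n U g"
  shows "C_k_on n U (\<lambda>x. f x + g x)"
  using assms(2,3)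
proof (induction n arbitrary: f g)
  case 0
  then show ?case by (auto intro: continuous_intros)
next
  case (Suc n)
  show ?case
    by (rule C_k_on_SucI[OF assms(1) has_derivative_add[OF C_k_on_derivative C_k_on_derivative]])
      (use Suc in \<open>auto simp del: C_k_on.simps(1)\<close>)
qed

lemma C_k_on_bilinear:
  assumes "open U" "bounded_bilinear B" "C_k_on n U f" "C_k_on n U g"
  shows "C_k_on n U (\<lambda>x. B (f x) (g x))"
  using assms(3,4)
proof (induction n arbitrary: f g)
  case 0
  then show ?case by (auto intro: bounded_bilinear.continuous_on[OF assms(2)])
next
  case (Suc n)
  show ?case
  proof (rule C_k_on_SucI[OF assms(1)])
    show "((\<lambda>x. B (f x) (g x)) has_derivative (\<lambda>v. B (f x) (frechet_derivative g (at x) v) +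
        B (frechet_derivative f (at x) v) (g x))) (at x)" if "x \<in> U" for x
      using bounded_bilinear.FDERIV[OF assms(2) C_k_on_derivative C_k_on_derivative] Suc.prems that
      by blast
    show "C_k_on n U (\<lambda>x. B (f x) (frechet_derivative g (at x) v) +
        B (frechet_derivative f (at x) v) (g x))" for v
      using Suc.prems C_k_on_Suc_lower[OF Suc.prems(1)] C_k_on_Suc_lower[OF Suc.prems(2)]
      by (intro C_k_on_add[OF assms(1)] Suc.IH) auto
  qed
qed

lemma C_k_on_sum:
  assumes "open U" "\<And>i. i \<in> I \<Longrightarrow> C_k_on n U (f i)"
  shows "C_k_on n U (\<lambda>x. \<Sum>i\<in>I. f i x)"
  using assms(2)
  by (induction I rule: infinite_finite_induct) (auto intro: C_k_on_const C_k_on_add[OF assms(1)])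

lemma linear_Basis_expansion:
  fixes L :: "'a::euclidean_space \<Rightarrow> 'b::real_vector"
  assumes "linear L"
  shows "L v = (\<Sum>b\<in>Basis. (v \<bullet> b) *\<^sub>R L b)"
proof -
  have "L v = L (\<Sum>b\<in>Basis. (v \<bullet> b) *\<^sub>R b)" by (simp add: euclidean_representation)
  also have "\<dots> = (\<Sum>b\<in>Basis. (v \<bullet> b) *\<^sub>R L b)"
    by (simp add: linear_sum[OF assms] linear_scale[OF assms])
  finally show ?thesis .
qed

text \<open>The chain rule applies the derivative of \<open>g\<close> to a direction that moves with
  \<open>x\<close>, while \<open>C_k_on\<close> speaks of fixed directions only. Expansion over
  \<open>Basis\<close> turns it into a finite sum of products, each factor of which is of class
  \<open>C^n\<close>.\<close>

lemma C_k_on_compose: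
  assumes "open U" "open V" "f ` U \<subseteq> V" "C_k_on n V g" "C_k_on n U f"
  shows "C_k_on n U (\<lambda>x. g (f x))"
  using assms(4,5)
proof (induction n arbitrary: g)
  case 0
  then show ?case using assms(3) by (auto intro: continuous_on_compose2)
next
  case (Suc n)
  have *: "linear (frechet_derivative g (at (f x)))" if "x \<in> U" for x
    using Suc.prems(1) that assms(3) by (auto intro!: linear_frechet_derivative)
  show ?case
  proof (rule C_k_on_SucI[OF assms(1)])
    fix x assume x: "x \<in> U"
    have "((\<lambda>x. g (f x)) has_derivative
        (\<lambda>v. frechet_derivative g (at (f x)) (frechet_derivative f (at x) v))) (at x)"
      using C_k_on_derivative[OF Suc.prems(2) x] C_k_on_derivative[OF Suc.prems(1), of "f x"]
        assms(3) x by (auto intro: has_derivative_compose)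
    then show "((\<lambda>x. g (f x)) has_derivative
        (\<lambda>v. \<Sum>b\<in>Basis. (frechet_derivative f (at x) v \<bullet> b) *\<^sub>R frechet_derivative g (at (f x)) b)) (at x)"
      by (subst (asm) linear_Basis_expansion[OF *[OF x]])
  next
    fix v
    show "C_k_on n U (\<lambda>x. \<Sum>b\<in>Basis. (frechet_derivative f (at x) v \<bullet> b) *\<^sub>R
        frechet_derivative g (at (f x)) b)"
    proof (intro C_k_on_sum C_k_on_bilinear[OF _ bounded_bilinear_scaleR]
        C_k_on_bilinear[OF _ bounded_bilinear_inner] C_k_on_const assms(1))
      fix b :: 'b
      show "C_k_on n U (\<lambda>x. frechet_derivative g (at (f x)) b)"
        using Suc.prems(1) C_k_on_Suc_lower[OF Suc.prems(2)] by (intro Suc.IH) auto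
      show "C_k_on n U (\<lambda>x. frechet_derivative f (at x) v)"
        using Suc.prems by auto
    qed
  qed
qed

lemma smooth_on_subset: "smooth_on U f \<Longrightarrow> V \<subseteq> U \<Longrightarrow> smooth_on V f"
  by (auto simp: smooth_on_def intro: C_k_on_subset)

lemma smooth_on_cong: "open U \<Longrightarrow> (\<And>x. x \<in> U \<Longrightarrow> f x = g x) \<Longrightarrow> smooth_on U f \<longleftrightarrow> smooth_on U g"
  using C_k_on_cong[of U f g] by (simp add: smooth_on_def)

lemma smooth_on_imp_continuous_on: "smooth_on U f \<Longrightarrow> continuous_on U f"
  using C_k_on_imp_continuous_on by (auto simp: smooth_on_def)

lemma smooth_on_derivative:
  assumes "smooth_on U f" "x \<in> U"
  shows "(f has_derivative frechet_derivative f (at x)) (at x)"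
  using assms C_k_on_derivative unfolding smooth_on_def by blast

lemma smooth_on_const: "smooth_on U (\<lambda>x. c)"
  by (simp add: smooth_on_def C_k_on_const)

lemma smooth_on_bounded_linear: "open U \<Longrightarrow> bounded_linear L \<Longrightarrow> smooth_on U L"
  by (simp add: smooth_on_def C_k_on_bounded_linear)

lemma smooth_on_id: "open U \<Longrightarrow> smooth_on U (\<lambda>x. x)"
  by (rule smooth_on_bounded_linear) (auto simp: bounded_linear_ident)

lemma smooth_on_add: "open U \<Longrightarrow> smooth_on U f \<Longrightarrow> smooth_on U g \<Longrightarrow> smooth_on U (\<lambda>x. f x + g x)"
  by (simp add: smooth_on_def C_k_on_add)

lemma smooth_on_sum:
  "open U \<Longrightarrow> (\<And>i. i \<in> I \<Longrightarrow> smooth_on U (f i)) \<Longrightarrow> smooth_on U (\<lambda>x. \<Sum>i\<in>I. f i x)"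
  by (simp add: smooth_on_def C_k_on_sum)

lemma smooth_on_bilinear:
  "open U \<Longrightarrow> bounded_bilinear B \<Longrightarrow> smooth_on U f \<Longrightarrow> smooth_on U g \<Longrightarrow>
    smooth_on U (\<lambda>x. B (f x) (g x))"
  by (simp add: smooth_on_def C_k_on_bilinear)

lemma smooth_on_compose:
  "open U \<Longrightarrow> open V \<Longrightarrow> f ` U \<subseteq> V \<Longrightarrow> smooth_on V g \<Longrightarrow> smooth_on U f \<Longrightarrow>
    smooth_on U (\<lambda>x. g (f x))"
  unfolding smooth_on_def using C_k_on_compose by blast

lemma smooth_on_linear_compose:
  "open U \<Longrightarrow> bounded_linear L \<Longrightarrow> smooth_on U f \<Longrightarrow> smooth_on U (\<lambda>x. L (f x))"
  by (rule smooth_on_compose[of U UNIV f L]) (auto intro: smooth_on_bounded_linear)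

lemmas smooth_on_fst = smooth_on_linear_compose[OF _ bounded_linear_fst]
lemmas smooth_on_snd = smooth_on_linear_compose[OF _ bounded_linear_snd]
lemmas smooth_on_scaleR = smooth_on_bilinear[OF _ bounded_bilinear_scaleR]
lemmas smooth_on_mult = smooth_on_bilinear[OF _ bounded_bilinear_mult[where ?'a = real]]
lemmas smooth_on_inner = smooth_on_bilinear[OF _ bounded_bilinear_inner]

lemma smooth_on_uminus: "open U \<Longrightarrow> smooth_on U f \<Longrightarrow> smooth_on U (\<lambda>x. - f x)"
  using smooth_on_linear_compose[OF _ bounded_linear_minus[OF bounded_linear_ident]] by blast

lemma smooth_on_diff:
  assumes "open U" "smooth_on U f" "smooth_on U g"
  shows "smooth_on U (\<lambda>x. f x - g x)"
  using smooth_on_add[OF assms(1,2) smooth_on_uminus[OF assms(1,3)]] by simp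

lemma smooth_on_prod:
  fixes f :: "'i \<Rightarrow> 'a::euclidean_space \<Rightarrow> real"
  assumes "open U" "\<And>i. i \<in> I \<Longrightarrow> smooth_on U (f i)"
  shows "smooth_on U (\<lambda>x. \<Prod>i\<in>I. f i x)"
  using assms(2)
  by (induction I rule: infinite_finite_induct)
    (auto intro: smooth_on_const smooth_on_mult[OF assms(1)])

lemma smooth_on_Pair:
  assumes "open U" "smooth_on U f" "smooth_on U g"
  shows "smooth_on U (\<lambda>x. (f x, g x))"
proof -
  have 1: "bounded_linear (\<lambda>x. (x, 0))" "bounded_linear (\<lambda>x. (0, x))"
    by (auto intro!: bounded_linear_Pair bounded_linear_ident bounded_linear_zero)
  have "smooth_on U (\<lambda>x. (f x, 0) + (0, g x))"
    using assms by (intro smooth_on_add smooth_on_linear_compose[OF _ 1(1)]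
        smooth_on_linear_compose[OF _ 1(2)])
  then show ?thesis by simp
qed

lemma smooth_on_vec_nth: "open U \<Longrightarrow> smooth_on U f \<Longrightarrow> smooth_on U (\<lambda>x. f x $ i)"
  by (rule smooth_on_linear_compose[OF _ bounded_linear_vec_nth])

lemma smooth_on_vec_lambda:
  fixes f :: "'i::finite \<Rightarrow> 'a::euclidean_space \<Rightarrow> 'b::euclidean_space"
  assumes "open U" "\<And>i. smooth_on U (f i)"
  shows "smooth_on U (\<lambda>x. \<chi> i. f i x)"
proof -
  have L: "bounded_linear (\<lambda>v::'b. axis i v)" for i :: 'i
    by (rule linear_conv_bounded_linear[THEN iffD1])
      (auto intro!: linearI simp: vec_eq_iff axis_def)
  have "smooth_on U (\<lambda>x. \<Sum>i\<in>UNIV. axis i (f i x))"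
    using assms by (intro smooth_on_sum smooth_on_linear_compose[OF _ L])
  moreover have "(\<Sum>i\<in>UNIV. axis i (f i x)) = (\<chi> i. f i x)" for x
    by (simp add: vec_eq_iff axis_def sum.delta' if_distrib cong: if_cong)
  ultimately show ?thesis by simp
qed

text \<open>The derivative is a product of constants and of \<open>inverse\<close> itself, so the
  induction hypothesis already covers it.\<close>

lemma smooth_on_inverse: "smooth_on {x::real. x \<noteq> 0} inverse"
proof -
  have o: "open {x::real. x \<noteq> 0}" by (simp add: open_Collect_neq)
  have "C_k_on n {x::real. x \<noteq> 0} inverse" for n
  proof (induction n)
    case 0
    then show ?case by (auto intro: continuous_intros)
  next
    case (Suc n)
    show ?case
    proof (rule C_k_on_SucI[OF o])
      show "(inverse has_derivative (\<lambda>h. - (inverse x * h * inverse x))) (at x)"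
        if "x \<in> {x::real. x \<noteq> 0}" for x
        using that by (auto intro: has_derivative_inverse')
      have "C_k_on n {x. x \<noteq> 0} (\<lambda>x. (- v) * (inverse x * inverse x))" for v :: real
        by (intro C_k_on_bilinear[OF o bounded_bilinear_mult] C_k_on_const Suc)
      then show "C_k_on n {x. x \<noteq> 0} (\<lambda>x. - (inverse x * v * inverse x))" for v :: real
        by (simp add: algebra_simps)
    qed
  qed
  then show ?thesis by (simp add: smooth_on_def)
qed

lemma smooth_on_divide:
  fixes f g :: "'a::euclidean_space \<Rightarrow> real"
  assumes "open U" "smooth_on U f" "smooth_on U g" "\<And>x. x \<in> U \<Longrightarrow> g x \<noteq> 0"
  shows "smooth_on U (\<lambda>x. f x / g x)"
proof -
  have "smooth_on U (\<lambda>x. inverse (g x))"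
    by (rule smooth_on_compose[OF assms(1) _ _ smooth_on_inverse assms(3)])
      (use assms(4) in \<open>auto simp: open_Collect_neq\<close>)
  then show ?thesis
    using smooth_on_mult[OF assms(1,2)] by (auto simp: divide_inverse)
qed

section \<open>Smoothness of matrix products, determinants and inverses\<close>

lemma bounded_bilinear_matrix_mult:
  "bounded_bilinear ((**) :: real^'n^'m \<Rightarrow> real^'p^'n \<Rightarrow> real^'p^'m)"
  unfolding bilinear_conv_bounded_bilinear[symmetric] bilinear_def
  by (auto intro!: linearI simp: matrix_add_ldistrib matrix_matrix_mult_def vec_eq_iff
      sum.distrib algebra_simps sum_distrib_left)

lemma bounded_bilinear_matrix_vector_mult:
  "bounded_bilinear ((*v) :: real^'n^'m \<Rightarrow> real^'n \<Rightarrow> real^'m)"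
  unfolding bilinear_conv_bounded_bilinear[symmetric] bilinear_def
  by (auto intro!: linearI simp: matrix_vector_mult_def vec_eq_iff
      sum.distrib algebra_simps sum_distrib_left)

lemma bounded_linear_transpose: "bounded_linear (transpose :: real^'n^'m \<Rightarrow> real^'m^'n)"
  unfolding linear_conv_bounded_linear[symmetric]
  by (auto intro!: linearI simp: transpose_def vec_eq_iff)

lemmas smooth_on_matrix_mult = smooth_on_bilinear[OF _ bounded_bilinear_matrix_mult]
lemmas smooth_on_matrix_vector_mult = smooth_on_bilinear[OF _ bounded_bilinear_matrix_vector_mult]
lemmas smooth_on_transpose = smooth_on_linear_compose[OF _ bounded_linear_transpose]

lemma smooth_on_det:
  fixes f :: "'a::euclidean_space \<Rightarrow> real^'n^'n"
  assumes "open U" "smooth_on U f"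
  shows "smooth_on U (\<lambda>x. det (f x))"
  unfolding det_def
  by (intro smooth_on_sum smooth_on_mult smooth_on_prod smooth_on_const smooth_on_vec_nth assms)

lemma matrix_inv_mult:
  fixes A :: "real^'n^'n"
  assumes "det A \<noteq> 0"
  shows "A ** matrix_inv A = mat 1" "matrix_inv A ** A = mat 1"
proof -
  have "invertible A" using assms by (simp add: invertible_det_nz)
  then have "A ** matrix_inv A = mat 1 \<and> matrix_inv A ** A = mat 1"
    unfolding invertible_def matrix_inv_def by (rule someI_ex)
  then show "A ** matrix_inv A = mat 1" "matrix_inv A ** A = mat 1" by auto
qed

text \<open>Cramer's rule writes the entries as quotients of determinants, the form in which
  smoothness of the inverse follows from that of \<open>det\<close> and of division.\<close>

lemma matrix_inv_cramer:
  fixes A :: "real^'n^'n"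
  assumes "det A \<noteq> 0"
  shows "matrix_inv A = (\<chi> k l. det (\<chi> i j. if j = k then mat 1 $ i $ l else A $ i $ j) / det A)"
proof -
  note * = matrix_inv_mult(1)[OF assms]
  have "A *v (\<chi> k. matrix_inv A $ k $ l) = (\<chi> i. mat 1 $ i $ l)" for l
    by (subst *[symmetric]) (simp add: matrix_matrix_mult_def matrix_vector_mult_def)
  then have "(\<chi> k. matrix_inv A $ k $ l) =
      (\<chi> k. det (\<chi> i j. if j = k then mat 1 $ i $ l else A $ i $ j) / det A)" for l
    by (subst (asm) cramer[OF assms]) (simp cong: if_cong)
  then show ?thesis by (simp add: vec_eq_iff)
qed

lemma smooth_on_matrix_inv:
  fixes f :: "'a::euclidean_space \<Rightarrow> real^'n^'n"
  assumes "open U" "smooth_on U f" "\<And>x. x \<in> U \<Longrightarrow> det (f x) \<noteq> 0"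
  shows "smooth_on U (\<lambda>x. matrix_inv (f x))"
proof -
  \<comment> \<open>\<open>P\<close> will be a comparison of indices and does not depend on
    \<open>x\<close>, so the case distinction is harmless.\<close>
  have *: "smooth_on U (\<lambda>x. if P then g x else h x)"
    if "smooth_on U g" "smooth_on U h" for P and g h :: "'a \<Rightarrow> real"
    using that by (cases P) auto
  have "smooth_on U (\<lambda>x. \<chi> k l.
      det (\<chi> i j. if j = k then mat 1 $ i $ l else f x $ i $ j) / det (f x))"
    by (intro smooth_on_vec_lambda smooth_on_divide smooth_on_det * smooth_on_vec_nth
        smooth_on_const assms)
  then show ?thesis
    by (subst smooth_on_cong[OF assms(1)]) (auto simp: matrix_inv_cramer assms(3))
qed

lemmas smooth_intros = smooth_on_const smooth_on_id smooth_on_add smooth_on_diff smooth_on_uminus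
  smooth_on_sum smooth_on_scaleR smooth_on_mult smooth_on_inner smooth_on_Pair smooth_on_fst
  smooth_on_snd smooth_on_vec_nth smooth_on_vec_lambda smooth_on_matrix_mult
  smooth_on_matrix_vector_mult smooth_on_transpose

section \<open>Submanifolds with a smooth orthogonal tangential projection\<close>

lemma has_vector_derivative_compose_derivative:
  assumes "(\<gamma> has_vector_derivative v) (at t within I)" "(f has_derivative D) (at (\<gamma> t))"
  shows "((\<lambda>s. f (\<gamma> s)) has_vector_derivative D v) (at t within I)"
  using has_derivative_compose[OF assms(1)[unfolded has_vector_derivative_def] assms(2)]
    linear_scale[OF has_derivative_linear[OF assms(2)]]
  by (simp add: has_vector_derivative_def)

text \<open>Every tangent vector belongs to at least one curve, which makes the value described by
  \<open>dir_deriv\<close> unique; any local extension of \<open>f\<close> differentiable at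
  \<open>p\<close> then computes it. All rules for \<open>dir_deriv\<close> are reduced to Frechet
  derivatives in this way.\<close>

lemma dir_deriv_eq:
  assumes v: "v \<in> tangent_space S p"
    and U: "open U" "p \<in> U" "\<And>x. x \<in> S \<inter> U \<Longrightarrow> g x = f x"
    and g: "(g has_derivative D) (at p)"
  shows "dir_deriv S f p v = D v"
proof -
  have *: "((f \<circ> \<gamma>) has_vector_derivative D v) (at 0)" if c: "smooth_curve_through S p v \<gamma>" for \<gamma>
  proof -
    obtain e where e: "e > 0" "smooth_on {-e<..<e} \<gamma>" "\<gamma> ` {-e<..<e} \<subseteq> S"
      and \<gamma>: "\<gamma> 0 = p" "(\<gamma> has_vector_derivative v) (at 0)"
      using c by (auto simp: smooth_curve_through_def)
    have gd: "((\<lambda>s. g (\<gamma> s)) has_vector_derivative D v) (at 0)"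
      using has_vector_derivative_compose_derivative[of \<gamma> v 0 UNIV g D] \<gamma> g by simp
    have "continuous_on {-e<..<e} \<gamma>" using e(2) by (rule smooth_on_imp_continuous_on)
    \<comment> \<open>Near \<open>0\<close> the curve stays in \<open>U\<close>, where
      \<open>f\<close> and \<open>g\<close> agree along it. This preimage is the neighbourhood on
      which the derivative is transferred.\<close>
    then have o: "open ({-e<..<e} \<inter> \<gamma> -` U)"
      using U(1) continuous_on_open_vimage[of "{-e<..<e}" \<gamma>] by (metis Int_commute open_greaterThanLessThan)
    show ?thesis
      by (rule has_vector_derivative_transform_within_open[OF gd o])
        (use e \<gamma>(1) U in \<open>auto simp: image_subset_iff\<close>)
  qed
  obtain \<gamma> where c: "smooth_curve_through S p v \<gamma>"
    using v by (auto simp: tangent_space_def)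
  have "d = D v" if "\<forall>\<gamma>. smooth_curve_through S p v \<gamma> \<longrightarrow> ((f \<circ> \<gamma>) has_vector_derivative d) (at 0)" for d
    by (rule vector_derivative_unique_at[OF that[rule_format, OF c] *[OF c]])
  then show ?thesis
    unfolding dir_deriv_def using * by (intro the_equality) simp_all
qed

lemma smooth_on_frechet_derivative:
  "smooth_on U f \<Longrightarrow> smooth_on U (\<lambda>x. frechet_derivative f (at x) v)"
  unfolding smooth_on_def
proof
  fix n assume "\<forall>n. C_k_on n U f"
  then have "C_k_on (Suc n) U f" ..
  then show "C_k_on n U (\<lambda>x. frechet_derivative f (at x) v)" by simp
qed

lemma smooth_map_onI:
  fixes f g :: "'a::euclidean_space \<Rightarrow> 'b::euclidean_space"
  assumes "smooth_on UNIV g" "\<And>x. x \<in> S \<Longrightarrow> g x = f x"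
  shows "smooth_map_on S f"
  unfolding smooth_map_on_def
proof
  fix p :: 'a
  have "open (UNIV :: 'a set) \<and> p \<in> UNIV \<and> smooth_on UNIV g \<and> (\<forall>x\<in>S \<inter> UNIV. g x = f x)"
    using assms by simp
  then show "\<exists>U g. open U \<and> p \<in> U \<and> smooth_on U g \<and> (\<forall>x\<in>S \<inter> U. g x = f x)" by iprover
qed

lemma smooth_map_onE:
  assumes "smooth_map_on S f" "p \<in> S"
  obtains U g where "open U" "p \<in> U" "smooth_on U g" "\<And>x. x \<in> S \<inter> U \<Longrightarrow> g x = f x"
proof -
  obtain U g where "open U \<and> p \<in> U \<and> smooth_on U g \<and> (\<forall>x\<in>S \<inter> U. g x = f x)"
    using assms by (auto simp: smooth_map_on_def)
  then show thesis by (intro that[of U g]) auto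
qed

lemma smooth_map_onE2:
  assumes "smooth_map_on S f" "smooth_map_on S f'" "p \<in> S"
  obtains U g g' where "open U" "p \<in> U" "smooth_on U g" "smooth_on U g'"
    "\<And>x. x \<in> S \<inter> U \<Longrightarrow> g x = f x" "\<And>x. x \<in> S \<inter> U \<Longrightarrow> g' x = f' x"
proof -
  obtain U g where 1: "open U" "p \<in> U" "smooth_on U g" "\<And>x. x \<in> S \<inter> U \<Longrightarrow> g x = f x"
    by (fact smooth_map_onE[OF assms(1,3)])
  obtain V g' where 2: "open V" "p \<in> V" "smooth_on V g'" "\<And>x. x \<in> S \<inter> V \<Longrightarrow> g' x = f' x"
    by (fact smooth_map_onE[OF assms(2,3)])
  show thesis
    by (rule that[of "U \<inter> V" g g'])
      (use 1(1,2,4) 2(1,2,4) smooth_on_subset[OF 1(3)] smooth_on_subset[OF 2(3)] in auto)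
qed

section \<open>Calculus rules for directional derivatives on a subset\<close>

lemma dir_deriv_bilinear:
  assumes B: "bounded_bilinear B" and "smooth_map_on S f" "smooth_map_on S f'"
    and "p \<in> S" "v \<in> tangent_space S p"
  shows "dir_deriv S (\<lambda>x. B (f x) (f' x)) p v =
    B (dir_deriv S f p v) (f' p) + B (f p) (dir_deriv S f' p v)"
proof -
  obtain U g g' where U: "open U" "p \<in> U" "smooth_on U g" "smooth_on U g'"
    "\<And>x. x \<in> S \<inter> U \<Longrightarrow> g x = f x" "\<And>x. x \<in> S \<inter> U \<Longrightarrow> g' x = f' x"
    by (fact smooth_map_onE2[OF assms(2-4)])
  note d = smooth_on_derivative[OF U(3,2)] smooth_on_derivative[OF U(4,2)]
  have "dir_deriv S (\<lambda>x. B (f x) (f' x)) p v =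
      B (g p) (frechet_derivative g' (at p) v) + B (frechet_derivative g (at p) v) (g' p)"
    using dir_deriv_eq[OF assms(5) U(1,2) _ bounded_bilinear.FDERIV[OF B d]] U(5,6) by simp
  then show ?thesis
    using dir_deriv_eq[OF assms(5) U(1,2,5) d(1)] dir_deriv_eq[OF assms(5) U(1,2,6) d(2)]
      U(2,5,6) assms(4) by (simp add: add.commute)
qed

lemma dir_deriv_add:
  assumes "smooth_map_on S f" "smooth_map_on S f'" "p \<in> S" "v \<in> tangent_space S p"
  shows "dir_deriv S (\<lambda>x. f x + f' x) p v = dir_deriv S f p v + dir_deriv S f' p v"
proof -
  obtain U g g' where U: "open U" "p \<in> U" "smooth_on U g" "smooth_on U g'"
    "\<And>x. x \<in> S \<inter> U \<Longrightarrow> g x = f x" "\<And>x. x \<in> S \<inter> U \<Longrightarrow> g' x = f' x"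
    by (fact smooth_map_onE2[OF assms(1-3)])
  note d = smooth_on_derivative[OF U(3,2)] smooth_on_derivative[OF U(4,2)]
  show ?thesis
    using dir_deriv_eq[OF assms(4) U(1,2) _ has_derivative_add[OF d]] U(5,6)
      dir_deriv_eq[OF assms(4) U(1,2,5) d(1)] dir_deriv_eq[OF assms(4) U(1,2,6) d(2)] by simp
qed

lemma dir_deriv_linear:
  assumes "smooth_map_on S f" "p \<in> S" "v \<in> tangent_space S p" "w \<in> tangent_space S p"
  shows "v + w \<in> tangent_space S p \<Longrightarrow>
      dir_deriv S f p (v + w) = dir_deriv S f p v + dir_deriv S f p w"
    and "c *\<^sub>R v \<in> tangent_space S p \<Longrightarrow> dir_deriv S f p (c *\<^sub>R v) = c *\<^sub>R dir_deriv S f p v"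
proof -
  obtain U g where U: "open U" "p \<in> U" "smooth_on U g" "\<And>x. x \<in> S \<inter> U \<Longrightarrow> g x = f x"
    by (fact smooth_map_onE[OF assms(1,2)])
  note d = smooth_on_derivative[OF U(3,2)]
  note e = dir_deriv_eq[OF _ U(1,2,4) d] and l = has_derivative_linear[OF d]
  show "v + w \<in> tangent_space S p \<Longrightarrow>
      dir_deriv S f p (v + w) = dir_deriv S f p v + dir_deriv S f p w"
    and "c *\<^sub>R v \<in> tangent_space S p \<Longrightarrow> dir_deriv S f p (c *\<^sub>R v) = c *\<^sub>R dir_deriv S f p v"
    using assms e linear_add[OF l] linear_scale[OF l] by auto
qed

lemma smooth_map_on_bilinear:
  assumes B: "bounded_bilinear B" and "smooth_map_on S f" "smooth_map_on S f'"
  shows "smooth_map_on S (\<lambda>x. B (f x) (f' x))"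
  unfolding smooth_map_on_def
proof
  fix p assume p: "p \<in> S"
  obtain U g g' where U: "open U" "p \<in> U" "smooth_on U g" "smooth_on U g'"
    "\<And>x. x \<in> S \<inter> U \<Longrightarrow> g x = f x" "\<And>x. x \<in> S \<inter> U \<Longrightarrow> g' x = f' x"
    by (fact smooth_map_onE2[OF assms(2,3) p])
  show "\<exists>U g. open U \<and> p \<in> U \<and> smooth_on U g \<and> (\<forall>x\<in>S \<inter> U. g x = B (f x) (f' x))"
    by (intro exI[of _ U] exI[of _ "\<lambda>x. B (g x) (g' x)"] conjI smooth_on_bilinear[OF U(1) B U(3,4)] ballI)
      (simp_all add: U)
qed

lemma smooth_map_on_linear:
  assumes L: "bounded_linear L" and "smooth_map_on S f"
  shows "smooth_map_on S (\<lambda>x. L (f x))"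
  unfolding smooth_map_on_def
proof
  fix p assume p: "p \<in> S"
  obtain U g where U: "open U" "p \<in> U" "smooth_on U g" "\<And>x. x \<in> S \<inter> U \<Longrightarrow> g x = f x"
    by (fact smooth_map_onE[OF assms(2) p])
  show "\<exists>U g. open U \<and> p \<in> U \<and> smooth_on U g \<and> (\<forall>x\<in>S \<inter> U. g x = L (f x))"
    by (intro exI[of _ U] exI[of _ "\<lambda>x. L (g x)"] conjI smooth_on_linear_compose[OF U(1) L U(3)] ballI)
      (simp_all add: U)
qed

lemma dir_deriv_linear_compose:
  assumes L: "bounded_linear L" and "smooth_map_on S f" "p \<in> S" "v \<in> tangent_space S p"
  shows "dir_deriv S (\<lambda>x. L (f x)) p v = L (dir_deriv S f p v)"
proof -
  obtain U g where U: "open U" "p \<in> U" "smooth_on U g" "\<And>x. x \<in> S \<inter> U \<Longrightarrow> g x = f x"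
    by (fact smooth_map_onE[OF assms(2,3)])
  note d = smooth_on_derivative[OF U(3,2)]
  have "L (g x) = L (f x)" if "x \<in> S \<inter> U" for x using U(4)[OF that] by simp
  from dir_deriv_eq[OF assms(4) U(1,2) this bounded_linear.has_derivative[OF L d]]
    dir_deriv_eq[OF assms(4) U(1,2,4) d]
  show ?thesis by simp
qed

lemma dir_deriv_cong:
  assumes "smooth_map_on S f" "\<And>x. x \<in> S \<Longrightarrow> f x = g x" "p \<in> S" "v \<in> tangent_space S p"
  shows "dir_deriv S f p v = dir_deriv S g p v"
proof -
  obtain U h where U: "open U" "p \<in> U" "smooth_on U h" "\<And>x. x \<in> S \<inter> U \<Longrightarrow> h x = f x"
    by (fact smooth_map_onE[OF assms(1,3)])
  note d = smooth_on_derivative[OF U(3,2)]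
  have "h x = g x" if "x \<in> S \<inter> U" for x using U(4)[OF that] assms(2) that by simp
  from dir_deriv_eq[OF assms(4) U(1,2) this d] dir_deriv_eq[OF assms(4) U(1,2,4) d]
  show ?thesis by simp
qed

lemma dir_deriv_linear_map:
  assumes "bounded_linear L" "v \<in> tangent_space S p"
  shows "dir_deriv S L p v = L v"
  by (rule dir_deriv_eq[OF assms(2) open_UNIV UNIV_I refl bounded_linear_imp_has_derivative[OF assms(1)]])

lemma smooth_map_on_linear_map: "bounded_linear L \<Longrightarrow> smooth_map_on S L"
  by (rule smooth_map_onI[OF smooth_on_bounded_linear[OF open_UNIV] refl])

text \<open>Used for \<open>SE3\<close> and for flat space. Smoothness of \<open>P\<close> jointly
  in both arguments makes the projection of a constant vector a smooth field.
  \<open>bracket_in\<close> is assumed because a bare set \<open>S\<close> offers no equation for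
  its tangent spaces that could be differentiated; for \<open>SE3\<close> there is one.\<close>

locale tangential_projection =
  fixes S :: "'a::euclidean_space set" and P :: "'a \<Rightarrow> 'a \<Rightarrow> 'a"
    and g :: "'a \<Rightarrow> 'a \<Rightarrow> 'a \<Rightarrow> real"
  assumes linear_P: "\<And>p. linear (P p)"
    and smooth_P: "smooth_on UNIV (\<lambda>(p, v). P p v)"
    and P_in: "\<And>p v. p \<in> S \<Longrightarrow> P p v \<in> tangent_space S p"
    and P_id: "\<And>p v. p \<in> S \<Longrightarrow> v \<in> tangent_space S p \<Longrightarrow> P p v = v"
    and P_inner: "\<And>p v w. p \<in> S \<Longrightarrow> w \<in> tangent_space S p \<Longrightarrow> P p v \<bullet> w = v \<bullet> w"
    and metric: "\<And>p v w. p \<in> S \<Longrightarrow> v \<in> tangent_space S p \<Longrightarrow> w \<in> tangent_space S p \<Longrightarrow>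
      g p v w = v \<bullet> w"
    and bracket_in: "\<And>X Y p. X \<in> vector_fields S \<Longrightarrow> Y \<in> vector_fields S \<Longrightarrow> p \<in> S \<Longrightarrow>
      lie_bracket S X Y p \<in> tangent_space S p"
begin

lemma tangent_add: "p \<in> S \<Longrightarrow> v \<in> tangent_space S p \<Longrightarrow> w \<in> tangent_space S p \<Longrightarrow>
    v + w \<in> tangent_space S p"
  using P_in[of p "v + w"] by (simp add: linear_add[OF linear_P] P_id)

lemma tangent_scale: "p \<in> S \<Longrightarrow> v \<in> tangent_space S p \<Longrightarrow> c *\<^sub>R v \<in> tangent_space S p"
  using P_in[of p "c *\<^sub>R v"] by (simp add: linear_scale[OF linear_P] P_id)

lemma tangent_diff: "p \<in> S \<Longrightarrow> v \<in> tangent_space S p \<Longrightarrow> w \<in> tangent_space S p \<Longrightarrow>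
    v - w \<in> tangent_space S p"
  using P_in[of p "v - w"] by (simp add: linear_diff[OF linear_P] P_id)

lemma smooth_on_P:
  assumes "open U" "smooth_on U f" "smooth_on U h"
  shows "smooth_on U (\<lambda>x. P (f x) (h x))"
  using smooth_on_compose[OF assms(1) open_UNIV _ smooth_P smooth_on_Pair[OF assms]] by simp

lemma tangent_extends:
  assumes "p \<in> S" "v \<in> tangent_space S p"
  obtains Z where "Z \<in> vector_fields S" "Z p = v"
proof (rule that[of "\<lambda>x. P x v"])
  have "smooth_on UNIV (\<lambda>x. P x v)"
    by (intro smooth_on_P smooth_intros open_UNIV)
  then show "(\<lambda>x. P x v) \<in> vector_fields S"
    using P_in by (auto simp: vector_fields_def intro: smooth_map_onI)
qed (use assms P_id in auto)

text \<open>The projection drops out of inner products with tangent vectors, which reduces metric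
  compatibility to the product rule; torsion vanishes because \<open>P p\<close> fixes the
  bracket.\<close>

lemma levi_civita_projection: "is_levi_civita S g (\<lambda>X Y p. P p (dir_deriv S Y p (X p)))"
proof -
  have sm: "smooth_map_on S X" and tan: "p \<in> S \<Longrightarrow> X p \<in> tangent_space S p"
    if "X \<in> vector_fields S" for X p
    using that by (auto simp: vector_fields_def)
  have closed: "(\<lambda>p. P p (dir_deriv S Y p (X p))) \<in> vector_fields S"
    if X: "X \<in> vector_fields S" and Y: "Y \<in> vector_fields S" for X Y
  proof -
    have "\<exists>U h. open U \<and> p \<in> U \<and> smooth_on U h \<and>
        (\<forall>x\<in>S \<inter> U. h x = P x (dir_deriv S Y x (X x)))" if p: "p \<in> S" for p
    proof -
      obtain U k k' where U: "open U" "p \<in> U" "smooth_on U k" "smooth_on U k'"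
        "\<And>x. x \<in> S \<inter> U \<Longrightarrow> k x = X x" "\<And>x. x \<in> S \<inter> U \<Longrightarrow> k' x = Y x"
        by (fact smooth_map_onE2[OF sm[OF X] sm[OF Y] p])
      \<comment> \<open>As in the chain rule the direction \<open>X x\<close> varies, so the
        derivative is expanded over \<open>Basis\<close> to exhibit a smooth local
        extension.\<close>
      let ?h = "\<lambda>x. P x (\<Sum>b\<in>Basis. (k x \<bullet> b) *\<^sub>R frechet_derivative k' (at x) b)"
      have "smooth_on U (\<lambda>x. frechet_derivative k' (at x) b)" for b
        by (rule smooth_on_frechet_derivative[OF U(4)])
      then have "smooth_on U ?h"
        using U(3) by (intro smooth_on_P smooth_intros U(1))
      moreover have "?h x = P x (dir_deriv S Y x (X x))" if x: "x \<in> S \<inter> U" for x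
      proof -
        have d: "(k' has_derivative frechet_derivative k' (at x)) (at x)"
          using smooth_on_derivative[OF U(4)] x by blast
        have "dir_deriv S Y x (X x) = frechet_derivative k' (at x) (X x)"
          using dir_deriv_eq[OF _ U(1) _ U(6) d] tan[OF X] x by blast
        then show ?thesis
          using linear_Basis_expansion[OF has_derivative_linear[OF d], of "X x"] U(5)[OF x] by simp
      qed
      ultimately show ?thesis using U by blast
    qed
    then show ?thesis using P_in by (simp add: vector_fields_def smooth_map_on_def)
  qed
  have conn: "affine_connection S (\<lambda>X Y p. P p (dir_deriv S Y p (X p)))"
    unfolding affine_connection_def
  proof (intro conjI ballI allI impI)
    fix X Y Z :: "'a \<Rightarrow> 'a" and p :: 'a
    assume f: "X \<in> vector_fields S" "Y \<in> vector_fields S" "Z \<in> vector_fields S" "p \<in> S"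
    note t = tan[OF f(1,4)] tan[OF f(2,4)]
    show "P p (dir_deriv S Z p (X p + Y p)) = P p (dir_deriv S Z p (X p)) + P p (dir_deriv S Z p (Y p))"
      unfolding dir_deriv_linear(1)[OF sm[OF f(3)] f(4) t tangent_add[OF f(4) t]]
      by (rule linear_add[OF linear_P])
    show "P p (dir_deriv S (\<lambda>x. Y x + Z x) p (X p)) =
        P p (dir_deriv S Y p (X p)) + P p (dir_deriv S Z p (X p))"
      unfolding dir_deriv_add[OF sm[OF f(2)] sm[OF f(3)] f(4) t(1)]
      by (rule linear_add[OF linear_P])
  next
    fix f :: "'a \<Rightarrow> real" and X Y :: "'a \<Rightarrow> 'a" and p :: 'a
    assume f: "smooth_map_on S f" "X \<in> vector_fields S" "Y \<in> vector_fields S" "p \<in> S"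
    note t = tan[OF f(2,4)] tan[OF f(3,4)]
    show "P p (dir_deriv S Y p (f p *\<^sub>R X p)) = f p *\<^sub>R P p (dir_deriv S Y p (X p))"
      unfolding dir_deriv_linear(2)[OF sm[OF f(3)] f(4) t(1,1) tangent_scale[OF f(4) t(1)]]
      by (rule linear_scale[OF linear_P])
    show "P p (dir_deriv S (\<lambda>x. f x *\<^sub>R Y x) p (X p)) =
        dir_deriv S f p (X p) *\<^sub>R Y p + f p *\<^sub>R P p (dir_deriv S Y p (X p))"
      unfolding dir_deriv_bilinear[OF bounded_bilinear_scaleR f(1) sm[OF f(3)] f(4) t(1)]
      by (simp only: linear_add[OF linear_P] linear_scale[OF linear_P] P_id[OF f(4) t(2)])
  qed (rule closed)
  show ?thesis
    unfolding is_levi_civita_def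
  proof (intro conjI ballI conn)
    fix X Y p assume f: "X \<in> vector_fields S" "Y \<in> vector_fields S" "p \<in> S"
    show "P p (dir_deriv S Y p (X p)) - P p (dir_deriv S X p (Y p)) = lie_bracket S X Y p"
      using P_id[OF f(3) bracket_in[OF f]] by (simp add: lie_bracket_def linear_diff[OF linear_P])
  next
    fix X Y Z p assume f: "X \<in> vector_fields S" "Y \<in> vector_fields S" "Z \<in> vector_fields S" "p \<in> S"
    obtain U k k' where U: "open U" "p \<in> U" "smooth_on U k" "smooth_on U k'"
      "\<And>x. x \<in> S \<inter> U \<Longrightarrow> k x = Y x" "\<And>x. x \<in> S \<inter> U \<Longrightarrow> k' x = Z x"
      by (fact smooth_map_onE2[OF sm[OF f(2)] sm[OF f(3)] f(4)])
    note d = smooth_on_derivative[OF U(3,2)] smooth_on_derivative[OF U(4,2)]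
    have eq: "k x \<bullet> k' x = g x (Y x) (Z x)" if "x \<in> S \<inter> U" for x
      using metric[OF _ tan[OF f(2)] tan[OF f(3)], of x] U(5,6)[OF that] that by simp
    have "dir_deriv S (\<lambda>x. g x (Y x) (Z x)) p (X p) =
        k p \<bullet> frechet_derivative k' (at p) (X p) + frechet_derivative k (at p) (X p) \<bullet> k' p"
      by (rule dir_deriv_eq[OF tan[OF f(1,4)] U(1,2) eq bounded_bilinear.FDERIV[OF bounded_bilinear_inner d]])
    also have "\<dots> = Y p \<bullet> dir_deriv S Z p (X p) + dir_deriv S Y p (X p) \<bullet> Z p"
      using dir_deriv_eq[OF tan[OF f(1,4)] U(1,2,5) d(1)]
        dir_deriv_eq[OF tan[OF f(1,4)] U(1,2,6) d(2)] U(5,6)[of p] U(2) f(4) by simp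
    also have "\<dots> = g p (P p (dir_deriv S Y p (X p))) (Z p) + g p (Y p) (P p (dir_deriv S Z p (X p)))"
      using P_inner[OF f(4) tan[OF f(2,4)]] P_inner[OF f(4) tan[OF f(3,4)]]
        metric[OF f(4) P_in[OF f(4)] tan[OF f(3,4)]] metric[OF f(4) tan[OF f(2,4)] P_in[OF f(4)]]
      by (simp add: inner_commute)
    finally show "dir_deriv S (\<lambda>x. g x (Y x) (Z x)) p (X p) =
        g p (P p (dir_deriv S Y p (X p))) (Z p) + g p (Y p) (P p (dir_deriv S Z p (X p)))" .
  qed
qed

text \<open>The difference tensor of two Levi-Civita connections is symmetric in its first two and skew in
  its last two arguments, hence zero.\<close>

lemma levi_civita_unique:
  assumes D: "is_levi_civita S g D" and D': "is_levi_civita S g D'"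
    and "X \<in> vector_fields S" "Y \<in> vector_fields S" "p \<in> S"
  shows "D X Y p = D' X Y p"
proof -
  define \<delta> where "\<delta> X Y Z = (D X Y p - D' X Y p) \<bullet> Z p" for X Y Z
  have tan: "X p \<in> tangent_space S p" if "X \<in> vector_fields S" for X
    using that assms(5) by (auto simp: vector_fields_def)
  have cl: "D X Y \<in> vector_fields S" "D' X Y \<in> vector_fields S"
    if "X \<in> vector_fields S" "Y \<in> vector_fields S" for X Y
    using D D' that by (auto simp: is_levi_civita_def affine_connection_def)
  have sym: "\<delta> X Y Z = \<delta> Y X Z"
    if "X \<in> vector_fields S" "Y \<in> vector_fields S" for X Y Z
  proof -
    have "D X Y p - D Y X p = D' X Y p - D' Y X p"
      using D D' that assms(5) by (simp add: is_levi_civita_def)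
    then have "D X Y p - D' X Y p = D Y X p - D' Y X p" by (simp add: algebra_simps)
    then show ?thesis by (simp add: \<delta>_def)
  qed
  have skew: "\<delta> X Y Z = - \<delta> X Z Y"
    if f: "X \<in> vector_fields S" "Y \<in> vector_fields S" "Z \<in> vector_fields S" for X Y Z
  proof -
    have m: "dir_deriv S (\<lambda>x. g x (Y x) (Z x)) p (X p) = D X Y p \<bullet> Z p + Y p \<bullet> D X Z p"
      if "is_levi_civita S g D" and "D X Y \<in> vector_fields S" "D X Z \<in> vector_fields S" for D
    proof -
      have "dir_deriv S (\<lambda>x. g x (Y x) (Z x)) p (X p) = g p (D X Y p) (Z p) + g p (Y p) (D X Z p)"
        using that(1) f assms(5) unfolding is_levi_civita_def by blast
      then show ?thesis
        unfolding metric[OF assms(5) tan[OF that(2)] tan[OF f(3)]]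
          metric[OF assms(5) tan[OF f(2)] tan[OF that(3)]] .
    qed
    show ?thesis
      using m[OF D cl(1)[OF f(1,2)] cl(1)[OF f(1,3)]] m[OF D' cl(2)[OF f(1,2)] cl(2)[OF f(1,3)]]
      by (simp add: \<delta>_def inner_diff_left inner_diff_right inner_commute)
  qed
  have zero: "\<delta> X Y Z = 0" if Z: "Z \<in> vector_fields S" for Z
  proof -
    note f = assms(3,4) Z
    have "\<delta> X Y Z = - \<delta> Z X Y" using skew[OF f] sym[OF f(1,3), of Y] by simp
    also have "\<dots> = \<delta> Y Z X" using skew[OF f(3,1,2)] sym[OF f(2,3), of X] by simp
    also have "\<dots> = - \<delta> X Y Z" using skew[OF f(2,3,1)] sym[OF f(1,2), of Z] by simp
    finally show ?thesis by simp
  qed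
  \<comment> \<open>The difference is itself tangent, hence the value at \<open>p\<close> of some
    field \<open>Z\<close>; against this \<open>Z\<close> the tensor \<open>\<delta>\<close> gives
    its squared norm.\<close>
  have "D X Y p - D' X Y p \<in> tangent_space S p"
    using tangent_diff[OF assms(5) tan[OF cl(1)] tan[OF cl(2)]] assms(3,4) by blast
  then obtain Z where "Z \<in> vector_fields S" "Z p = D X Y p - D' X Y p"
    using tangent_extends assms(5) by blast
  then show ?thesis using zero[of Z] by (simp add: \<delta>_def)
qed

text \<open>Existence shows that the connection chosen by \<open>levi_civita\<close> is a genuine
  one, uniqueness then identifies it with the projected derivative.\<close>

lemma levi_civita_eq:
  assumes "X \<in> vector_fields S" "Y \<in> vector_fields S" "p \<in> S"
  shows "levi_civita S g X Y p = P p (dir_deriv S Y p (X p))"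
proof -
  have "is_levi_civita S g (levi_civita S g)"
    unfolding levi_civita_def by (rule someI[of "is_levi_civita S g", OF levi_civita_projection])
  from levi_civita_unique[OF this levi_civita_projection assms] show ?thesis .
qed

end

section \<open>Absolutely continuous functions\<close>

lemma abs_continuous_onD:
  assumes "abs_continuous_on I f" "\<epsilon> > 0"
  obtains \<delta> where "\<delta> > 0" "\<And>P. finite P \<Longrightarrow> (\<And>a b. (a, b) \<in> P \<Longrightarrow> a \<le> b \<and> {a..b} \<subseteq> I) \<Longrightarrow>
    disjoint_family_on (\<lambda>(a, b). {a<..<b}) P \<Longrightarrow> (\<Sum>(a, b)\<in>P. b - a) < \<delta> \<Longrightarrow>
    (\<Sum>(a, b)\<in>P. norm (f b - f a)) < \<epsilon>"
proof -
  obtain \<delta> where "\<delta> > 0" "\<forall>P. finite P \<longrightarrow> (\<forall>(a, b)\<in>P. a \<le> b \<and> {a..b} \<subseteq> I) \<longrightarrow>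
      disjoint_family_on (\<lambda>(a, b). {a<..<b}) P \<longrightarrow> (\<Sum>(a, b)\<in>P. b - a) < \<delta> \<longrightarrow>
      (\<Sum>(a, b)\<in>P. norm (f b - f a)) < \<epsilon>"
    using assms unfolding abs_continuous_on_def by meson
  then show thesis
    by (intro that[of \<delta>]) (simp_all add: case_prod_unfold)
qed

lemma abs_continuous_on_dominated:
  assumes f: "abs_continuous_on I f"
    and h: "\<And>a b. a \<in> I \<Longrightarrow> b \<in> I \<Longrightarrow> norm (h b - h a) \<le> c * norm (f b - f a)"
  shows "abs_continuous_on I h"
  unfolding abs_continuous_on_def
proof (intro allI impI)
  fix \<epsilon> :: real assume e: "\<epsilon> > 0"
  \<comment> \<open>A positive divisor of \<open>\<epsilon>\<close>; \<open>c\<close> itself may be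
    zero or negative.\<close>
  let ?c = "\<bar>c\<bar> + 1"
  have e': "\<epsilon> / ?c > 0" using e by (simp add: add_nonneg_pos)
  obtain \<delta> where d: "\<delta> > 0" "\<And>P. finite P \<Longrightarrow> (\<And>a b. (a, b) \<in> P \<Longrightarrow> a \<le> b \<and> {a..b} \<subseteq> I) \<Longrightarrow>
      disjoint_family_on (\<lambda>(a, b). {a<..<b}) P \<Longrightarrow> (\<Sum>(a, b)\<in>P. b - a) < \<delta> \<Longrightarrow>
      (\<Sum>(a, b)\<in>P. norm (f b - f a)) < \<epsilon> / ?c"
    by (fact abs_continuous_onD[OF f e'])
  have "(\<Sum>(a, b)\<in>P. norm (h b - h a)) < \<epsilon>"
    if P: "finite P" "\<forall>(a, b)\<in>P. a \<le> b \<and> {a..b} \<subseteq> I"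
      "disjoint_family_on (\<lambda>(a, b). {a<..<b}) P" "(\<Sum>(a, b)\<in>P. b - a) < \<delta>" for P
  proof -
    have "norm (h b - h a) \<le> ?c * norm (f b - f a)" if "(a, b) \<in> P" for a b
    proof -
      have "a \<le> b \<and> {a..b} \<subseteq> I" using P(2) that by fast
      then have "a \<in> I" "b \<in> I" by (simp_all add: subset_iff)
      then have "norm (h b - h a) \<le> c * norm (f b - f a)" by (rule h)
      also have "\<dots> \<le> ?c * norm (f b - f a)" by (intro mult_right_mono) auto
      finally show ?thesis .
    qed
    then have "(\<Sum>(a, b)\<in>P. norm (h b - h a)) \<le> (\<Sum>(a, b)\<in>P. ?c * norm (f b - f a))"
      by (intro sum_mono) auto
    also have "\<dots> = ?c * (\<Sum>(a, b)\<in>P. norm (f b - f a))"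
      by (simp add: sum_distrib_left case_prod_unfold)
    also have "\<dots> < ?c * (\<epsilon> / ?c)"
      using P d(2)[of P] by (intro mult_strict_left_mono) auto
    also have "\<dots> = \<epsilon>" using add_nonneg_pos[of "\<bar>c\<bar>" 1] by simp
    finally show ?thesis .
  qed
  then show "\<exists>\<delta>>0. \<forall>P. finite P \<longrightarrow> (\<forall>(a, b)\<in>P. a \<le> b \<and> {a..b} \<subseteq> I) \<longrightarrow>
      disjoint_family_on (\<lambda>(a, b). {a<..<b}) P \<longrightarrow> (\<Sum>(a, b)\<in>P. b - a) < \<delta> \<longrightarrow>
      (\<Sum>(a, b)\<in>P. norm (h b - h a)) < \<epsilon>"
    using d(1) by (intro exI[of _ \<delta>]) simp
qed

lemma abs_continuous_on_add:
  assumes f: "abs_continuous_on I f" and g: "abs_continuous_on I g"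
  shows "abs_continuous_on I (\<lambda>t. f t + g t)"
  unfolding abs_continuous_on_def
proof (intro allI impI)
  fix \<epsilon> :: real assume e: "\<epsilon> > 0"
  obtain \<delta> where d: "\<delta> > 0" "\<And>P. finite P \<Longrightarrow> (\<And>a b. (a, b) \<in> P \<Longrightarrow> a \<le> b \<and> {a..b} \<subseteq> I) \<Longrightarrow>
      disjoint_family_on (\<lambda>(a, b). {a<..<b}) P \<Longrightarrow> (\<Sum>(a, b)\<in>P. b - a) < \<delta> \<Longrightarrow>
      (\<Sum>(a, b)\<in>P. norm (f b - f a)) < \<epsilon> / 2"
    by (fact abs_continuous_onD[OF f half_gt_zero[OF e]])
  obtain \<delta>' where d': "\<delta>' > 0" "\<And>P. finite P \<Longrightarrow> (\<And>a b. (a, b) \<in> P \<Longrightarrow> a \<le> b \<and> {a..b} \<subseteq> I) \<Longrightarrow>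
      disjoint_family_on (\<lambda>(a, b). {a<..<b}) P \<Longrightarrow> (\<Sum>(a, b)\<in>P. b - a) < \<delta>' \<Longrightarrow>
      (\<Sum>(a, b)\<in>P. norm (g b - g a)) < \<epsilon> / 2"
    by (fact abs_continuous_onD[OF g half_gt_zero[OF e]])
  have "(\<Sum>(a, b)\<in>P. norm (f b + g b - (f a + g a))) < \<epsilon>"
    if P: "finite P" "\<forall>(a, b)\<in>P. a \<le> b \<and> {a..b} \<subseteq> I"
      "disjoint_family_on (\<lambda>(a, b). {a<..<b}) P" "(\<Sum>(a, b)\<in>P. b - a) < min \<delta> \<delta>'" for P
  proof -
    have "(\<Sum>(a, b)\<in>P. norm (f b + g b - (f a + g a))) \<le>
        (\<Sum>(a, b)\<in>P. norm (f b - f a) + norm (g b - g a))"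
      by (intro sum_mono) (auto simp: add_diff_add intro: norm_triangle_ineq)
    also have "\<dots> = (\<Sum>(a, b)\<in>P. norm (f b - f a)) + (\<Sum>(a, b)\<in>P. norm (g b - g a))"
      by (simp add: sum.distrib case_prod_unfold)
    also have "\<dots> < \<epsilon> / 2 + \<epsilon> / 2"
      using P by (intro add_strict_mono d(2) d'(2)) auto
    finally show ?thesis by simp
  qed
  then show "\<exists>\<delta>>0. \<forall>P. finite P \<longrightarrow> (\<forall>(a, b)\<in>P. a \<le> b \<and> {a..b} \<subseteq> I) \<longrightarrow>
      disjoint_family_on (\<lambda>(a, b). {a<..<b}) P \<longrightarrow> (\<Sum>(a, b)\<in>P. b - a) < \<delta> \<longrightarrow>
      (\<Sum>(a, b)\<in>P. norm (f b + g b - (f a + g a))) < \<epsilon>"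
    using d(1) d'(1) by (intro exI[of _ "min \<delta> \<delta>'"]) simp
qed

lemma abs_continuous_on_linear:
  assumes "bounded_linear L" "abs_continuous_on I f"
  shows "abs_continuous_on I (\<lambda>t. L (f t))"
proof -
  interpret bounded_linear L by fact
  obtain K where K: "\<And>x. norm (L x) \<le> norm x * K" using bounded by blast
  show ?thesis
    by (rule abs_continuous_on_dominated[OF assms(2), of _ K]) (metis K diff mult.commute)
qed

lemma abs_continuous_on_Pair:
  assumes "abs_continuous_on I f" "abs_continuous_on I g"
  shows "abs_continuous_on I (\<lambda>t. (f t, g t))"
proof -
  have "bounded_linear (\<lambda>x. (x, 0))" "bounded_linear (\<lambda>x. (0, x))"
    by (auto intro!: bounded_linear_Pair bounded_linear_ident bounded_linear_zero)
  from abs_continuous_on_add[OF abs_continuous_on_linear[OF this(1) assms(1)]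
      abs_continuous_on_linear[OF this(2) assms(2)]]
  show ?thesis by simp
qed

lemma abs_continuous_on_lipschitz:
  assumes "\<And>s t. s \<in> I \<Longrightarrow> t \<in> I \<Longrightarrow> norm (f t - f s) \<le> L * \<bar>t - s\<bar>"
  shows "abs_continuous_on I f"
proof (rule abs_continuous_on_dominated[of I "\<lambda>t. t"])
  show "abs_continuous_on I (\<lambda>t. t :: real)"
    unfolding abs_continuous_on_def
  proof (intro allI impI)
    fix \<epsilon> :: real assume "\<epsilon> > 0"
    moreover have "(\<Sum>(a, b)\<in>P. norm (b - a)) = (\<Sum>(a, b)\<in>P. b - a)"
      if "\<forall>(a, b)\<in>P. a \<le> b \<and> {a..b} \<subseteq> I" for P :: "(real \<times> real) set"
      using that by (intro sum.cong) auto
    ultimately show "\<exists>\<delta>>0. \<forall>P. finite P \<longrightarrow> (\<forall>(a, b)\<in>P. a \<le> b \<and> {a..b} \<subseteq> I) \<longrightarrow>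
        disjoint_family_on (\<lambda>(a, b). {a<..<b}) P \<longrightarrow> (\<Sum>(a, b)\<in>P. b - a) < \<delta> \<longrightarrow>
        (\<Sum>(a, b)\<in>P. norm (b - a)) < \<epsilon>"
      by (intro exI[of _ \<epsilon>]) simp
  qed
qed (use assms in auto)

lemma abs_continuous_on_const: "abs_continuous_on I (\<lambda>t. c)"
  by (rule abs_continuous_on_lipschitz[of _ _ 0]) simp

lemma abs_continuous_on_cong:
  assumes "abs_continuous_on I f" "\<And>t. t \<in> I \<Longrightarrow> f t = g t"
  shows "abs_continuous_on I g"
  by (rule abs_continuous_on_dominated[OF assms(1), of _ 1]) (simp add: assms(2))

lemma abs_continuous_on_subset:
  assumes "abs_continuous_on I f" "J \<subseteq> I"
  shows "abs_continuous_on J f"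
  unfolding abs_continuous_on_def
proof (intro allI impI)
  fix \<epsilon> :: real assume e: "\<epsilon> > 0"
  obtain \<delta> where "\<delta> > 0" and d: "\<And>P. finite P \<Longrightarrow> (\<And>a b. (a, b) \<in> P \<Longrightarrow> a \<le> b \<and> {a..b} \<subseteq> I) \<Longrightarrow>
      disjoint_family_on (\<lambda>(a, b). {a<..<b}) P \<Longrightarrow> (\<Sum>(a, b)\<in>P. b - a) < \<delta> \<Longrightarrow>
      (\<Sum>(a, b)\<in>P. norm (f b - f a)) < \<epsilon>"
    by (fact abs_continuous_onD[OF assms(1) e])
  have "(\<Sum>(a, b)\<in>P. norm (f b - f a)) < \<epsilon>"
    if "finite P" "\<forall>(a, b)\<in>P. a \<le> b \<and> {a..b} \<subseteq> J"
      "disjoint_family_on (\<lambda>(a, b). {a<..<b}) P" "(\<Sum>(a, b)\<in>P. b - a) < \<delta>" for P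
  proof (rule d)
    show "a \<le> b \<and> {a..b} \<subseteq> I" if "(a, b) \<in> P" for a b
      using \<open>\<forall>(a, b)\<in>P. a \<le> b \<and> {a..b} \<subseteq> J\<close> that assms(2) by fast
  qed (use that in auto)
  with \<open>\<delta> > 0\<close> show "\<exists>\<delta>>0. \<forall>P. finite P \<longrightarrow> (\<forall>(a, b)\<in>P. a \<le> b \<and> {a..b} \<subseteq> J) \<longrightarrow>
      disjoint_family_on (\<lambda>(a, b). {a<..<b}) P \<longrightarrow> (\<Sum>(a, b)\<in>P. b - a) < \<delta> \<longrightarrow>
      (\<Sum>(a, b)\<in>P. norm (f b - f a)) < \<epsilon>"
    by blast
qed

lemma abs_continuous_on_imp_continuous_on:
  assumes "abs_continuous_on {a..b} f"
  shows "continuous_on {a..b} f"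
  unfolding continuous_on_iff
proof (intro ballI allI impI)
  fix x \<epsilon> :: real assume x: "x \<in> {a..b}" and e: "\<epsilon> > 0"
  obtain \<delta> where "\<delta> > 0" and d: "\<And>P. finite P \<Longrightarrow> (\<And>u v. (u, v) \<in> P \<Longrightarrow> u \<le> v \<and> {u..v} \<subseteq> {a..b}) \<Longrightarrow>
      disjoint_family_on (\<lambda>(u, v). {u<..<v}) P \<Longrightarrow> (\<Sum>(u, v)\<in>P. v - u) < \<delta> \<Longrightarrow>
      (\<Sum>(u, v)\<in>P. norm (f v - f u)) < \<epsilon>"
    by (fact abs_continuous_onD[OF assms e])
  \<comment> \<open>A single interval is an admissible family and yields the modulus of
    continuity.\<close>
  have 1: "norm (f v - f u) < \<epsilon>" if "u \<le> v" "u \<in> {a..b}" "v \<in> {a..b}" "v - u < \<delta>" for u v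
    using d[of "{(u, v)}"] that by (auto simp: disjoint_family_on_def)
  have "dist (f y) (f x) < \<epsilon>" if "y \<in> {a..b}" "dist y x < \<delta>" for y
    using 1[of x y] 1[of y x] x that by (cases "x \<le> y") (auto simp: dist_norm norm_minus_commute)
  with \<open>\<delta> > 0\<close> show "\<exists>d>0. \<forall>y\<in>{a..b}. dist y x < d \<longrightarrow> dist (f y) (f x) < \<epsilon>" by blast
qed

lemma abs_continuous_on_bounded:
  assumes "abs_continuous_on {a..b} f"
  obtains M where "M > 0" "\<And>t. t \<in> {a..b} \<Longrightarrow> norm (f t) \<le> M"
proof -
  have "bounded (f ` {a..b})"
    by (intro compact_imp_bounded compact_continuous_image abs_continuous_on_imp_continuous_on assms) simp
  then show thesis using that by (auto simp: bounded_pos)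
qed

lemma abs_continuous_on_bilinear:
  assumes B: "bounded_bilinear B" and f: "abs_continuous_on {a..b} f" and g: "abs_continuous_on {a..b} g"
  shows "abs_continuous_on {a..b} (\<lambda>t. B (f t) (g t))"
  unfolding abs_continuous_on_def
proof (intro allI impI)
  interpret bounded_bilinear B by fact
  obtain K where K: "K > 0" "\<And>x y. norm (B x y) \<le> norm x * norm y * K"
    using pos_bounded by blast
  obtain M where M: "M > 0" "\<And>t. t \<in> {a..b} \<Longrightarrow> norm (f t) \<le> M" by (fact abs_continuous_on_bounded[OF f])
  obtain N where N: "N > 0" "\<And>t. t \<in> {a..b} \<Longrightarrow> norm (g t) \<le> N" by (fact abs_continuous_on_bounded[OF g])
  fix \<epsilon> :: real assume e: "\<epsilon> > 0"
  have eN: "\<epsilon> / (2 * N * K) > 0" and eM: "\<epsilon> / (2 * M * K) > 0" using e M(1) N(1) K(1) by auto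
  obtain \<delta> where d: "\<delta> > 0" "\<And>P. finite P \<Longrightarrow> (\<And>u v. (u, v) \<in> P \<Longrightarrow> u \<le> v \<and> {u..v} \<subseteq> {a..b}) \<Longrightarrow>
      disjoint_family_on (\<lambda>(u, v). {u<..<v}) P \<Longrightarrow> (\<Sum>(u, v)\<in>P. v - u) < \<delta> \<Longrightarrow>
      (\<Sum>(u, v)\<in>P. norm (f v - f u)) < \<epsilon> / (2 * N * K)"
    by (fact abs_continuous_onD[OF f eN])
  obtain \<delta>' where d': "\<delta>' > 0" "\<And>P. finite P \<Longrightarrow> (\<And>u v. (u, v) \<in> P \<Longrightarrow> u \<le> v \<and> {u..v} \<subseteq> {a..b}) \<Longrightarrow>
      disjoint_family_on (\<lambda>(u, v). {u<..<v}) P \<Longrightarrow> (\<Sum>(u, v)\<in>P. v - u) < \<delta>' \<Longrightarrow>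
      (\<Sum>(u, v)\<in>P. norm (g v - g u)) < \<epsilon> / (2 * M * K)"
    by (fact abs_continuous_onD[OF g eM])
  have "(\<Sum>(u, v)\<in>P. norm (B (f v) (g v) - B (f u) (g u))) < \<epsilon>"
    if P: "finite P" "\<forall>(u, v)\<in>P. u \<le> v \<and> {u..v} \<subseteq> {a..b}"
      "disjoint_family_on (\<lambda>(u, v). {u<..<v}) P" "(\<Sum>(u, v)\<in>P. v - u) < min \<delta> \<delta>'" for P
  proof -
    have "norm (B (f v) (g v) - B (f u) (g u)) \<le>
        (N * K) * norm (f v - f u) + (M * K) * norm (g v - g u)" if "(u, v) \<in> P" for u v
    proof -
      have uv: "u \<in> {a..b}" "v \<in> {a..b}" using P(2) that by auto
      \<comment> \<open>Changing one factor at a time; the bounds \<open>M\<close> and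
        \<open>N\<close> absorb the factor that stays, which explains the choice of
        \<open>\<epsilon> / (2 * N * K)\<close> and \<open>\<epsilon> / (2 * M * K)\<close>.\<close>
      have "B (f v) (g v) - B (f u) (g u) = B (f v - f u) (g v) + B (f u) (g v - g u)"
        by (simp add: diff_left diff_right)
      also have "norm \<dots> \<le> norm (f v - f u) * norm (g v) * K + norm (f u) * norm (g v - g u) * K"
        by (intro order_trans[OF norm_triangle_ineq] add_mono K)
      also have "\<dots> \<le> norm (f v - f u) * N * K + M * norm (g v - g u) * K"
        using uv K(1) M(1) by (intro add_mono mult_right_mono mult_left_mono N(2) M(2)) auto
      finally show ?thesis by (simp add: algebra_simps)
    qed
    then have "(\<Sum>(u, v)\<in>P. norm (B (f v) (g v) - B (f u) (g u))) \<le>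
        (\<Sum>(u, v)\<in>P. (N * K) * norm (f v - f u) + (M * K) * norm (g v - g u))"
      by (intro sum_mono) auto
    also have "\<dots> = (N * K) * (\<Sum>(u, v)\<in>P. norm (f v - f u)) + (M * K) * (\<Sum>(u, v)\<in>P. norm (g v - g u))"
      by (simp add: sum.distrib sum_distrib_left case_prod_unfold)
    also have "\<dots> < (N * K) * (\<epsilon> / (2 * N * K)) + (M * K) * (\<epsilon> / (2 * M * K))"
      using P M N K by (intro add_strict_mono mult_strict_left_mono d(2) d'(2)) auto
    also have "\<dots> = \<epsilon>" using M N K by (simp add: field_simps)
    finally show ?thesis .
  qed
  then show "\<exists>\<delta>>0. \<forall>P. finite P \<longrightarrow> (\<forall>(u, v)\<in>P. u \<le> v \<and> {u..v} \<subseteq> {a..b}) \<longrightarrow>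
      disjoint_family_on (\<lambda>(u, v). {u<..<v}) P \<longrightarrow> (\<Sum>(u, v)\<in>P. v - u) < \<delta> \<longrightarrow>
      (\<Sum>(u, v)\<in>P. norm (B (f v) (g v) - B (f u) (g u))) < \<epsilon>"
    using d(1) d'(1) by (intro exI[of _ "min \<delta> \<delta>'"]) simp
qed

text \<open>A gauge that traps the tags in the exceptional set inside an open set of small measure, where
  absolute continuity controls the increments, and uses the vanishing derivative elsewhere.\<close>

lemma abs_continuous_on_zero_derivative_endpoints:
  fixes f :: "real \<Rightarrow> 'a::euclidean_space"
  assumes ac: "abs_continuous_on {a..b} f" and ab: "a \<le> b" and N: "negligible N"
    and der: "\<And>t. t \<in> {a..b} - N \<Longrightarrow> (f has_vector_derivative 0) (at t within {a..b})"
  shows "f b = f a"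
proof -
  have "norm (f b - f a) \<le> e" if e: "e > 0" for e
  proof -
    \<comment> \<open>The intervals with tags outside \<open>N\<close> contribute at most
      \<open>\<eta> * (b - a)\<close> in all; the summand \<open>1\<close> keeps the divisor
      positive when \<open>a = b\<close>.\<close>
    define \<eta> where "\<eta> = e / (2 * (b - a + 1))"
    have \<eta>: "\<eta> > 0" using e ab by (simp add: \<eta>_def)
    have \<eta>e: "\<eta> * (b - a) \<le> e / 2"
      using e ab by (simp add: \<eta>_def field_simps)
    obtain \<delta> where "\<delta> > 0" and d: "\<And>P. finite P \<Longrightarrow> (\<And>u v. (u, v) \<in> P \<Longrightarrow> u \<le> v \<and> {u..v} \<subseteq> {a..b}) \<Longrightarrow>
        disjoint_family_on (\<lambda>(u, v). {u<..<v}) P \<Longrightarrow> (\<Sum>(u, v)\<in>P. v - u) < \<delta> \<Longrightarrow>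
        (\<Sum>(u, v)\<in>P. norm (f v - f u)) < e / 2"
      by (fact abs_continuous_onD[OF ac half_gt_zero[OF e]])
    have Nm: "N \<in> lmeasurable" "measure lebesgue N = 0"
      using N by (simp_all add: negligible_imp_measurable negligible_imp_measure0)
    then obtain T where T: "open T" "N \<subseteq> T" "T - N \<in> lmeasurable" "emeasure lebesgue (T - N) < ennreal \<delta>"
      using sets_lebesgue_outer_open[of N \<delta>] \<open>\<delta> > 0\<close> by (auto simp: fmeasurableD)
    have T3: "T \<in> lmeasurable"
      using fmeasurable.Un[OF Nm(1) T(3)] T(2) by (simp add: Un_absorb1)
    have "measure lebesgue T \<le> measure lebesgue N + measure lebesgue (T - N)"
      using measure_Un_le[of N lebesgue "T - N"] Nm(1) T(2,3) by (simp add: fmeasurableD Un_absorb1)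
    also have "measure lebesgue (T - N) < \<delta>"
      using T(3,4) \<open>\<delta> > 0\<close> by (simp add: emeasure_eq_measure2 ennreal_less_iff)
    finally have T4: "measure lebesgue T < \<delta>" using Nm(2) by simp
    have "\<exists>r>0. t \<in> {a..b} - N \<longrightarrow> (\<forall>y\<in>{a..b}. \<bar>y - t\<bar> < r \<longrightarrow> norm (f y - f t) \<le> \<eta> * \<bar>y - t\<bar>)" for t
    proof (cases "t \<in> {a..b} - N")
      case True
      then have "(f has_derivative (\<lambda>h. 0)) (at t within {a..b})"
        using der by (simp add: has_vector_derivative_def)
      then show ?thesis
        using \<eta> unfolding has_derivative_within_alt by (auto simp: norm_minus_commute)
    qed (auto intro: zero_less_one)
    then obtain r where r: "\<And>t. r t > 0"
      "\<And>t y. t \<in> {a..b} - N \<Longrightarrow> y \<in> {a..b} \<Longrightarrow> \<bar>y - t\<bar> < r t \<Longrightarrow> norm (f y - f t) \<le> \<eta> * \<bar>y - t\<bar>"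
      by metis
    define G where "G x = (if x \<in> N then T else ball x (r x))" for x
    have "gauge G" using T r by (auto simp: gauge_def G_def)
    then obtain p where p: "p tagged_division_of {a..b}" "G fine p"
      using fine_division_exists_real by blast
    note pd = tagged_division_ofD[OF p(1)]
    define p1 where "p1 = {z \<in> p. fst z \<in> N}"
    define p2 where "p2 = {z \<in> p. fst z \<notin> N}"
    have pp: "p = p1 \<union> p2" "p1 \<inter> p2 = {}" "finite p1" "finite p2"
      using pd(1) by (auto simp: p1_def p2_def)
    have K: "\<exists>u v. K = {u..v} \<and> u \<le> x \<and> x \<le> v \<and> a \<le> u \<and> v \<le> b \<and> Inf K = u \<and> Sup K = v"
      if xK: "(x, K) \<in> p" for x K
    proof -
      obtain u v where "K = {u..v}" using pd(4)[OF xK] by (metis box_real(2))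
      then show ?thesis using pd(2,3)[OF xK] by (intro exI[of _ u] exI[of _ v]) auto
    qed
    have "f b - f a = (\<Sum>(x, K)\<in>p. f (Sup K) - f (Inf K))"
      by (rule additive_tagged_division_1[OF ab p(1), symmetric])
    also have "\<dots> = (\<Sum>(x, K)\<in>p1. f (Sup K) - f (Inf K)) + (\<Sum>(x, K)\<in>p2. f (Sup K) - f (Inf K))"
      unfolding pp(1) by (rule sum.union_disjoint) (use pp in auto)
    also have "norm \<dots> \<le> e / 2 + e / 2"
    proof (rule order_trans[OF norm_triangle_ineq], rule add_mono)
      \<comment> \<open>Absolute continuity is about sets of endpoint pairs, so tagged intervals
        must not collapse when the tags are forgotten. Two of them with equal endpoints but
        different tags would have overlapping interiors.\<close>
      have inj: "x = y" if KL: "(x, K) \<in> p" "(y, L) \<in> p" "Inf K = Inf L" "Sup K = Sup L" for x y K L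
      proof (rule ccontr)
        assume "x \<noteq> y"
        then have "interior K \<inter> interior L = {}" using pd(5)[OF KL(1,2)] by auto
        moreover obtain u v where "K = {u..v}" "u \<le> x" "x \<le> v" "L = {u..v}" "u \<le> y" "y \<le> v"
          using K[OF KL(1)] K[OF KL(2)] KL(3,4) by auto
        ultimately have "{u<..<v} = {}" by (simp add: interior_atLeastAtMost_real)
        then have "v \<le> u" by simp
        then show False using \<open>x \<noteq> y\<close> \<open>u \<le> x\<close> \<open>x \<le> v\<close> \<open>u \<le> y\<close> \<open>y \<le> v\<close> by simp
      qed
      define h where "h = (\<lambda>(x::real, K::real set). (Inf K, Sup K))"
      have inj_h: "inj_on h p1"
      proof (rule inj_onI, clarsimp simp: h_def p1_def)
        fix x K y L assume "(x, K) \<in> p" "(y, L) \<in> p" "Inf K = Inf L" "Sup K = Sup L"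
        then show "x = y \<and> K = L" using inj[of x K y L] K[of x K] K[of y L] by auto
      qed
      have len: "(\<Sum>(u, v)\<in>h ` p1. v - u) = measure lebesgue (\<Union>(snd ` p1))"
      proof -
        have part: "p1 tagged_partial_division_of {a..b}"
          using tagged_partial_division_subset[of p "{a..b}" p1] p(1) pp(1) by (auto simp: tagged_division_of_def)
        have "measure lebesgue (\<Union>(snd ` p1)) = sum (measure lebesgue) (snd ` p1)"
          using content_division[OF partial_division_of_tagged_division[OF part]] by simp
        also have "\<dots> = (\<Sum>z\<in>p1. measure lebesgue (snd z))"
        proof (rule sum.reindex_cong[of snd])
          show "inj_on snd p1" using inj by (auto simp: inj_on_def p1_def)
        qed auto
        also have "\<dots> = (\<Sum>(u, v)\<in>h ` p1. v - u)"
        proof (rule sum.reindex_cong[of h, symmetric])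
          show "(case h z of (u, v) \<Rightarrow> v - u) = measure lebesgue (snd z)" if zp: "z \<in> p1" for z
          proof -
            obtain x K where z: "z = (x, K)" by (cases z)
            moreover obtain u v where "K = {u..v}" "Inf K = u" "Sup K = v" "u \<le> v"
              using K[of x K] zp z by (auto simp: p1_def)
            ultimately show ?thesis by (simp add: h_def measure_completion)
          qed
        qed (use inj_h in auto)
        finally show ?thesis ..
      qed
      have "norm (\<Sum>(x, K)\<in>p1. f (Sup K) - f (Inf K)) \<le> (\<Sum>(x, K)\<in>p1. norm (f (Sup K) - f (Inf K)))"
        by (rule order_trans[OF norm_sum]) (simp add: case_prod_unfold)
      also have "\<dots> = (\<Sum>(u, v)\<in>h ` p1. norm (f v - f u))"
        by (rule sum.reindex_cong[of h, symmetric]) (use inj_h in \<open>auto simp: h_def\<close>)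
      also have "\<dots> < e / 2"
      proof (rule d)
        show "finite (h ` p1)" using pp(3) by simp
        show "u \<le> v \<and> {u..v} \<subseteq> {a..b}" if uv: "(u, v) \<in> h ` p1" for u v
        proof -
          obtain x K where "(x, K) \<in> p" "u = Inf K" "v = Sup K"
            using uv by (auto simp: h_def p1_def)
          moreover have "Inf K \<le> Sup K \<and> a \<le> Inf K \<and> Sup K \<le> b" using K[of x K] calculation by linarith
          ultimately show ?thesis by auto
        qed
        show "disjoint_family_on (\<lambda>(u, v). {u<..<v}) (h ` p1)"
          unfolding disjoint_family_on_def
        proof (intro ballI impI)
          fix m n assume "m \<in> h ` p1" "n \<in> h ` p1" "m \<noteq> n"
          then obtain x K y L where *: "(x, K) \<in> p" "m = (Inf K, Sup K)" "(y, L) \<in> p" "n = (Inf L, Sup L)"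
            "(x, K) \<noteq> (y, L)" by (auto simp: h_def p1_def)
          have "interior K \<inter> interior L = {}" using pd(5) * by blast
          then show "(case m of (u, v) \<Rightarrow> {u<..<v}) \<inter> (case n of (u, v) \<Rightarrow> {u<..<v}) = {}"
          proof -
            obtain u v where "K = {u..v}" "Inf K = u" "Sup K = v" using K[OF *(1)] by blast
            moreover obtain u' v' where "L = {u'..v'}" "Inf L = u'" "Sup L = v'" using K[OF *(3)] by blast
            ultimately show ?thesis
              using \<open>interior K \<inter> interior L = {}\<close> *(2,4)
              by (simp add: interior_atLeastAtMost_real del: greaterThanLessThan_empty_iff Int_greaterThanLessThan)
          qed
        qed
        \<comment> \<open>Fineness puts every interval with a tag in \<open>N\<close> inside
          \<open>T\<close>, so the total length of these intervals is below
          \<open>\<delta>\<close>.\<close>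
        have "measure lebesgue (\<Union>(snd ` p1)) \<le> measure lebesgue T"
        proof (rule measure_mono_fmeasurable)
          show "\<Union>(snd ` p1) \<subseteq> T"
            using p(2) by (fastforce simp: fine_def G_def p1_def)
          have "closed (\<Union>(snd ` p1))"
          proof (rule closed_Union)
            show "\<forall>S\<in>snd ` p1. closed S"
            proof
              fix S assume "S \<in> snd ` p1"
              then obtain x where "(x, S) \<in> p" by (auto simp: p1_def)
              then obtain u v where "S = {u..v}" using K by blast
              then show "closed S" by simp
            qed
          qed (use pp in auto)
          then show "\<Union>(snd ` p1) \<in> sets lebesgue" by (simp add: borel_closed sets_completionI_sets)
        qed (rule T3)
        then show "(\<Sum>(u, v)\<in>h ` p1. v - u) < \<delta>" using len T4 by simp
      qed
      finally show "norm (\<Sum>(x, K)\<in>p1. f (Sup K) - f (Inf K)) \<le> e / 2" by simp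
      have *: "norm (f (Sup K) - f (Inf K)) \<le> \<eta> * measure lborel K" if z: "(x, K) \<in> p2" for x K
      proof -
        have xp: "(x, K) \<in> p" "x \<notin> N" using z by (auto simp: p2_def)
        obtain u v where uv: "K = {u..v}" "u \<le> x" "x \<le> v" "a \<le> u" "v \<le> b" "Inf K = u" "Sup K = v"
          using K[OF xp(1)] by blast
        have "K \<subseteq> G x" using p(2) xp(1) unfolding fine_def by fast
        then have "K \<subseteq> ball x (r x)" using xp(2) by (simp add: G_def)
        moreover have "u \<in> K" "v \<in> K" using uv by simp_all
        ultimately have "u \<in> ball x (r x)" "v \<in> ball x (r x)" by blast+
        then have "norm (f u - f x) \<le> \<eta> * \<bar>u - x\<bar>" "norm (f v - f x) \<le> \<eta> * \<bar>v - x\<bar>"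
          using r(2)[of x u] r(2)[of x v] uv xp by (auto simp: dist_real_def abs_minus_commute)
        \<comment> \<open>The tag lies between the endpoints, so the two distances add up to the
          length of the interval.\<close>
        then have "norm ((f v - f x) - (f u - f x)) \<le> \<eta> * \<bar>v - x\<bar> + \<eta> * \<bar>u - x\<bar>"
          using norm_triangle_ineq4[of "f v - f x" "f u - f x"] by linarith
        also have "\<dots> = \<eta> * measure lborel K" using uv by (simp add: algebra_simps)
        finally show ?thesis using uv by simp
      qed
      have "norm (\<Sum>(x, K)\<in>p2. f (Sup K) - f (Inf K)) \<le> (\<Sum>(x, K)\<in>p2. \<eta> * measure lborel K)"
        by (intro sum_norm_le) (use * in auto)
      also have "\<dots> \<le> (\<Sum>(x, K)\<in>p. \<eta> * measure lborel K)"
        by (intro sum_mono2) (use \<eta> pd(1) in \<open>auto simp: p2_def\<close>)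
      also have "\<dots> = \<eta> * (\<Sum>(x, K)\<in>p. measure lborel K)"
        by (simp add: sum_distrib_left case_prod_unfold)
      also have "\<dots> = \<eta> * (b - a)"
        using additive_content_tagged_division[of p a b] p(1) ab by simp
      finally show "norm (\<Sum>(x, K)\<in>p2. f (Sup K) - f (Inf K)) \<le> e / 2" using \<eta>e by simp
    qed
    finally show ?thesis by simp
  qed
  then show ?thesis using field_le_epsilon[of "norm (f b - f a)" 0] by simp
qed

lemma abs_continuous_on_zero_derivative_const:
  assumes ac: "abs_continuous_on {a..b} f"
    and der: "AE t in lborel. t \<in> {a..b} \<longrightarrow> (f has_vector_derivative 0) (at t within {a..b})"
    and t: "t \<in> {a..b}"
  shows "f t = f a"
proof -
  obtain N where N: "N \<in> null_sets lborel"
    "{t \<in> space lborel. \<not> (t \<in> {a..b} \<longrightarrow> (f has_vector_derivative 0) (at t within {a..b}))} \<subseteq> N"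
    using der by (auto elim!: AE_E simp: null_sets_def)
  show ?thesis
  proof (rule abs_continuous_on_zero_derivative_endpoints)
    show "abs_continuous_on {a..t} f" by (rule abs_continuous_on_subset[OF ac]) (use t in auto)
    show "negligible N"
      using N(1) by (simp add: negligible_iff_null_sets null_sets_completionI)
    show "(f has_vector_derivative 0) (at s within {a..t})" if "s \<in> {a..t} - N" for s
      by (rule has_vector_derivative_within_subset[of _ _ _ "{a..b}"]) (use N(2) that t in auto)
  qed (use t in auto)
qed

section \<open>Orthogonal matrices\<close>

declare transpose_matrix_vector [simp del]

lemmas mm_simps = bounded_bilinear.add_left[OF bounded_bilinear_matrix_mult]
  bounded_bilinear.add_right[OF bounded_bilinear_matrix_mult]
  bounded_bilinear.diff_left[OF bounded_bilinear_matrix_mult]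
  bounded_bilinear.diff_right[OF bounded_bilinear_matrix_mult]
  bounded_bilinear.minus_left[OF bounded_bilinear_matrix_mult]
  bounded_bilinear.minus_right[OF bounded_bilinear_matrix_mult]
  bounded_bilinear.scaleR_left[OF bounded_bilinear_matrix_mult]
  bounded_bilinear.scaleR_right[OF bounded_bilinear_matrix_mult]
  bounded_bilinear.zero_left[OF bounded_bilinear_matrix_mult]
  bounded_bilinear.zero_right[OF bounded_bilinear_matrix_mult]
  matrix_mul_lid matrix_mul_rid

lemmas mv_simps = bounded_bilinear.add_left[OF bounded_bilinear_matrix_vector_mult]
  bounded_bilinear.add_right[OF bounded_bilinear_matrix_vector_mult]
  bounded_bilinear.diff_left[OF bounded_bilinear_matrix_vector_mult]
  bounded_bilinear.diff_right[OF bounded_bilinear_matrix_vector_mult]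
  bounded_bilinear.minus_left[OF bounded_bilinear_matrix_vector_mult]
  bounded_bilinear.minus_right[OF bounded_bilinear_matrix_vector_mult]
  bounded_bilinear.scaleR_left[OF bounded_bilinear_matrix_vector_mult]
  bounded_bilinear.scaleR_right[OF bounded_bilinear_matrix_vector_mult]
  bounded_bilinear.zero_left[OF bounded_bilinear_matrix_vector_mult]
  bounded_bilinear.zero_right[OF bounded_bilinear_matrix_vector_mult]
  matrix_vector_mul_lid

lemmas linear_transpose = bounded_linear.linear[OF bounded_linear_transpose]

lemmas tr_simps = linear_add[OF linear_transpose] linear_diff[OF linear_transpose]
  linear_neg[OF linear_transpose] linear_scale[OF linear_transpose] linear_0[OF linear_transpose]
  matrix_transpose_mul transpose_mat transpose_transpose

lemma matrix_cancel:
  fixes A :: "real^'n^'m"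
  assumes "A ** B = mat 1"
  shows "A ** (B ** X) = X" "A *v (B *v x) = x"
  using assms by (simp_all add: matrix_mul_assoc matrix_vector_mul_assoc)

lemma orthogonal_matrixD:
  fixes A :: "real^'n^'n"
  assumes "orthogonal_matrix A"
  shows "transpose A ** A = mat 1" "A ** transpose A = mat 1"
  using assms by (auto simp: orthogonal_matrix_def)

text \<open>The determinant is \<open>1\<close> or \<open>-1\<close>, and squaring removes the sign.
  A rotation through an angle is the square of the one through half of it, and this takes the place
  of connectedness arguments for determinant \<open>1\<close>.\<close>

lemma det_orthogonal_square:
  fixes A :: "real^'n^'n"
  assumes "orthogonal_matrix A"
  shows "det (A ** A) = 1"
  using det_orthogonal_matrix[OF assms] by (auto simp: det_mul)

text \<open>The inner product of matrices is that of Frobenius. With this adjoint, left translation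
  by an orthogonal matrix is isometric, so the ambient inner product is left invariant on
  rotations.\<close>

lemma inner_matrix_mult_left:
  fixes A :: "real^'n^'m" and B :: "real^'p^'n"
  shows "(A ** B) \<bullet> D = B \<bullet> (transpose A ** D)"
proof -
  have "(A ** B) \<bullet> D = (\<Sum>i\<in>UNIV. \<Sum>j\<in>UNIV. \<Sum>k\<in>UNIV. A $ i $ k * B $ k $ j * D $ i $ j)"
    by (simp add: inner_vec_def matrix_matrix_mult_def sum_distrib_right)
  also have "\<dots> = (\<Sum>i\<in>UNIV. \<Sum>k\<in>UNIV. \<Sum>j\<in>UNIV. A $ i $ k * B $ k $ j * D $ i $ j)"
    by (rule sum.cong[OF refl], rule sum.swap)
  also have "\<dots> = (\<Sum>k\<in>UNIV. \<Sum>i\<in>UNIV. \<Sum>j\<in>UNIV. A $ i $ k * B $ k $ j * D $ i $ j)"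
    by (rule sum.swap)
  also have "\<dots> = (\<Sum>k\<in>UNIV. \<Sum>j\<in>UNIV. \<Sum>i\<in>UNIV. A $ i $ k * B $ k $ j * D $ i $ j)"
    by (rule sum.cong[OF refl], rule sum.swap)
  also have "\<dots> = B \<bullet> (transpose A ** D)"
    by (simp add: inner_vec_def matrix_matrix_mult_def transpose_def sum_distrib_left algebra_simps)
  finally show ?thesis .
qed

lemma inner_matrix_vector_left:
  fixes A :: "real^'n^'m"
  shows "(A *v x) \<bullet> y = x \<bullet> (transpose A *v y)"
  using dot_lmul_matrix[of y A x] by (simp add: inner_commute transpose_matrix_vector)

lemma inner_transpose: "transpose A \<bullet> (B :: real^'n^'m) = A \<bullet> transpose B"
proof -
  have "transpose A \<bullet> B = (\<Sum>i\<in>UNIV. \<Sum>j\<in>UNIV. A $ j $ i * B $ i $ j)"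
    by (simp add: inner_vec_def transpose_def)
  also have "\<dots> = (\<Sum>j\<in>UNIV. \<Sum>i\<in>UNIV. A $ j $ i * B $ i $ j)" by (rule sum.swap)
  finally show ?thesis by (simp add: inner_vec_def transpose_def)
qed

subsection \<open>The Cayley transform\<close>

text \<open>This is \<open>(1 + M) (1 - M)^-1\<close>, written with a single inverse so that
  \<open>(cay M + 1) / 2\<close> is visibly the inverse of \<open>1 - M\<close>. Unlike the
  exponential it has a rational inverse, which is what the charts need.\<close>

definition cay :: "real^'n^'n \<Rightarrow> real^'n^'n" where
  "cay M = 2 *\<^sub>R matrix_inv (mat 1 - M) - mat 1"

definition cay_inv :: "real^'n^'n \<Rightarrow> real^'n^'n" where
  "cay_inv R = mat 1 - 2 *\<^sub>R matrix_inv (R + mat 1)"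

lemma matrix_inv_unique:
  fixes A :: "real^'n^'n"
  assumes "A ** B = mat 1"
  shows "det A \<noteq> 0" "matrix_inv A = B"
proof -
  show d: "det A \<noteq> 0"
    using det_mul[of A B] assms by auto
  have "matrix_inv A = matrix_inv A ** (A ** B)" using assms by simp
  also have "\<dots> = B" by (rule matrix_cancel(1)[OF matrix_inv_mult(2)[OF d]])
  finally show "matrix_inv A = B" .
qed

lemma skew_inner: "transpose M = - M \<Longrightarrow> (M *v x) \<bullet> x = 0" for M :: "real^'n^'n"
  using dot_lmul_matrix[of x M x] by (simp add: mv_simps inner_commute flip: transpose_matrix_vector)

text \<open>The quadratic form of a skew matrix vanishes, so \<open>M x = x\<close> forces
  \<open>x \<bullet> x = 0\<close> and \<open>1 - M\<close> has no kernel.\<close>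

lemma det_one_minus_skew:
  fixes M :: "real^'n^'n"
  assumes "transpose M = - M"
  shows "det (mat 1 - M) \<noteq> 0"
proof -
  have "x = 0" if "(mat 1 - M) *v x = 0" for x
  proof -
    have "M *v x = x" using that by (simp add: mv_simps)
    then show ?thesis using skew_inner[OF assms, of x] by simp
  qed
  then show ?thesis
    using matrix_left_invertible_ker[of "mat 1 - M"] invertible_left_inverse[of "mat 1 - M"]
    by (simp add: invertible_det_nz)
qed

lemma cay_skew:
  fixes M :: "real^'n^'n"
  assumes "transpose M = - M"
  shows "orthogonal_matrix (cay M)" "det (cay M) = 1"
    "det (cay M + mat 1) \<noteq> 0" "cay_inv (cay M) = M"
proof -
  define K where "K = matrix_inv (mat 1 - M)"
  note d = det_one_minus_skew[OF assms]
  have K: "(mat 1 - M) ** K = mat 1" "K ** (mat 1 - M) = mat 1"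
    using matrix_inv_mult[OF d] by (simp_all add: K_def)
  have tr: "transpose (mat 1 - M) = mat 1 + M" using assms by (simp add: tr_simps)
  have KT: "transpose K ** (mat 1 + M) = mat 1"
    using arg_cong[OF K(1), of transpose] tr by (simp add: matrix_transpose_mul)
  \<comment> \<open>Padding \<open>K\<close> by \<open>transpose K ** (mat 1 + M)\<close> and
    \<open>transpose K\<close> by \<open>(mat 1 - M) ** K\<close> makes \<open>M\<close> cancel. The
    resulting identity is orthogonality in disguise.\<close>
  have "K + transpose K = transpose K ** (mat 1 + M) ** K + transpose K ** ((mat 1 - M) ** K)"
    using KT K by simp
  also have "\<dots> = 2 *\<^sub>R (transpose K ** K)"
    by (simp add: matrix_mul_assoc mm_simps) (simp add: scaleR_2)
  finally have KK: "K + transpose K = 2 *\<^sub>R (transpose K ** K)" .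
  have "transpose (cay M) ** cay M = 4 *\<^sub>R (transpose K ** K) - 2 *\<^sub>R (K + transpose K) + mat 1"
    by (simp add: cay_def K_def[symmetric] tr_simps mm_simps algebra_simps)
  then show "orthogonal_matrix (cay M)" by (simp add: orthogonal_matrix KK)
  have "cay M = (2 *\<^sub>R mat 1 - (mat 1 - M)) ** K"
    using K by (simp add: cay_def K_def[symmetric] mm_simps(3,7) mm_simps(11))
  also have "2 *\<^sub>R mat 1 - (mat 1 - M) = transpose (mat 1 - M)"
    by (simp add: tr scaleR_2)
  \<comment> \<open>In this form the determinant is that of \<open>mat 1 - M\<close> times that of
    its inverse.\<close>
  finally have "cay M = transpose (mat 1 - M) ** K" .
  then have "det (cay M) = det (mat 1 - M) * det K" by (simp add: det_mul)
  also have "\<dots> = 1" using arg_cong[OF K(1), of det] by (simp add: det_mul)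
  finally show "det (cay M) = 1" .
  have "(cay M + mat 1) ** ((1/2) *\<^sub>R (mat 1 - M)) = mat 1"
    using K(2) by (simp add: cay_def K_def[symmetric] mm_simps(7,8))
  from matrix_inv_unique[OF this]
  show "det (cay M + mat 1) \<noteq> 0" "cay_inv (cay M) = M" by (simp_all add: cay_inv_def)
qed

lemma cay_inv_orthogonal:
  fixes R :: "real^'n^'n"
  assumes "orthogonal_matrix R" "det (R + mat 1) \<noteq> 0"
  shows "transpose (cay_inv R) = - cay_inv R" "cay (cay_inv R) = R"
proof -
  define K where "K = matrix_inv (R + mat 1)"
  have K: "(R + mat 1) ** K = mat 1" "K ** (R + mat 1) = mat 1"
    using matrix_inv_mult[OF assms(2)] by (simp_all add: K_def)
  have KT: "transpose K ** (transpose R + mat 1) = mat 1"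
    using arg_cong[OF K(1), of transpose] by (simp add: tr_simps)
  have "K + transpose K = transpose K ** (transpose R + mat 1) ** K + transpose K ** ((R + mat 1) ** K)"
    using KT K by simp
  also have "\<dots> = transpose K ** ((transpose R + mat 1) + (R + mat 1)) ** K"
    by (simp only: mm_simps(1,2) matrix_mul_assoc)
  \<comment> \<open>Orthogonality of \<open>R\<close> enters here: it turns the sum into a product
    whose factors are inverted by \<open>transpose K\<close> and \<open>K\<close>.\<close>
  also have "(transpose R + mat 1) + (R + mat 1) = (transpose R + mat 1) ** (R + mat 1)"
    using orthogonal_matrixD(1)[OF assms(1)] by (simp add: mm_simps(1,2) ac_simps)
  also have "transpose K ** ((transpose R + mat 1) ** (R + mat 1)) ** K =
      transpose K ** (transpose R + mat 1) ** ((R + mat 1) ** K)"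
    by (simp only: matrix_mul_assoc)
  also have "\<dots> = mat 1" by (simp only: KT K matrix_mul_lid)
  finally have s: "K + transpose K = mat 1" .
  have "transpose (cay_inv R) + cay_inv R = 2 *\<^sub>R mat 1 - 2 *\<^sub>R (K + transpose K)"
    unfolding cay_inv_def K_def[symmetric] tr_simps scaleR_2 by (simp add: algebra_simps)
  then show "transpose (cay_inv R) = - cay_inv R" by (simp add: s eq_neg_iff_add_eq_0)
  have "(mat 1 - cay_inv R) ** ((1/2) *\<^sub>R (R + mat 1)) = mat 1"
    using K(2) by (simp add: cay_inv_def K_def[symmetric] mm_simps(7,8))
  from matrix_inv_unique(2)[OF this] show "cay (cay_inv R) = R" by (simp add: cay_def)
qed

lemma smooth_on_cay:
  fixes f :: "'a::euclidean_space \<Rightarrow> real^'n^'n"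
  assumes "open U" "smooth_on U f" "\<And>x. x \<in> U \<Longrightarrow> transpose (f x) = - f x"
  shows "smooth_on U (\<lambda>x. cay (f x))"
  unfolding cay_def
  by (intro smooth_intros smooth_on_matrix_inv assms(1,2)) (simp add: det_one_minus_skew assms(3))

lemma smooth_on_cay_inv:
  fixes f :: "'a::euclidean_space \<Rightarrow> real^'n^'n"
  assumes "open U" "smooth_on U f" "\<And>x. x \<in> U \<Longrightarrow> det (f x + mat 1) \<noteq> 0"
  shows "smooth_on U (\<lambda>x. cay_inv (f x))"
  unfolding cay_inv_def by (intro smooth_intros smooth_on_matrix_inv assms)

text \<open>At \<open>0\<close> the derivative of \<open>cay\<close> doubles its argument, hence the
  parameter \<open>t / 2\<close>. It is found from
  \<open>cay (t M / 2) (1 - t M / 2) = 1 + t M / 2\<close>, which spares differentiating a matrix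
  inverse.\<close>

lemma cay_curve_derivative:
  fixes M :: "real^'n^'n"
  assumes "transpose M = - M"
  shows "smooth_on UNIV (\<lambda>t. cay ((t / 2) *\<^sub>R M))"
    "((\<lambda>t. cay ((t / 2) *\<^sub>R M)) has_vector_derivative M) (at 0)"
proof -
  have sk: "transpose ((t / 2) *\<^sub>R M) = - ((t / 2) *\<^sub>R M)" for t
    using assms by (simp add: tr_simps)
  have "smooth_on UNIV (\<lambda>t. (1/2) *\<^sub>R (t *\<^sub>R M))" by (intro smooth_intros open_UNIV)
  then show sm: "smooth_on UNIV (\<lambda>t. cay ((t / 2) *\<^sub>R M))"
    by (intro smooth_on_cay open_UNIV sk) simp
  let ?c = "\<lambda>t. cay ((t / 2) *\<^sub>R M)"
  have "\<exists>D. (?c has_derivative D) (at 0)" using smooth_on_derivative[OF sm] by blast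
  then obtain d where d: "(?c has_vector_derivative d) (at 0)"
    by (metis differentiable_def vector_derivative_works)
  have 1: "((\<lambda>t. ?c t ** (mat 1 - (t / 2) *\<^sub>R M)) has_vector_derivative
      ?c 0 ** (- (1/2) *\<^sub>R M) + d ** (mat 1 - (0 / 2) *\<^sub>R M)) (at 0)"
    by (rule bounded_bilinear.has_vector_derivative[OF bounded_bilinear_matrix_mult d])
      (auto intro!: derivative_eq_intros)
  have eq: "?c t ** (mat 1 - (t / 2) *\<^sub>R M) = mat 1 + (t / 2) *\<^sub>R M" for t
  proof -
    have "?c t ** (mat 1 - (t / 2) *\<^sub>R M) = 2 *\<^sub>R mat 1 - (mat 1 - (t / 2) *\<^sub>R M)"
      unfolding cay_def mm_simps(3)[of "2 *\<^sub>R X" for X] mm_simps(7)[of 2]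
        matrix_inv_mult(2)[OF det_one_minus_skew[OF sk]] by simp
    then show ?thesis by (simp add: scaleR_2)
  qed
  have 2: "((\<lambda>t. mat 1 + (t / 2) *\<^sub>R M) has_vector_derivative (1/2) *\<^sub>R M) (at 0)"
    by (auto intro!: derivative_eq_intros)
  have c0: "?c 0 = mat 1" using eq[of 0] by simp
  have "- (1/2) *\<^sub>R M + d = (1/2) *\<^sub>R M"
    using vector_derivative_unique_at[OF 1[unfolded eq] 2] c0 by simp
  then have "d = (1/2) *\<^sub>R M + (1/2) *\<^sub>R M" by (simp add: algebra_simps)
  then show "(?c has_vector_derivative M) (at 0)"
    using d by (simp flip: scaleR_left_distrib)
qed

subsection \<open>Rotations about an axis\<close>

text \<open>Rodrigues' formula. When \<open>N\<close> cubed is \<open>- N\<close> this is the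
  exponential of \<open>t N\<close>, in any dimension.\<close>

definition rot :: "real^'n^'n \<Rightarrow> real \<Rightarrow> real^'n^'n" where
  "rot N t = mat 1 + sin t *\<^sub>R N + (1 - cos t) *\<^sub>R (N ** N)"

lemma rot_0 [simp]: "rot N 0 = mat 1"
  by (simp add: rot_def)

lemma rot_2pi [simp]: "rot N (2 * pi) = mat 1"
  by (simp add: rot_def)

lemma rot_4pi [simp]: "rot N (4 * pi) = mat 1"
  using sin_2npi[of 2] cos_2npi[of 2] by (simp add: rot_def)

locale rotation_axis =
  fixes N :: "real^'n^'n"
  assumes skew: "transpose N = - N" and cube: "N ** (N ** N) = - N"
begin

lemma rot_mult: "rot N s ** rot N t = rot N (s + t)"
proof -
  have c4: "N ** (N ** (N ** N)) = - (N ** N)" using cube by (simp add: mm_simps)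
  have "rot N s ** rot N t = mat 1 + (sin s * cos t + cos s * sin t) *\<^sub>R N +
      (1 - (cos s * cos t - sin s * sin t)) *\<^sub>R (N ** N)"
    by (simp add: rot_def mm_simps cube c4 matrix_mul_assoc[symmetric] algebra_simps)
  then show ?thesis by (simp add: rot_def sin_add cos_add)
qed

lemma transpose_rot: "transpose (rot N t) = rot N (- t)"
  by (simp add: rot_def tr_simps skew mm_simps)

lemma orthogonal_rot: "orthogonal_matrix (rot N t)"
  by (simp add: orthogonal_matrix transpose_rot rot_mult)

lemma rot_square: "rot N t = rot N (t / 2) ** rot N (t / 2)"
  by (simp add: rot_mult)

lemma det_rot: "det (rot N t) = 1"
  by (subst rot_square) (rule det_orthogonal_square[OF orthogonal_rot])

lemma rot_derivative:
  "((\<lambda>t. rot N (c * t)) has_vector_derivative rot N (c * t) ** (c *\<^sub>R N)) (at t within I)"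
proof -
  have "((\<lambda>t. rot N (c * t)) has_vector_derivative
      (cos (c * t) * c) *\<^sub>R N + (sin (c * t) * c) *\<^sub>R (N ** N)) (at t within I)"
    unfolding rot_def by (auto intro!: derivative_eq_intros simp: algebra_simps)
  moreover have "rot N (c * t) ** (c *\<^sub>R N) = (cos (c * t) * c) *\<^sub>R N + (sin (c * t) * c) *\<^sub>R (N ** N)"
    by (simp add: rot_def mm_simps cube matrix_mul_assoc[symmetric] algebra_simps)
  ultimately show ?thesis by simp
qed

end

text \<open>The matrix \<open>2 n n^T - 1\<close>. For a unit vector it is minus the reflection in
  the plane orthogonal to \<open>n\<close>, which in dimension three is the rotation by \<pi> about
  \<open>n\<close>.\<close>

definition half_turn :: "real^'n \<Rightarrow> real^'n^'n" where
  "half_turn n = (\<chi> i j. 2 * (n $ i * n $ j)) - mat 1"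

lemma half_turn_apply: "half_turn n *v v = (2 * (n \<bullet> v)) *\<^sub>R n - v"
proof -
  have "(\<chi> i j. 2 * (n $ i * n $ j)) *v v = (2 * (n \<bullet> v)) *\<^sub>R n"
    by (simp add: vec_eq_iff matrix_vector_mult_def inner_vec_def sum_distrib_left sum_distrib_right
        algebra_simps)
  then show ?thesis by (simp add: half_turn_def mv_simps)
qed

lemma half_turn_apply_axis: "norm n = 1 \<Longrightarrow> half_turn n *v n = n"
  unfolding half_turn_apply by (simp add: dot_square_norm scaleR_2)

lemma half_turn_apply_orthogonal: "n \<bullet> v = 0 \<Longrightarrow> half_turn n *v v = - v"
  by (simp add: half_turn_apply)

lemma half_turn_square:
  assumes "norm n = 1"
  shows "half_turn n ** half_turn n = mat 1"
proof -
  have "n \<bullet> n = 1" using assms by (simp add: dot_square_norm)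
  then have "n \<bullet> (half_turn n *v v) = n \<bullet> v" for v
    by (simp add: half_turn_apply inner_diff_right)
  then have "half_turn n *v (half_turn n *v v) = v" for v
    by (subst half_turn_apply) (simp, simp add: half_turn_apply)
  then show ?thesis
    by (simp add: matrix_eq matrix_vector_mul_assoc)
qed

lemma half_turn_rotation:
  fixes n :: "real^3"
  assumes "norm n = 1"
  shows "rotation_matrix (half_turn n)"
proof -
  have "transpose (half_turn n) = half_turn n"
    by (simp add: half_turn_def transpose_def vec_eq_iff mat_def mult.commute)
  then have "orthogonal_matrix (half_turn n)"
    using half_turn_square[OF assms] by (simp add: orthogonal_matrix)
  moreover have "det (half_turn n) = 2 * (n \<bullet> n) - 1"
    by (simp add: half_turn_def det_3 mat_def inner_vec_def sum_3) algebra
  ultimately show ?thesis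
    using assms by (simp add: rotation_matrix_def dot_square_norm)
qed

text \<open>The axis is the bisector of the two vectors, and its half-turn exchanges them. For
  \<open>u = - e\<close> there is no bisector and the caller has to find another axis.\<close>

lemma half_turn_swap:
  fixes u e :: "real^'n"
  assumes "norm u = 1" "norm e = 1" "u \<noteq> - e"
  shows "norm ((1 / norm (u + e)) *\<^sub>R (u + e)) = 1"
    "half_turn ((1 / norm (u + e)) *\<^sub>R (u + e)) *v u = e"
proof -
  have nz: "norm (u + e) \<noteq> 0" using assms(3) by (simp add: eq_neg_iff_add_eq_0)
  then show "norm ((1 / norm (u + e)) *\<^sub>R (u + e)) = 1" by simp
  have uu: "u \<bullet> u = 1" "e \<bullet> e = 1" using assms by (simp_all add: dot_square_norm)
  have "(norm (u + e))\<^sup>2 = 2 * ((u + e) \<bullet> u)"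
    unfolding power2_norm_eq_inner by (simp add: inner_add_left inner_add_right uu inner_commute)
  then have "2 * ((u + e) \<bullet> u) = norm (u + e) * norm (u + e)" by (simp only: power2_eq_square)
  then have c: "2 * ((u + e) \<bullet> u) / (norm (u + e) * norm (u + e)) = 1"
    using nz by (simp only: divide_self mult_eq_0_iff simp_thms)
  have "half_turn ((1 / norm (u + e)) *\<^sub>R (u + e)) *v u =
      (2 * ((u + e) \<bullet> u) / (norm (u + e) * norm (u + e))) *\<^sub>R (u + e) - u"
    by (simp add: half_turn_apply)
  then have "half_turn ((1 / norm (u + e)) *\<^sub>R (u + e)) *v u = 1 *\<^sub>R (u + e) - u"
    by (simp only: c)
  then show "half_turn ((1 / norm (u + e)) *\<^sub>R (u + e)) *v u = e" by simp
qed

lemma rotation_matrix_mult: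
  fixes A B :: "real^'n^'n"
  shows
  "rotation_matrix A \<Longrightarrow> rotation_matrix B \<Longrightarrow> rotation_matrix (A ** B)"
  by (simp add: rotation_matrix_def det_mul orthogonal_matrix_mul)

text \<open>A rotation commutes with the cross product, so the images of the first two basis vectors
  determine that of the third.\<close>

lemma rotation_matrix_eqI:
  fixes A B :: "real^3^3"
  assumes "rotation_matrix A" "rotation_matrix B"
    "A *v axis 1 1 = B *v axis 1 1" "A *v axis 2 1 = B *v axis 2 1"
  shows "A = B"
proof -
  have "A *v axis 3 1 = B *v axis 3 1"
    using cross_rotation_matrix[OF assms(1), of "axis 1 1" "axis 2 1"]
      cross_rotation_matrix[OF assms(2), of "axis 1 1" "axis 2 1"] assms(3,4)
    by (simp add: cross_basis)
  then have "A *v axis k 1 = B *v axis k 1" for k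
    using assms(3,4) exhaust_3[of k] by auto
  then have "column k A = column k B" for k by (metis matrix_vector_mult_basis)
  then show ?thesis by (simp add: column_def vec_eq_iff)
qed

text \<open>Half-turns generate the rotation group: one moves \<open>A e\<^sub>1\<close> back to \<open>e\<^sub>1\<close>, a second one about an
  axis orthogonal to \<open>e\<^sub>1\<close> then moves the image of \<open>e\<^sub>2\<close> back to \<open>e\<^sub>2\<close>.\<close>

lemma rotation_half_turn_induct:
  fixes A :: "real^3^3"
  assumes A: "rotation_matrix A"
    and one: "P (mat 1)"
    and step: "\<And>A n. rotation_matrix A \<Longrightarrow> norm n = 1 \<Longrightarrow> P A \<Longrightarrow> P (A ** half_turn n)"
  shows "P A"
proof -
  let ?e1 = "axis 1 1 :: real^3" and ?e2 = "axis 2 1 :: real^3"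
  have rot1: "rotation_matrix (mat 1 :: real^3^3)"
    by (simp add: rotation_matrix_def orthogonal_matrix_id)
  have e: "?e1 \<bullet> ?e1 = 1" "?e2 \<bullet> ?e2 = 1" "?e1 \<bullet> ?e2 = 0" "?e2 \<bullet> ?e1 = 0" "norm ?e1 = 1" "norm ?e2 = 1"
    by (simp_all add: inner_axis_axis)
  have n: "norm (B *v x) = norm x" "(B *v x) \<bullet> (B *v y) = x \<bullet> y" if "rotation_matrix B" for B :: "real^3^3" and x y
  proof -
    have o: "orthogonal_transformation ((*v) B)"
      using that by (simp add: rotation_matrix_def orthogonal_transformation_matrix)
    show "norm (B *v x) = norm x" using o by (rule orthogonal_transformation_norm)
    show "(B *v x) \<bullet> (B *v y) = x \<bullet> y" using o by (simp add: orthogonal_transformation_def)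
  qed
  have "\<exists>m. norm m = 1 \<and> half_turn m *v (A *v ?e1) = ?e1"
  proof (cases "A *v ?e1 = - ?e1")
    case True
    \<comment> \<open>The antipodal case, where the bisector degenerates: a half-turn about any axis
      orthogonal to \<open>?e1\<close> does it.\<close>
    then show ?thesis using e by (intro exI[of _ ?e2]) (simp add: half_turn_apply)
  next
    case False
    then show ?thesis using half_turn_swap[of "A *v ?e1" ?e1] n(1)[OF A] e(5) by metis
  qed
  then obtain m where m: "norm m = 1" "half_turn m *v (A *v ?e1) = ?e1" by blast
  define B where "B = half_turn m ** A"
  have B: "rotation_matrix B" using rotation_matrix_mult[OF half_turn_rotation[OF m(1)] A] by (simp add: B_def)
  have Be1: "B *v ?e1 = ?e1" using m(2) by (simp add: B_def matrix_vector_mul_assoc)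
  have AB: "A = half_turn m ** B"
    by (simp add: B_def matrix_mul_assoc half_turn_square[OF m(1)])
  have P1: "P (mat 1 ** half_turn m)" by (intro step rot1 m one)
  show ?thesis
  proof (cases "B *v ?e2 = - ?e2")
    case True
    \<comment> \<open>\<open>B\<close> fixes \<open>?e1\<close> and negates \<open>?e2\<close>,
      which leaves only this half-turn.\<close>
    have "B = half_turn ?e1"
      by (rule rotation_matrix_eqI[OF B half_turn_rotation]) (use e True Be1 in \<open>simp_all add: half_turn_apply_axis half_turn_apply_orthogonal\<close>)
    then show ?thesis using step[OF _ _ P1, of ?e1] e half_turn_rotation[OF m(1)] by (simp add: AB)
  next
    case False
    define k where "k = (1 / norm (B *v ?e2 + ?e2)) *\<^sub>R (B *v ?e2 + ?e2)"
    have k: "norm k = 1" "half_turn k *v (B *v ?e2) = ?e2"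
      using half_turn_swap[of "B *v ?e2" ?e2] n(1)[OF B] e False by (simp_all add: k_def)
    have "(B *v ?e2) \<bullet> ?e1 = (B *v ?e2) \<bullet> (B *v ?e1)" by (simp add: Be1)
    also have "\<dots> = 0" by (simp only: n(2)[OF B] e)
    finally have "k \<bullet> ?e1 = 0" using e by (simp add: k_def inner_add_left)
    then have ke: "half_turn k *v ?e1 = - ?e1" by (simp add: half_turn_apply)
    \<comment> \<open>As \<open>k\<close> is orthogonal to \<open>?e1\<close>, the half-turn about
      it negates \<open>?e1\<close> while it brings \<open>B *v ?e2\<close> back to
      \<open>?e2\<close>. What results is therefore a third half-turn, about \<open>?e2\<close>, and
      not the identity.\<close>
    have "half_turn k ** B = half_turn ?e2"
      by (rule rotation_matrix_eqI[OF rotation_matrix_mult[OF half_turn_rotation[OF k(1)] B] half_turn_rotation])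
        (use e k ke Be1 in \<open>simp_all add: half_turn_apply_axis half_turn_apply_orthogonal flip: matrix_vector_mul_assoc\<close>)
    then have "B = half_turn k ** half_turn ?e2"
      by (metis half_turn_square[OF k(1)] matrix_mul_assoc matrix_mul_lid)
    then have "A = mat 1 ** half_turn m ** half_turn k ** half_turn ?e2" by (simp add: AB matrix_mul_assoc)
    moreover have "P (mat 1 ** half_turn m ** half_turn k ** half_turn ?e2)"
      by (intro step P1 rotation_matrix_mult half_turn_rotation rot1 m k e)
    ultimately show ?thesis by simp
  qed
qed

section \<open>The geometry of SE(3)\<close>

lemma exhaust_6:
  fixes x :: 6
  shows "x = 1 \<or> x = 2 \<or> x = 3 \<or> x = 4 \<or> x = 5 \<or> x = 6"
proof (induct x)
  case (of_int z)
  then have "0 \<le> z" "z < 6" by simp_all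
  then have "z = 0 \<or> z = 1 \<or> z = 2 \<or> z = 3 \<or> z = 4 \<or> z = 5" by arith
  then show ?case by auto
qed

lemma forall_6: "(\<forall>i::6. P i) \<longleftrightarrow> P 1 \<and> P 2 \<and> P 3 \<and> P 4 \<and> P 5 \<and> P 6"
  by (metis exhaust_6)

lemma UNIV_6: "UNIV = {1, 2, 3, 4, 5, 6 :: 6}"
  using exhaust_6 by auto

lemma sum_6: "sum f (UNIV :: 6 set) = f 1 + f 2 + f 3 + f 4 + f 5 + f 6"
  unfolding UNIV_6 by (simp add: ac_simps)

lemma prod_6: "prod f (UNIV :: 6 set) = f 1 * f 2 * f 3 * f 4 * f 5 * f 6"
  unfolding UNIV_6 by (simp add: ac_simps)

text \<open>The inclusions of the rotational and of the translational coordinates into \<open>\<real>\<^sup>6\<close>.\<close>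

definition emb1 :: "real^3^6" where
  "emb1 = (\<chi> i k. if (i = 1 \<and> k = 1) \<or> (i = 2 \<and> k = 2) \<or> (i = 3 \<and> k = 3) then 1 else 0)"

definition emb2 :: "real^3^6" where
  "emb2 = (\<chi> i k. if (i = 4 \<and> k = 1) \<or> (i = 5 \<and> k = 2) \<or> (i = 6 \<and> k = 3) then 1 else 0)"

lemma emb_mult [simp]:
  "transpose emb1 ** emb1 = mat 1" "transpose emb2 ** emb2 = mat 1"
  "transpose emb1 ** emb2 = 0" "transpose emb2 ** emb1 = 0"
  by (simp_all add: vec_eq_iff matrix_matrix_mult_def transpose_def mat_def forall_3 sum_6
      emb1_def emb2_def)

lemma emb_complete: "emb1 ** transpose emb1 + emb2 ** transpose emb2 = mat 1"
  by (simp add: vec_eq_iff matrix_matrix_mult_def transpose_def mat_def forall_6 sum_3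
      emb1_def emb2_def)

lemma emb1_vec: "transpose emb1 *v u = vector [u $ 1, u $ 2, u $ 3]"
  by (simp add: vec_eq_iff matrix_vector_mult_def transpose_def forall_3 sum_6 emb1_def)

lemma emb2_vec: "transpose emb2 *v u = vector [u $ 4, u $ 5, u $ 6]"
  by (simp add: vec_eq_iff matrix_vector_mult_def transpose_def forall_3 sum_6 emb2_def)

text \<open>The element of the Lie algebra of rotations with frame coordinates \<open>a\<close>:
  these fill the entries (1,2), (1,3), (2,3) in the order of the frame. Up to the factor it is the
  cross product matrix of \<open>(- a_3, a_2, - a_1)\<close>, so the identification with axes
  reverses orientation.\<close>

definition om :: "real^3 \<Rightarrow> real^3^3" where
  "om a = (1 / sqrt 2) *\<^sub>R vector [vector [0, a $ 1, a $ 2], vector [- a $ 1, 0, a $ 3],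
     vector [- a $ 2, - a $ 3, 0]]"

text \<open>Reading only the upper triangle makes this linear on all matrices. The inverse charts
  are thereby defined on ambient open sets, where the matrices are not skew.\<close>

definition vee :: "real^3^3 \<Rightarrow> real^3" where
  "vee M = sqrt 2 *\<^sub>R vector [M $ 1 $ 2, M $ 1 $ 3, M $ 2 $ 3]"

lemma linear_om: "linear om"
  by (rule linearI) (simp_all add: om_def vec_eq_iff forall_3 field_simps)

lemma linear_vee: "linear vee"
  by (rule linearI) (simp_all add: vee_def vec_eq_iff forall_3 algebra_simps)

lemma transpose_om: "transpose (om a) = - om a"
  by (simp add: om_def vec_eq_iff forall_3 transpose_def)

lemma vee_om: "vee (om a) = a"
  by (simp add: om_def vee_def vec_eq_iff forall_3)

lemma om_vee:
  assumes "transpose M = - M"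
  shows "om (vee M) = M"
proof -
  have *: "M $ j $ i = - M $ i $ j" for i j
    using arg_cong[OF assms, of "\<lambda>A. A $ i $ j"] by (simp add: transpose_def)
  have "M $ 1 $ 1 = 0" "M $ 2 $ 2 = 0" "M $ 3 $ 3 = 0"
    using *[of 1 1] *[of 2 2] *[of 3 3] by linarith+
  moreover have "M $ 2 $ 1 = - M $ 1 $ 2" "M $ 3 $ 1 = - M $ 1 $ 3" "M $ 3 $ 2 = - M $ 2 $ 3"
    by (fact *)+
  ultimately show ?thesis
    by (simp add: om_def vee_def vec_eq_iff forall_3)
qed

lemma inner_om: "om a \<bullet> om b = a \<bullet> b"
  by (simp add: om_def inner_vec_def sum_3)

section \<open>The left invariant frame and the tangent spaces of SE(3)\<close>

definition frame_comb :: "se3_ambient \<Rightarrow> real^6 \<Rightarrow> se3_ambient" where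
  "frame_comb p u = (fst p ** om (transpose emb1 *v u), fst p *v (transpose emb2 *v u))"

lemma se3_frame_eq: "se3_frame i p = frame_comb p (axis i 1)"
proof -
  obtain C r where p: "p = (C, r)" by (cases p)
  have "\<forall>i. se3_frame i p = frame_comb p (axis i 1)"
    unfolding forall_6 p frame_comb_def emb1_vec emb2_vec
    by (simp add: se3_frame_def rotation_field_def translation_field_def om_def axis_def vec_eq_iff forall_3 matrix_matrix_mult_def
        matrix_vector_mult_def sum_3)
  then show ?thesis by blast
qed

lemma linear_frame_comb: "linear (frame_comb p)"
  by (rule linearI) (simp_all add: frame_comb_def mv_simps mm_simps linear_add[OF linear_om]
      linear_scale[OF linear_om])

text \<open>Linearity in the base point makes every frame field the restriction of an ambient linear
  map, whose derivative in direction \<open>v\<close> is \<open>frame_comb v u\<close>. This is why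
  a tangent vector is later inserted where a point is expected.\<close>

lemma linear_frame_comb_point: "linear (\<lambda>p. frame_comb p u)"
  by (rule linearI) (simp_all add: frame_comb_def mv_simps mm_simps)

lemma linear_axis_expansion:
  fixes L :: "real^'n \<Rightarrow> 'b::real_vector"
  assumes "linear L"
  shows "L u = (\<Sum>i\<in>UNIV. u $ i *\<^sub>R L (axis i 1))"
proof -
  have "L u = L (\<Sum>i\<in>UNIV. u $ i *\<^sub>R axis i 1)"
    using basis_expansion[of u] by (simp add: scalar_mult_eq_scaleR)
  then show ?thesis by (simp add: linear_sum[OF assms] linear_scale[OF assms])
qed

lemma frame_comb_sum: "frame_comb p u = (\<Sum>i\<in>UNIV. u $ i *\<^sub>R se3_frame i p)"
  unfolding se3_frame_eq by (rule linear_axis_expansion[OF linear_frame_comb])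

lemma SE3_iff: "p \<in> SE3 \<longleftrightarrow> rotation_matrix (fst p)"
  by (cases p) (simp add: SE3_def rotation_matrix_def)

lemma SE3_orthogonal:
  assumes "p \<in> SE3"
  shows "transpose (fst p) ** fst p = mat 1" "fst p ** transpose (fst p) = mat 1"
  using assms orthogonal_matrixD[of "fst p"] by (auto simp: SE3_iff rotation_matrix_def)

definition frame_inv :: "se3_ambient \<Rightarrow> se3_ambient \<Rightarrow> real^6" where
  "frame_inv p v = emb1 *v vee (transpose (fst p) ** fst v) + emb2 *v (transpose (fst p) *v snd v)"

lemma emb_complete_vec: "emb1 *v (transpose emb1 *v u) + emb2 *v (transpose emb2 *v u) = u"
  using arg_cong[OF emb_complete, of "\<lambda>A. A *v u"] by (simp add: mv_simps matrix_vector_mul_assoc)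

lemma emb_proj:
  "transpose emb1 *v (emb1 *v a + emb2 *v b) = a" "transpose emb2 *v (emb1 *v a + emb2 *v b) = b"
  by (simp_all add: mv_simps matrix_vector_mul_assoc)

lemma frame_inv_comb: "p \<in> SE3 \<Longrightarrow> frame_inv p (frame_comb p u) = u"
  by (simp add: frame_inv_def frame_comb_def matrix_cancel[OF SE3_orthogonal(1)] vee_om emb_complete_vec)

lemma frame_comb_inv:
  assumes "p \<in> SE3" "transpose (transpose (fst p) ** fst v) = - (transpose (fst p) ** fst v)"
  shows "frame_comb p (frame_inv p v) = v"
  by (simp add: frame_inv_def frame_comb_def emb_proj om_vee[OF assms(2)]
      matrix_cancel[OF SE3_orthogonal(2)[OF assms(1)]])

lemma frame_coords_se3:
  assumes "p \<in> SE3"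
  shows "frame_coords se3_frame p (frame_comb p u) = u"
  unfolding frame_coords_def frame_comb_sum[symmetric]
proof (rule the_equality)
  fix c assume "frame_comb p u = frame_comb p c"
  then have "frame_inv p (frame_comb p u) = frame_inv p (frame_comb p c)" by simp
  then show "c = u" by (simp add: frame_inv_comb[OF assms])
qed simp

lemma frame_comb_skew:
  assumes "p \<in> SE3"
  shows "transpose (transpose (fst p) ** fst (frame_comb p u)) = - (transpose (fst p) ** fst (frame_comb p u))"
  using assms by (simp add: frame_comb_def matrix_cancel[OF SE3_orthogonal(1)] transpose_om)

text \<open>Differentiating \<open>transpose C ** C = 1\<close> along the curve shows that the
  velocity is skew in body coordinates. The derivative is taken within \<open>I\<close>, because
  rollings live on closed intervals and are differentiable only almost everywhere.\<close>

lemma SE3_curve_velocity: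
  assumes d: "(x has_vector_derivative v) (at t within I)" and I: "at t within I \<noteq> bot" "t \<in> I"
    and x: "\<And>s. s \<in> I \<Longrightarrow> x s \<in> SE3"
  shows "v = frame_comb (x t) (frame_inv (x t) v)"
proof -
  let ?C = "\<lambda>s. fst (x s)"
  have C: "(?C has_vector_derivative fst v) (at t within I)"
    by (rule bounded_linear.has_vector_derivative[OF bounded_linear_fst d])
  have "((\<lambda>s. transpose (?C s) ** ?C s) has_vector_derivative
      transpose (?C t) ** fst v + transpose (fst v) ** ?C t) (at t within I)"
    by (rule bounded_bilinear.has_vector_derivative[OF bounded_bilinear_matrix_mult
          bounded_linear.has_vector_derivative[OF bounded_linear_transpose C] C])
  moreover have "((\<lambda>s. transpose (?C s) ** ?C s) has_vector_derivative 0) (at t within I)"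
    by (rule has_vector_derivative_transform[OF I(2) _ has_vector_derivative_const[of "mat 1"]])
      (simp add: SE3_orthogonal x)
  ultimately have "transpose (?C t) ** fst v + transpose (fst v) ** ?C t = 0"
    by (rule vector_derivative_unique_within[OF I(1)])
  then have "transpose (transpose (?C t) ** fst v) = - (transpose (?C t) ** fst v)"
    by (simp add: tr_simps eq_neg_iff_add_eq_0 add.commute)
  from frame_comb_inv[OF x[OF I(2)] this] show ?thesis ..
qed

lemma tangent_space_SE3:
  assumes p: "p \<in> SE3"
  shows "tangent_space SE3 p = range (frame_comb p)"
proof (intro equalityI subsetI)
  fix v assume "v \<in> tangent_space SE3 p"
  then obtain \<gamma> e where g: "e > 0" "\<gamma> ` {-e<..<e} \<subseteq> SE3" "\<gamma> 0 = p" "(\<gamma> has_vector_derivative v) (at 0)"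
    by (auto simp: tangent_space_def smooth_curve_through_def)
  have "v = frame_comb (\<gamma> 0) (frame_inv (\<gamma> 0) v)"
  proof (rule SE3_curve_velocity)
    show "(\<gamma> has_vector_derivative v) (at 0 within {-e<..<e})"
      by (rule has_vector_derivative_at_within[OF g(4)])
    show "at 0 within {-e<..<e} \<noteq> bot"
      using g(1) at_within_open[of 0 "{-e<..<e}"] by simp
  qed (use g in auto)
  then show "v \<in> range (frame_comb p)" using g(3) by blast
next
  fix v assume "v \<in> range (frame_comb p)"
  then obtain u where v: "v = frame_comb p u" by blast
  let ?a = "om (transpose emb1 *v u)"
  \<comment> \<open>The Cayley curve stands in for the one-parameter subgroup: it has the same
    initial velocity, and its smoothness is already known.\<close>
  define \<gamma> where "\<gamma> t = (fst p ** cay ((t / 2) *\<^sub>R ?a), snd p + t *\<^sub>R snd v)" for t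
  note c = cay_curve_derivative[OF transpose_om[of "transpose emb1 *v u"]]
  have sk: "transpose ((t / 2) *\<^sub>R ?a) = - ((t / 2) *\<^sub>R ?a)" for t
    by (simp add: tr_simps transpose_om)
  have sm: "smooth_on UNIV \<gamma>"
    unfolding \<gamma>_def by (intro smooth_intros open_UNIV c(1))
  have in_SE3: "\<gamma> t \<in> SE3" for t
  proof -
    have "rotation_matrix (cay ((t / 2) *\<^sub>R ?a))"
      using cay_skew(1,2)[OF sk[of t]] by (simp only: rotation_matrix_def simp_thms)
    then show ?thesis
      using p by (simp add: \<gamma>_def SE3_iff rotation_matrix_mult)
  qed
  have "cay (0 :: real^3^3) = mat 1"
    by (simp add: cay_def matrix_inv_unique(2)[of "mat 1" "mat 1"] scaleR_2)
  then have g0: "\<gamma> 0 = p" by (simp add: \<gamma>_def)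
  have 1: "((\<lambda>t. fst p ** cay ((t / 2) *\<^sub>R ?a)) has_vector_derivative fst p ** ?a) (at 0)"
    by (rule bounded_linear.has_vector_derivative[OF bounded_bilinear.bounded_linear_right[OF bounded_bilinear_matrix_mult] c(2)])
  have 2: "((\<lambda>t. snd p + t *\<^sub>R snd v) has_vector_derivative snd v) (at 0)"
    by (auto intro!: derivative_eq_intros)
  have "(fst p ** ?a, snd v) = v" by (simp add: v frame_comb_def)
  then have d: "(\<gamma> has_vector_derivative v) (at 0)"
    unfolding \<gamma>_def using has_vector_derivative_Pair[OF 1 2] by simp
  have "\<exists>e>0. smooth_on {-e<..<e} \<gamma> \<and> \<gamma> ` {-e<..<e} \<subseteq> SE3"
    by (intro exI[of _ 1] conjI smooth_on_subset[OF sm]) (use in_SE3 in auto)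
  then have "smooth_curve_through SE3 p v \<gamma>"
    unfolding smooth_curve_through_def using g0 d by (intro conjI)
  then show "v \<in> tangent_space SE3 p"
    unfolding tangent_space_def by (intro CollectI exI)
qed

text \<open>\<open>om\<close> is isometric and \<open>fst p\<close> is orthogonal, so the frame is
  orthonormal for the ambient inner product at every point. The metric is thus the induced one and
  its connection a projection.\<close>

lemma inner_frame_comb:
  assumes "p \<in> SE3"
  shows "frame_comb p u \<bullet> frame_comb p w = u \<bullet> w"
proof -
  have "frame_comb p u \<bullet> frame_comb p w =
      (transpose emb1 *v u) \<bullet> (transpose emb1 *v w) + (transpose emb2 *v u) \<bullet> (transpose emb2 *v w)"
    using assms by (simp add: frame_comb_def inner_matrix_mult_left inner_om
        matrix_cancel[OF SE3_orthogonal(1)] inner_matrix_vector_left[of "fst p"])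
  also have "\<dots> = u \<bullet> w"
    by (simp add: emb1_vec emb2_vec inner_vec_def sum_3 sum_6)
  finally show ?thesis .
qed

text \<open>At an orthogonal \<open>C = fst p\<close> the first component is \<open>C\<close> times
  the skew part of \<open>C^T (fst v)\<close>, multiplied out to a polynomial so that it is smooth
  on the whole ambient space.\<close>

definition se3_proj :: "se3_ambient \<Rightarrow> se3_ambient \<Rightarrow> se3_ambient" where
  "se3_proj p v = ((1/2) *\<^sub>R (fst v - fst p ** (transpose (fst v) ** fst p)), snd v)"

lemmas bounded_linear_fst_transpose =
  bounded_linear_compose[OF bounded_linear_transpose bounded_linear_fst]

text \<open>An equation for the tangent vectors that is linear in the vector and in the point can be
  differentiated along a field; this is what the bracket requires.\<close>

lemma SE3_tangent_iff:
  assumes "p \<in> SE3"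
  shows "v \<in> tangent_space SE3 p \<longleftrightarrow>
    transpose (fst p) ** fst v + transpose (fst v) ** fst p = 0"
proof -
  have "transpose (fst p) ** fst v + transpose (fst v) ** fst p = 0 \<longleftrightarrow>
      transpose (transpose (fst p) ** fst v) = - (transpose (fst p) ** fst v)"
    by (simp add: tr_simps eq_neg_iff_add_eq_0 add.commute)
  also have "\<dots> \<longleftrightarrow> v \<in> range (frame_comb p)"
  proof
    assume "transpose (transpose (fst p) ** fst v) = - (transpose (fst p) ** fst v)"
    from frame_comb_inv[OF assms this, symmetric] show "v \<in> range (frame_comb p)" by (rule range_eqI)
  next
    assume "v \<in> range (frame_comb p)"
    then obtain u where "v = frame_comb p u" by (rule rangeE)
    then show "transpose (transpose (fst p) ** fst v) = - (transpose (fst p) ** fst v)"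
      using frame_comb_skew[OF assms, of u] by (simp only:)
  qed
  finally show ?thesis by (simp add: tangent_space_SE3[OF assms])
qed

text \<open>Differentiating the tangency equation of \<open>Y\<close> along \<open>X\<close>
  produces, besides the terms with the derivative of \<open>Y\<close>, the expression
  \<open>X^T Y + Y^T X\<close> in the rotational parts. It is symmetric in the two fields and
  cancels in the bracket.\<close>

lemma se3_lie_bracket_tangent:
  assumes X: "X \<in> vector_fields SE3" and Y: "Y \<in> vector_fields SE3" and p: "p \<in> SE3"
  shows "lie_bracket SE3 X Y p \<in> tangent_space SE3 p"
proof -
  have *: "transpose (fst p) ** fst (dir_deriv SE3 Y p (X p)) + transpose (fst (X p)) ** fst (Y p) +
      (transpose (fst (Y p)) ** fst (X p) + transpose (fst (dir_deriv SE3 Y p (X p))) ** fst p) = 0"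
    if X: "X \<in> vector_fields SE3" and Y: "Y \<in> vector_fields SE3" for X Y
  proof -
    have tX: "X p \<in> tangent_space SE3 p" and sY: "smooth_map_on SE3 Y"
      using X Y p by (simp_all add: vector_fields_def)
    note s = smooth_map_on_linear_map[OF bounded_linear_fst_transpose]
      smooth_map_on_linear[OF bounded_linear_fst sY]
      smooth_map_on_linear[OF bounded_linear_fst_transpose sY]
      smooth_map_on_linear_map[OF bounded_linear_fst]
    note m = smooth_map_on_bilinear[OF bounded_bilinear_matrix_mult s(1,2)]
      smooth_map_on_bilinear[OF bounded_bilinear_matrix_mult s(3,4)]
    note e = dir_deriv_bilinear[OF bounded_bilinear_matrix_mult s(1,2) p tX]
      dir_deriv_bilinear[OF bounded_bilinear_matrix_mult s(3,4) p tX]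
    have "dir_deriv SE3 (\<lambda>x. transpose (fst x) ** fst (Y x)) p (X p) +
        dir_deriv SE3 (\<lambda>x. transpose (fst (Y x)) ** fst x) p (X p) =
        dir_deriv SE3 (\<lambda>x. transpose (fst x) ** fst (Y x) + transpose (fst (Y x)) ** fst x) p (X p)"
      by (rule dir_deriv_add[OF m p tX, symmetric])
    also have "\<dots> = dir_deriv SE3 (\<lambda>x. 0) p (X p)"
    proof (rule dir_deriv_cong[OF smooth_map_on_linear_map[OF bounded_linear_zero] _ p tX, symmetric])
      fix x assume "x \<in> SE3"
      moreover from this have "Y x \<in> tangent_space SE3 x" using Y by (simp add: vector_fields_def)
      ultimately show "0 = transpose (fst x) ** fst (Y x) + transpose (fst (Y x)) ** fst x"
        using SE3_tangent_iff by simp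
    qed
    also have "\<dots> = 0" by (rule dir_deriv_linear_map[OF bounded_linear_zero tX])
    finally show ?thesis
      unfolding e dir_deriv_linear_map[OF bounded_linear_fst_transpose tX]
        dir_deriv_linear_map[OF bounded_linear_fst tX]
        dir_deriv_linear_compose[OF bounded_linear_fst sY p tX]
        dir_deriv_linear_compose[OF bounded_linear_fst_transpose sY p tX]
      by (simp add: algebra_simps)
  qed
  show ?thesis
    using trans[OF *[OF X Y] *[OF Y X, symmetric]]
    by (simp add: SE3_tangent_iff[OF p] lie_bracket_def mm_simps tr_simps algebra_simps)
qed

lemma se3_metric_comb:
  assumes "p \<in> SE3"
  shows "se3_metric p (frame_comb p u) (frame_comb p w) = u \<bullet> w"
  using assms by (simp add: se3_metric_def frame_coords_se3)

lemma SE3_projection: "tangential_projection SE3 se3_proj se3_metric"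
proof (rule tangential_projection.intro)
  show "linear (se3_proj p)" for p
    by (rule linearI) (simp_all add: se3_proj_def tr_simps mm_simps algebra_simps)
  have "smooth_on UNIV (\<lambda>x. se3_proj (fst x) (snd x))"
    unfolding se3_proj_def by (intro smooth_intros open_UNIV)
  then show "smooth_on UNIV (\<lambda>(p, v). se3_proj p v)" by (simp add: case_prod_unfold)
next
  fix p v :: se3_ambient assume p: "p \<in> SE3"
  show "se3_proj p v \<in> tangent_space SE3 p"
    by (simp add: SE3_tangent_iff[OF p] se3_proj_def mm_simps tr_simps SE3_orthogonal[OF p]
        matrix_cancel[OF SE3_orthogonal(1)[OF p]] matrix_cancel[OF SE3_orthogonal(2)[OF p]]
        matrix_mul_assoc[symmetric] algebra_simps)
next
  fix p v :: se3_ambient assume p: "p \<in> SE3" and v: "v \<in> tangent_space SE3 p"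
  obtain u where u: "v = frame_comb p u" using v by (auto simp: tangent_space_SE3[OF p])
  have "fst p ** (transpose (fst v) ** fst p) = - fst v"
    by (simp add: u frame_comb_def matrix_transpose_mul transpose_om mm_simps
        matrix_mul_assoc[symmetric] SE3_orthogonal[OF p])
  then show "se3_proj p v = v"
    by (simp add: se3_proj_def prod_eq_iff)
next
  fix p v w :: se3_ambient assume p: "p \<in> SE3" and w: "w \<in> tangent_space SE3 p"
  obtain u where u: "w = frame_comb p u" using w by (auto simp: tangent_space_SE3[OF p])
  let ?M = "transpose (fst p) ** fst v" and ?a = "om (transpose emb1 *v u)"
  have "(fst p ** (transpose (fst v) ** fst p)) \<bullet> (fst p ** ?a) = transpose ?M \<bullet> ?a"
    by (simp add: inner_matrix_mult_left[of "fst p"] matrix_cancel[OF SE3_orthogonal(1)[OF p]] tr_simps)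
  also have "\<dots> = - (?M \<bullet> ?a)" by (simp add: inner_transpose transpose_om)
  also have "?M \<bullet> ?a = fst v \<bullet> (fst p ** ?a)"
    by (simp add: inner_matrix_mult_left[of "transpose (fst p)"] transpose_transpose)
  finally show "se3_proj p v \<bullet> w = v \<bullet> w"
    by (simp add: u se3_proj_def frame_comb_def inner_diff_left inner_prod_def)
next
  fix p v w :: se3_ambient assume p: "p \<in> SE3" and "v \<in> tangent_space SE3 p" "w \<in> tangent_space SE3 p"
  then obtain u z where "v = frame_comb p u" "w = frame_comb p z"
    by (auto simp: tangent_space_SE3[OF p])
  then show "se3_metric p v w = v \<bullet> w"
    by (simp add: se3_metric_comb[OF p] inner_frame_comb[OF p])
qed (rule se3_lie_bracket_tangent)

lemma tangent_space_UNIV: "tangent_space UNIV p = UNIV"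
proof -
  have "v \<in> tangent_space UNIV p" for v
  proof -
    have "((\<lambda>t. p + t *\<^sub>R v) has_vector_derivative v) (at 0)"
      by (auto intro!: derivative_eq_intros)
    moreover have "smooth_on {-1<..<1} (\<lambda>t. p + t *\<^sub>R v)"
      by (intro smooth_intros open_greaterThanLessThan)
    ultimately have "smooth_curve_through UNIV p v (\<lambda>t. p + t *\<^sub>R v)"
      unfolding smooth_curve_through_def by (intro conjI exI[of _ 1]) auto
    then show ?thesis unfolding tangent_space_def by (intro CollectI exI)
  qed
  then show ?thesis by blast
qed

lemma euclidean_projection: "tangential_projection UNIV (\<lambda>p v. v) euclidean_metric"
proof (rule tangential_projection.intro)
  show "smooth_on UNIV (\<lambda>(p :: real^6, v :: real^6). v)"
    using smooth_on_snd[OF open_UNIV smooth_on_id[OF open_UNIV]] by (simp add: case_prod_unfold)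
qed (simp_all add: tangent_space_UNIV euclidean_metric_def linear_id[unfolded id_def])

section \<open>Connection matrices of the two frames\<close>

lemma levi_civita_euclidean:
  "levi_civita UNIV euclidean_metric (euclidean_frame i) (euclidean_frame j) p = 0"
proof -
  have f: "euclidean_frame i \<in> vector_fields UNIV" for i
    unfolding vector_fields_def tangent_space_UNIV euclidean_frame_def
    using smooth_map_onI[OF smooth_on_const refl] by simp
  have "levi_civita UNIV euclidean_metric (euclidean_frame i) (euclidean_frame j) p =
      dir_deriv UNIV (euclidean_frame j) p (euclidean_frame i p)"
    by (rule tangential_projection.levi_civita_eq[OF euclidean_projection f f UNIV_I])
  also have "\<dots> = 0"
    by (rule dir_deriv_eq[where g = "\<lambda>p. axis j 1" and U = UNIV and D = "\<lambda>v. 0"])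
      (simp_all add: tangent_space_UNIV euclidean_frame_def)
  finally show ?thesis .
qed

text \<open>The cross product matrix of \<open>a\<close> times \<open>- 1 / (2 * sqrt 2)\<close>.
  One half comes from the connection and \<open>1 / sqrt 2\<close> from \<open>om\<close>; the sign
  reflects that \<open>om\<close> reverses the orientation of axes.\<close>

definition gam :: "real^3 \<Rightarrow> real^3^3" where
  "gam a = (- 1 / (2 * sqrt 2)) *\<^sub>R vector [vector [0, - a $ 3, a $ 2], vector [a $ 3, 0, - a $ 1],
     vector [- a $ 2, a $ 1, 0]]"

text \<open>Half the commutator: the connection of the bi-invariant metric on the rotation group.\<close>

lemma om_gam: "om (gam a *v b) = (1/2) *\<^sub>R (om a ** om b - om b ** om a)"
  by (simp add: om_def gam_def vec_eq_iff forall_3 matrix_matrix_mult_def matrix_vector_mult_def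
      sum_3) (simp add: field_simps)

definition blk :: "real^3^3 \<Rightarrow> real^3^3 \<Rightarrow> real^6^6" where
  "blk g h = emb1 ** (g ** transpose emb1) + emb2 ** (h ** transpose emb2)"

text \<open>The connection in direction \<open>u\<close> as a matrix in the frame. The translational
  factor is flat, but its frame vectors \<open>C k\<close> turn with \<open>C\<close>, so that block
  is \<open>om\<close> in full, while the rotational block is only half a commutator.\<close>

definition conn :: "real^6 \<Rightarrow> real^6^6" where
  "conn u = blk (gam (transpose emb1 *v u)) (om (transpose emb1 *v u))"

lemma blk_apply: "blk g h *v u = emb1 *v (g *v (transpose emb1 *v u)) + emb2 *v (h *v (transpose emb2 *v u))"
  by (simp add: blk_def mv_simps matrix_vector_mul_assoc matrix_mul_assoc)

text \<open>For skew \<open>a\<close> and \<open>b\<close> the tangential part of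
  \<open>C a b\<close> is \<open>C\<close> times half the commutator of \<open>a\<close> and
  \<open>b\<close>; the translational component is unconstrained and passes unchanged.\<close>

lemma se3_proj_comb:
  assumes p: "p \<in> SE3"
  shows "se3_proj p (frame_comb (frame_comb p u) z) = frame_comb p (conn u *v z)"
proof -
  let ?a = "om (transpose emb1 *v u)" and ?b = "om (transpose emb1 *v z)"
  have 1: "transpose (fst p ** ?a ** ?b) ** fst p = ?b ** ?a"
    by (simp add: matrix_transpose_mul transpose_om mm_simps matrix_mul_assoc[symmetric] SE3_orthogonal[OF p])
  show ?thesis
    by (simp add: se3_proj_def frame_comb_def conn_def blk_apply emb_proj om_gam mm_simps 1)
      (simp add: matrix_mul_assoc matrix_vector_mul_assoc)
qed

lemma bounded_linear_frame_comb_point: "bounded_linear (\<lambda>p. frame_comb p u)"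
  using linear_frame_comb_point by (simp add: linear_conv_bounded_linear)

lemma se3_frame_vector_field: "se3_frame i \<in> vector_fields SE3"
  using smooth_map_on_linear_map[OF bounded_linear_frame_comb_point]
  by (auto simp: vector_fields_def tangent_space_SE3 se3_frame_eq[abs_def])

lemma levi_civita_se3_frame:
  assumes p: "p \<in> SE3"
  shows "levi_civita SE3 se3_metric (se3_frame i) (se3_frame j) p =
    se3_proj p (frame_comb (se3_frame i p) (axis j 1))"
proof -
  have "se3_frame i p \<in> tangent_space SE3 p"
    using p by (simp add: tangent_space_SE3 se3_frame_eq)
  then have "dir_deriv SE3 (se3_frame j) p (se3_frame i p) = frame_comb (se3_frame i p) (axis j 1)"
    using dir_deriv_linear_map[OF bounded_linear_frame_comb_point] by (simp add: se3_frame_eq[abs_def])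
  then show ?thesis
    using tangential_projection.levi_civita_eq[OF SE3_projection se3_frame_vector_field
        se3_frame_vector_field p] by simp
qed

text \<open>Both sides are bilinear in \<open>u\<close> and \<open>z\<close>, so agreement on the
  frame vectors is enough. The double sum in \<open>has_covariant_derivative\<close> thereby becomes
  one matrix.\<close>

lemma levi_civita_se3_sum:
  assumes p: "p \<in> SE3"
  shows "(\<Sum>i\<in>UNIV. \<Sum>j\<in>UNIV. (u $ i * z $ j) *\<^sub>R
      levi_civita SE3 se3_metric (se3_frame i) (se3_frame j) p) = frame_comb p (conn u *v z)"
proof -
  let ?P = "se3_proj p"
  have lP: "linear ?P" by (rule tangential_projection.linear_P[OF SE3_projection])
  have l1: "linear (\<lambda>z. ?P (frame_comb v z))" for v
    using linear_compose[OF linear_frame_comb lP] by (simp add: o_def)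
  have l2: "linear (\<lambda>u. ?P (frame_comb (frame_comb p u) z))"
    using linear_compose[OF linear_frame_comb linear_compose[OF linear_frame_comb_point lP]]
    by (simp add: o_def)
  have "?P (frame_comb (frame_comb p u) z) =
      (\<Sum>i\<in>UNIV. u $ i *\<^sub>R ?P (frame_comb (frame_comb p (axis i 1)) z))"
    by (rule linear_axis_expansion[OF l2])
  also have "\<dots> = (\<Sum>i\<in>UNIV. u $ i *\<^sub>R (\<Sum>j\<in>UNIV. z $ j *\<^sub>R ?P (frame_comb (frame_comb p (axis i 1)) (axis j 1))))"
    by (intro sum.cong refl arg_cong[of _ _ "scaleR _"] linear_axis_expansion[OF l1])
  also have "\<dots> = (\<Sum>i\<in>UNIV. \<Sum>j\<in>UNIV. (u $ i * z $ j) *\<^sub>R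
      levi_civita SE3 se3_metric (se3_frame i) (se3_frame j) p)"
    by (simp add: scaleR_sum_right levi_civita_se3_frame[OF p] se3_frame_eq)
  finally show ?thesis by (simp add: se3_proj_comb[OF p])
qed

section \<open>Covariant derivatives in frame coordinates\<close>

lemma frame_comb_eq_iff: "p \<in> SE3 \<Longrightarrow> frame_comb p u = frame_comb p w \<longleftrightarrow> u = w"
  using frame_inv_comb by metis

text \<open>Independence of the frame vectors turns a vanishing covariant derivative into the linear
  equation \<open>z' = - conn u z\<close> for the coordinates. The velocity \<open>u\<close> stays
  existentially quantified and is pinned down later by uniqueness of derivatives.\<close>

lemma has_covariant_derivative_SE3:
  assumes p: "x t \<in> SE3"
  shows "has_covariant_derivative SE3 se3_metric se3_frame x Z 0 t I \<longleftrightarrow>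
    (\<exists>u. (x has_vector_derivative frame_comb (x t) u) (at t within I) \<and>
      ((\<lambda>s. frame_coords se3_frame (x s) (Z s)) has_vector_derivative
        - (conn u *v frame_coords se3_frame (x t) (Z t))) (at t within I))"
proof -
  have "0 = frame_comb (x t) z' + frame_comb (x t) w \<longleftrightarrow> z' = - w" for z' w
  proof -
    have "0 = frame_comb (x t) z' + frame_comb (x t) w \<longleftrightarrow> frame_comb (x t) 0 = frame_comb (x t) (z' + w)"
      by (simp add: linear_add[OF linear_frame_comb] linear_0[OF linear_frame_comb])
    also have "\<dots> \<longleftrightarrow> 0 = z' + w" by (rule frame_comb_eq_iff[OF p])
    finally show ?thesis by (auto simp: eq_neg_iff_add_eq_0)
  qed
  then show ?thesis
    unfolding has_covariant_derivative_def levi_civita_se3_sum[OF p] frame_comb_sum[symmetric]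
    by auto
qed

lemma frame_coords_euclidean: "frame_coords euclidean_frame p v = v"
proof -
  have "(\<Sum>i\<in>UNIV. c $ i *\<^sub>R euclidean_frame i p) = c" for c :: "real^6"
    using basis_expansion[of c] by (simp add: euclidean_frame_def scalar_mult_eq_scaleR)
  then show ?thesis by (simp add: frame_coords_def)
qed

lemma has_covariant_derivative_euclidean:
  "has_covariant_derivative UNIV euclidean_metric euclidean_frame x Z 0 t I \<longleftrightarrow>
    (\<exists>u. (x has_vector_derivative u) (at t within I)) \<and> (Z has_vector_derivative 0) (at t within I)"
proof -
  have *: "(\<Sum>i\<in>UNIV. c $ i *\<^sub>R euclidean_frame i p) = c" for c p :: "real^6"
    using basis_expansion[of c] by (simp add: euclidean_frame_def scalar_mult_eq_scaleR)
  show ?thesis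
    unfolding has_covariant_derivative_def frame_coords_euclidean levi_civita_euclidean * by auto
qed

section \<open>Configurations and the invariants of a rolling\<close>

lemma Isom0_apply:
  assumes x: "x \<in> SE3" and q: "q \<in> Isom0 x"
  shows "q (frame_comb x u) = frame_matrix x q *v u"
proof -
  have "linear (\<lambda>u. q (frame_comb x u))"
    using q by (intro linearI) (simp_all add: Isom0_def tangent_space_SE3[OF x]
        linear_add[OF linear_frame_comb] linear_scale[OF linear_frame_comb])
  then have "q (frame_comb x u) = matrix (\<lambda>u. q (frame_comb x u)) *v u"
    by (simp add: matrix_works)
  also have "matrix (\<lambda>u. q (frame_comb x u)) = frame_matrix x q"
    by (simp add: matrix_def frame_matrix_def se3_frame_eq)
  finally show ?thesis .
qed

text \<open>The determinant of an isometry is \<open>1\<close> or \<open>-1\<close>, so the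
  positivity demanded in \<open>Isom0\<close> amounts to determinant \<open>1\<close>.\<close>

lemma rotation_matrix_iff:
  fixes A :: "real^'n^'n"
  shows "rotation_matrix A \<longleftrightarrow> (\<forall>u w. (A *v u) \<bullet> (A *v w) = u \<bullet> w) \<and> det A > 0"
proof -
  have "(\<forall>u w. (A *v u) \<bullet> (A *v w) = u \<bullet> w) \<longleftrightarrow> orthogonal_matrix A"
    using orthogonal_transformation_matrix[of "(*v) A"]
    by (simp add: orthogonal_transformation_def)
  moreover have "orthogonal_matrix A \<Longrightarrow> det A > 0 \<longleftrightarrow> det A = 1"
    using det_orthogonal_matrix[of A] by auto
  ultimately show ?thesis by (auto simp: rotation_matrix_def)
qed

lemma Isom0_rotation:
  assumes x: "x \<in> SE3" and q: "q \<in> Isom0 x"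
  shows "rotation_matrix (frame_matrix x q)"
proof -
  have "(frame_matrix x q *v u) \<bullet> (frame_matrix x q *v w) = u \<bullet> w" for u w
  proof -
    have "q (frame_comb x u) \<bullet> q (frame_comb x w) = se3_metric x (frame_comb x u) (frame_comb x w)"
      using q by (simp add: Isom0_def tangent_space_SE3[OF x])
    then show ?thesis by (simp add: Isom0_apply[OF x q] se3_metric_comb[OF x])
  qed
  moreover have "det (frame_matrix x q) > 0" using q by (simp add: Isom0_def)
  ultimately show ?thesis by (simp add: rotation_matrix_iff)
qed

text \<open>\<open>restrict\<close> supplies the value \<open>undefined\<close> off the tangent
  space that \<open>Isom0\<close> prescribes; only so does it invert \<open>frame_matrix\<close>
  exactly.\<close>

definition matrix_isom :: "se3_ambient \<Rightarrow> real^6^6 \<Rightarrow> se3_ambient \<Rightarrow> real^6" where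
  "matrix_isom x A = restrict (\<lambda>v. A *v frame_coords se3_frame x v) (tangent_space SE3 x)"

lemma matrix_isom_apply:
  "x \<in> SE3 \<Longrightarrow> matrix_isom x A (frame_comb x u) = A *v u"
  by (simp add: matrix_isom_def tangent_space_SE3 frame_coords_se3)

lemma frame_matrix_isom:
  assumes "x \<in> SE3"
  shows "frame_matrix x (matrix_isom x A) = A"
  by (simp add: frame_matrix_def se3_frame_eq matrix_isom_apply[OF assms] matrix_vector_mult_basis
      column_def vec_eq_iff)

lemma matrix_isom_Isom0:
  assumes x: "x \<in> SE3" and A: "rotation_matrix A"
  shows "matrix_isom x A \<in> Isom0 x"
proof -
  have A': "(A *v u) \<bullet> (A *v w) = u \<bullet> w" "det A > 0" for u w
    using A by (simp_all add: rotation_matrix_iff)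
  have ext: "matrix_isom x A \<in> extensional (tangent_space SE3 x)"
    by (simp add: matrix_isom_def)
  have add: "matrix_isom x A (frame_comb x u + frame_comb x w) =
      matrix_isom x A (frame_comb x u) + matrix_isom x A (frame_comb x w)" for u w
    unfolding linear_add[OF linear_frame_comb, symmetric] matrix_isom_apply[OF x] by (simp add: mv_simps)
  have scale: "matrix_isom x A (c *\<^sub>R frame_comb x u) = c *\<^sub>R matrix_isom x A (frame_comb x u)" for c u
    unfolding linear_scale[OF linear_frame_comb, symmetric] matrix_isom_apply[OF x] by (simp add: mv_simps)
  show ?thesis
    unfolding Isom0_def
    using ext add scale A'
    by (auto simp: tangent_space_SE3[OF x] matrix_isom_apply[OF x] se3_metric_comb[OF x] frame_matrix_isom[OF x])
qed

lemma matrix_isom_frame_matrix: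
  assumes x: "x \<in> SE3" and q: "q \<in> Isom0 x"
  shows "matrix_isom x (frame_matrix x q) = q"
proof
  fix v
  show "matrix_isom x (frame_matrix x q) v = q v"
  proof (cases "v \<in> tangent_space SE3 x")
    case True
    then obtain u where "v = frame_comb x u" by (auto simp: tangent_space_SE3[OF x])
    then show ?thesis by (simp add: matrix_isom_apply[OF x] Isom0_apply[OF x q])
  next
    case False
    then have "q v = undefined" using q unfolding Isom0_def by (blast intro: extensional_arb)
    then show ?thesis using False by (simp add: matrix_isom_def)
  qed
qed

type_synonym model_config = "se3_ambient \<times> (real^6) \<times> (real^6^6)"

definition Q_model :: "model_config set" where
  "Q_model = {(x, xh, A). x \<in> SE3 \<and> rotation_matrix A}"

definition config_of :: "model_config \<Rightarrow> configuration" where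
  "config_of = (\<lambda>(x, xh, A). (x, xh, matrix_isom x A))"

lemma config_of_in_Q: "p \<in> Q_model \<Longrightarrow> config_of p \<in> Q"
  by (auto simp: Q_model_def config_of_def Q_def matrix_isom_Isom0)

lemma Q_coords_config_of: "p \<in> Q_model \<Longrightarrow> Q_coords (config_of p) = p"
  by (auto simp: Q_model_def config_of_def Q_coords_def frame_matrix_isom)

lemma Q_coords_in_model: "c \<in> Q \<Longrightarrow> Q_coords c \<in> Q_model"
  by (auto simp: Q_model_def Q_coords_def Q_def Isom0_rotation)

lemma config_of_Q_coords: "c \<in> Q \<Longrightarrow> config_of (Q_coords c) = c"
  by (auto simp: config_of_def Q_coords_def Q_def matrix_isom_frame_matrix)

lemma Q_coords_image: "Q_coords ` Q = Q_model"
  using Q_coords_in_model Q_coords_config_of config_of_in_Q by (metis (no_types, lifting) image_iff subsetI subset_antisym image_subset_iff)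

text \<open>For \<open>q = (x, xh, A)\<close> with \<open>x = (C, r)\<close> the parallel fields \<open>(0, k)\<close> of the flat factor are mapped
  by the isometry to the constant vectors \<open>W k\<close>; this gives the first invariant, and the second one
  is the displacement in these directions.\<close>

definition leaf_map :: "model_config \<Rightarrow> (real^3^6) \<times> (real^3)" where
  "leaf_map = (\<lambda>(x, xh, A). (A ** (emb2 ** transpose (fst x)),
     transpose (A ** (emb2 ** transpose (fst x))) *v xh - snd x))"

section \<open>Constancy of the invariants along a rolling\<close>

lemma at_within_Icc_nontrivial:
  fixes t :: real
  assumes "\<tau> > 0" "t \<in> {0..\<tau>}"
  shows "at t within {0..\<tau>} \<noteq> bot"
proof -
  have "{0..\<tau>} \<noteq> {t}"
  proof
    assume "{0..\<tau>} = {t}"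
    moreover have "0 \<in> {0..\<tau>}" "\<tau> \<in> {0..\<tau>}" using assms by auto
    ultimately show False using assms(1) by auto
  qed
  then have "t islimpt {0..\<tau>}"
    using connected_imp_perfect[of "{0..\<tau>}" t] assms(2) by simp
  then show ?thesis by (simp add: trivial_limit_within)
qed

lemma frame_comb_translation:
  assumes "x \<in> SE3"
  shows "frame_comb x (emb2 *v (transpose (fst x) *v k)) = (0, k)"
proof -
  have "transpose emb1 *v (emb2 *v b) = 0" "transpose emb2 *v (emb2 *v b) = b" for b
    by (simp_all add: matrix_vector_mul_assoc mv_simps)
  then show ?thesis
    using assms by (simp add: frame_comb_def linear_0[OF linear_om] mm_simps matrix_cancel[OF SE3_orthogonal(2)])
qed

lemma conn_emb2: "conn u *v (emb2 *v b) = emb2 *v (om (transpose emb1 *v u) *v b)"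
proof -
  have "transpose emb1 *v (emb2 *v b) = 0" "transpose emb2 *v (emb2 *v b) = b" for b
    by (simp_all add: matrix_vector_mul_assoc mv_simps)
  then show ?thesis by (simp add: conn_def blk_apply mv_simps)
qed

lemma intrinsic_rolling_leaf_map:
  assumes roll: "intrinsic_rolling \<tau> \<gamma>" and \<tau>: "\<tau> > 0" and t: "t \<in> {0..\<tau>}"
  shows "leaf_map (Q_coords (\<gamma> t)) = leaf_map (Q_coords (\<gamma> 0))"
proof -
  define x where "x t = fst (\<gamma> t)" for t
  define xh where "xh t = fst (snd (\<gamma> t))" for t
  define q where "q t = snd (snd (\<gamma> t))" for t
  define A where "A t = frame_matrix (x t) (q t)" for t
  have \<gamma>im: "\<gamma> ` {0..\<tau>} \<subseteq> Q"
    and ac: "abs_continuous_on {0..\<tau>} (Q_coords \<circ> \<gamma>)"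
    and vel: "AE t in lborel. t \<in> {0..\<tau>} \<longrightarrow>
           (\<exists>v. (x has_vector_derivative v) (at t within {0..\<tau>}) \<and>
                (xh has_vector_derivative q t v) (at t within {0..\<tau>}))"
    and par: "\<And>Z. (\<forall>t\<in>{0..\<tau>}. Z t \<in> tangent_space SE3 (x t)) \<Longrightarrow>
           (parallel_along SE3 se3_metric se3_frame \<tau> x Z \<longleftrightarrow>
            parallel_along UNIV euclidean_metric euclidean_frame \<tau> xh (\<lambda>t. q t (Z t)))"
    using roll unfolding intrinsic_rolling_def Let_def x_def[abs_def] xh_def[abs_def] q_def[abs_def]
    by (blast, blast, blast, blast)
  have \<gamma>Q: "\<gamma> t \<in> Q" if "t \<in> {0..\<tau>}" for t using \<gamma>im that by (rule image_subset_iff[THEN iffD1, THEN bspec])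
  have Qc: "Q_coords (\<gamma> t) = (x t, xh t, A t)" for t
    by (simp add: Q_coords_def A_def x_def xh_def q_def case_prod_unfold)
  have xS: "x t \<in> SE3" and qI: "q t \<in> Isom0 (x t)" if "t \<in> {0..\<tau>}" for t
    using \<gamma>Q[OF that] by (auto simp: Q_def x_def q_def)
  have acx: "abs_continuous_on {0..\<tau>} x" and acxh: "abs_continuous_on {0..\<tau>} xh"
    using abs_continuous_on_linear[OF bounded_linear_fst ac]
      abs_continuous_on_linear[OF bounded_linear_compose[OF bounded_linear_fst bounded_linear_snd] ac]
    by (simp_all add: Qc o_def)
  define W where "W t = A t ** (emb2 ** transpose (fst (x t)))" for t
  have qk: "q t (0, k) = W t *v k" if "t \<in> {0..\<tau>}" for t k
    using Isom0_apply[OF xS[OF that] qI[OF that], of "emb2 *v (transpose (fst (x t)) *v k)"]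
    unfolding frame_comb_translation[OF xS[OF that]]
    by (simp add: W_def A_def matrix_vector_mul_assoc matrix_mul_assoc)
  \<comment> \<open>The no-twist condition for the constant field \<open>(0, k)\<close>: its image
    \<open>W t *v k\<close> is absolutely continuous with derivative zero almost everywhere, hence
    constant.\<close>
  have Wk: "W t *v k = W 0 *v k" if t: "t \<in> {0..\<tau>}" for t k
  proof -
    let ?Z = "\<lambda>t::real. (0, k) :: se3_ambient"
    have fc: "frame_coords se3_frame (x s) (?Z s) = emb2 *v (transpose (fst (x s)) *v k)" if "s \<in> {0..\<tau>}" for s
      using frame_coords_se3[OF xS[OF that]] frame_comb_translation[OF xS[OF that]] by metis
    have hc: "has_covariant_derivative SE3 se3_metric se3_frame x ?Z 0 t {0..\<tau>}"
      if t: "t \<in> {0..\<tau>}" and v: "(x has_vector_derivative v) (at t within {0..\<tau>})" for t v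
    proof -
      define u where "u = frame_inv (x t) v"
      have vu: "v = frame_comb (x t) u"
        unfolding u_def by (rule SE3_curve_velocity[OF v at_within_Icc_nontrivial[OF \<tau> t] t xS])
      have "((\<lambda>s. emb2 *v (transpose (fst (x s)) *v k)) has_vector_derivative
          emb2 *v (transpose (fst v) *v k)) (at t within {0..\<tau>})"
        by (intro bounded_linear.has_vector_derivative[OF bounded_bilinear.bounded_linear_right[OF bounded_bilinear_matrix_vector_mult]]
            bounded_linear.has_vector_derivative[OF bounded_bilinear.bounded_linear_left[OF bounded_bilinear_matrix_vector_mult]]
            bounded_linear.has_vector_derivative[OF bounded_linear_fst_transpose] v)
      then have d: "((\<lambda>s. frame_coords se3_frame (x s) (?Z s)) has_vector_derivative
          emb2 *v (transpose (fst v) *v k)) (at t within {0..\<tau>})"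
        by (rule has_vector_derivative_transform[OF t, rotated]) (rule fc)
      \<comment> \<open>The coordinates of the constant field turn back at the rate at which the
        frame turns; this is precisely the parallel equation.\<close>
      have "transpose (fst v) = - (om (transpose emb1 *v u) ** transpose (fst (x t)))"
        by (simp add: vu frame_comb_def matrix_transpose_mul transpose_om mm_simps)
      then have "emb2 *v (transpose (fst v) *v k) = - (conn u *v frame_coords se3_frame (x t) (?Z t))"
        unfolding fc[OF t] conn_emb2 by (simp add: mv_simps flip: matrix_vector_mul_assoc)
      with d v show ?thesis
        unfolding has_covariant_derivative_SE3[where x = x and t = t, OF xS[OF t]] vu by (intro exI[of _ u]) simp
    qed
    have "AE t in lborel. t \<in> {0..\<tau>} \<longrightarrow> has_covariant_derivative SE3 se3_metric se3_frame x ?Z 0 t {0..\<tau>}"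
      using vel by (rule eventually_mono) (iprover intro: hc)
    then have "parallel_along SE3 se3_metric se3_frame \<tau> x ?Z"
      unfolding parallel_along_def by (intro conjI abs_continuous_on_const)
    moreover have "\<forall>t\<in>{0..\<tau>}. ?Z t \<in> tangent_space SE3 (x t)"
    proof
      fix t assume "t \<in> {0..\<tau>}"
      note S = xS[OF this]
      show "?Z t \<in> tangent_space SE3 (x t)"
        unfolding tangent_space_SE3[OF S] by (subst frame_comb_translation[OF S, symmetric]) (rule rangeI)
    qed
    ultimately have "parallel_along UNIV euclidean_metric euclidean_frame \<tau> xh (\<lambda>t. q t (?Z t))"
      using par[of ?Z] by iprover
    then have acZ: "abs_continuous_on {0..\<tau>} (\<lambda>t. q t (?Z t))"
      and AEZ: "AE t in lborel. t \<in> {0..\<tau>} \<longrightarrow> (\<exists>u. (xh has_vector_derivative u) (at t within {0..\<tau>})) \<and>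
        ((\<lambda>t. q t (?Z t)) has_vector_derivative 0) (at t within {0..\<tau>})"
      unfolding parallel_along_def has_covariant_derivative_euclidean by iprover+
    have "AE t in lborel. t \<in> {0..\<tau>} \<longrightarrow> ((\<lambda>t. q t (?Z t)) has_vector_derivative 0) (at t within {0..\<tau>})"
      using AEZ by (rule eventually_mono) iprover
    from abs_continuous_on_zero_derivative_const[OF acZ this t]
    have "q t (?Z t) = q 0 (?Z 0)" .
    then show ?thesis using qk[OF t] qk[of 0] \<tau> by simp
  qed
  have W: "W t = W 0" if "t \<in> {0..\<tau>}" for t
    unfolding matrix_eq by (rule allI) (rule Wk[OF that])
  \<comment> \<open>Since \<open>W\<close> is already known to be constant, \<open>W 0\<close> may
    replace \<open>W t\<close>, and \<open>s\<close> is a linear image of absolutely continuous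
    curves.\<close>
  define s where "s t = transpose (W 0) *v xh t + - snd (x t)" for t
  have "abs_continuous_on {0..\<tau>} s"
    unfolding s_def
    by (intro abs_continuous_on_add abs_continuous_on_linear[OF _ acxh]
        abs_continuous_on_linear[OF bounded_linear_minus[OF bounded_linear_snd] acx]
        bounded_bilinear.bounded_linear_right[OF bounded_bilinear_matrix_vector_mult])
  moreover have "AE t in lborel. t \<in> {0..\<tau>} \<longrightarrow> (s has_vector_derivative 0) (at t within {0..\<tau>})"
  proof -
    have sd: "(s has_vector_derivative 0) (at t within {0..\<tau>})"
      if t: "t \<in> {0..\<tau>}" and v: "(x has_vector_derivative v) (at t within {0..\<tau>})"
        and vh: "(xh has_vector_derivative q t v) (at t within {0..\<tau>})" for t v
    proof -
      define u where "u = frame_inv (x t) v"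
      have vu: "v = frame_comb (x t) u"
        unfolding u_def by (rule SE3_curve_velocity[OF v at_within_Icc_nontrivial[OF \<tau> t] t xS])
      have "(s has_vector_derivative transpose (W 0) *v q t v + - snd v) (at t within {0..\<tau>})"
        unfolding s_def
        by (intro has_vector_derivative_add
            bounded_linear.has_vector_derivative[OF bounded_bilinear.bounded_linear_right[OF bounded_bilinear_matrix_vector_mult] vh]
            bounded_linear.has_vector_derivative[OF bounded_linear_minus[OF bounded_linear_snd] v])
      moreover have "transpose (W 0) *v q t v = snd v"
      proof -
        \<comment> \<open>Orthogonality reduces \<open>W^T A u\<close> to the translational velocity
          \<open>C (emb2^T u)\<close>, so by no slip the two terms of the derivative of
          \<open>s\<close> cancel.\<close>
        have "transpose (A t) ** A t = mat 1"
          using Isom0_rotation[OF xS[OF t] qI[OF t]] by (simp add: A_def rotation_matrix_def orthogonal_matrix)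
        then have "transpose (W t) *v (A t *v u) = fst (x t) *v (transpose emb2 *v u)"
          by (simp add: W_def tr_simps matrix_vector_mul_assoc[symmetric] matrix_cancel(2))
        then show ?thesis
          using Isom0_apply[OF xS[OF t] qI[OF t], of u] W[OF t] by (simp add: vu A_def frame_comb_def)
      qed
      ultimately show ?thesis by simp
    qed
    show ?thesis using vel by (rule eventually_mono) (iprover intro: sd)
  qed
  ultimately have "s t = s 0" by (rule abs_continuous_on_zero_derivative_const) (rule t)
  then show ?thesis
    using W[OF t] by (simp add: leaf_map_def Qc W_def[symmetric] s_def)
qed

section \<open>Rollings with piecewise constant controls\<close>

lemma blk_mult: "blk g h ** blk g' h' = blk (g ** g') (h ** h')"
proof -
  have e: "transpose emb1 ** (emb1 ** X) = X" "transpose emb1 ** (emb2 ** X) = 0"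
    "transpose emb2 ** (emb1 ** X) = 0" "transpose emb2 ** (emb2 ** X) = X" for X :: "real^'n^3"
    by (simp_all add: matrix_mul_assoc mm_simps)
  show ?thesis
    by (simp add: blk_def mm_simps matrix_mul_assoc[symmetric] e)
qed

lemma blk_one: "blk (mat 1) (mat 1) = mat 1"
  by (simp add: blk_def emb_complete)

lemma transpose_blk: "transpose (blk g h) = blk (transpose g) (transpose h)"
  by (simp add: blk_def tr_simps matrix_mul_assoc)

lemma blk_minus: "blk (- g) (- h) = - blk g h"
  by (simp add: blk_def mm_simps)

lemma orthogonal_blk:
  assumes "orthogonal_matrix g" "orthogonal_matrix h"
  shows "orthogonal_matrix (blk g h)"
  using assms by (simp add: orthogonal_matrix transpose_blk blk_mult blk_one)

lemma transpose_gam: "transpose (gam a) = - gam a"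
  by (simp add: gam_def vec_eq_iff forall_3 transpose_def)

lemma transpose_conn: "transpose (conn u) = - conn u"
  by (simp add: conn_def transpose_blk transpose_gam transpose_om blk_minus)

text \<open>The rolling equations in the trivialization with control \<open>u\<close>. The middle
  component is no slip; the last one is no twist, since it gives
  \<open>(A z)' = A (z' + conn u z)\<close> for the coordinates \<open>z\<close> of a field.\<close>

definition roll_velocity ::
    "model_config \<Rightarrow> real^6 \<Rightarrow> model_config" where
  "roll_velocity p u = (frame_comb (fst p) u, snd (snd p) *v u, snd (snd p) ** conn u)"

text \<open>A class of curves that is easy to verify and closed under concatenation: a Lipschitz
  bound in place of absolute continuity, and a finite exceptional set for the junctions.\<close>

definition model_rolling :: "real \<Rightarrow> (real \<Rightarrow> model_config) \<Rightarrow> bool" where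
  "model_rolling \<tau> p \<longleftrightarrow> \<tau> > 0 \<and> p ` {0..\<tau>} \<subseteq> Q_model \<and>
     (\<exists>L. \<forall>s\<in>{0..\<tau>}. \<forall>t\<in>{0..\<tau>}. norm (p t - p s) \<le> L * \<bar>t - s\<bar>) \<and>
     (\<exists>F. finite F \<and> (\<forall>t\<in>{0<..<\<tau>} - F. \<exists>u. (p has_vector_derivative roll_velocity (p t) u) (at t)))"

lemma AE_finite_exception:
  assumes "finite F" "\<And>t. t \<in> {a<..<b} - F \<Longrightarrow> P t"
  shows "AE t in lborel. t \<in> {a..b::real} \<longrightarrow> P t"
proof (rule AE_I')
  show "insert a (insert b F) \<in> null_sets lborel"
    using assms(1) by (intro finite_imp_null_set_lborel) simp
  show "{t \<in> space lborel. \<not> (t \<in> {a..b} \<longrightarrow> P t)} \<subseteq> insert a (insert b F)"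
    using assms(2) by fastforce
qed

lemma AE_Icc_iff:
  assumes "finite F" "\<And>t. t \<in> {a<..<b} - F \<Longrightarrow> P t \<longleftrightarrow> R t"
  shows "(AE t in lborel. t \<in> {a..b::real} \<longrightarrow> P t) \<longleftrightarrow> (AE t in lborel. t \<in> {a..b} \<longrightarrow> R t)"
proof -
  have e: "AE t in lborel. t \<in> {a..b} \<longrightarrow> (P t \<longleftrightarrow> R t)"
    by (rule AE_finite_exception[OF assms])
  show ?thesis
  proof
    assume "AE t in lborel. t \<in> {a..b} \<longrightarrow> P t"
    with e show "AE t in lborel. t \<in> {a..b} \<longrightarrow> R t" by eventually_elim simp
  next
    assume "AE t in lborel. t \<in> {a..b} \<longrightarrow> R t"
    with e show "AE t in lborel. t \<in> {a..b} \<longrightarrow> P t" by eventually_elim simp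
  qed
qed

text \<open>If \<open>z\<close> are the coordinates of \<open>Z\<close>, its image is
  \<open>A z\<close> with \<open>(A z)' = A (z' + conn u z)\<close> and \<open>A\<close> invertible.
  At every regular time the two covariant derivatives therefore vanish together. As \<open>Z\<close>
  is arbitrary, absolute continuity has to be transferred in both directions too.\<close>

lemma model_rolling_intrinsic:
  assumes roll: "model_rolling \<tau> p"
  shows "intrinsic_rolling \<tau> (\<lambda>t. config_of (p t))"
proof -
  define x where "x t = fst (p t)" for t
  define xh where "xh t = fst (snd (p t))" for t
  define A where "A t = snd (snd (p t))" for t
  have \<tau>: "\<tau> > 0" and pm: "p ` {0..\<tau>} \<subseteq> Q_model"
    and Lex: "\<exists>L. \<forall>s\<in>{0..\<tau>}. \<forall>t\<in>{0..\<tau>}. norm (p t - p s) \<le> L * \<bar>t - s\<bar>"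
    and Fex: "\<exists>F. finite F \<and> (\<forall>t\<in>{0<..<\<tau>} - F. \<exists>u. (p has_vector_derivative roll_velocity (p t) u) (at t))"
    using roll unfolding model_rolling_def by iprover+
  obtain L where L0: "\<forall>s\<in>{0..\<tau>}. \<forall>t\<in>{0..\<tau>}. norm (p t - p s) \<le> L * \<bar>t - s\<bar>"
    using Lex by (rule exE)
  note L = L0[THEN bspec, THEN bspec]
  obtain F where F: "finite F" and der: "\<forall>t\<in>{0<..<\<tau>} - F. \<exists>u. (p has_vector_derivative roll_velocity (p t) u) (at t)"
    using Fex by iprover
  have pQ: "p t \<in> Q_model" if "t \<in> {0..\<tau>}" for t
    using pm that by (rule image_subset_iff[THEN iffD1, THEN bspec])
  have pt: "p t = (x t, xh t, A t)" for t by (simp add: x_def xh_def A_def)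
  have xS: "x t \<in> SE3" and Arot: "rotation_matrix (A t)" if "t \<in> {0..\<tau>}" for t
    using pQ[OF that] by (auto simp: Q_model_def pt)
  have acp: "abs_continuous_on {0..\<tau>} p"
    using L by (rule abs_continuous_on_lipschitz)
  have acx: "abs_continuous_on {0..\<tau>} x" and acA: "abs_continuous_on {0..\<tau>} A"
    using abs_continuous_on_linear[OF bounded_linear_fst acp]
      abs_continuous_on_linear[OF bounded_linear_compose[OF bounded_linear_snd bounded_linear_snd] acp]
    by (simp_all add: x_def[abs_def] A_def[abs_def] o_def)
  note acC = abs_continuous_on_linear[OF bounded_linear_fst acx]
    and acCT = abs_continuous_on_linear[OF bounded_linear_fst_transpose acx]
    and acAT = abs_continuous_on_linear[OF bounded_linear_transpose acA]
  note mvr = bounded_bilinear.bounded_linear_right[OF bounded_bilinear_matrix_vector_mult]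
  note bl_om = linear_om[unfolded linear_conv_bounded_linear]
    and bl_vee = linear_vee[unfolded linear_conv_bounded_linear]
  have AT: "transpose (A t) ** A t = mat 1" if "t \<in> {0..\<tau>}" for t
    using Arot[OF that] by (simp add: rotation_matrix_def orthogonal_matrix)
  define q where "q t = matrix_isom (x t) (A t)" for t
  have vel: "(x has_vector_derivative frame_comb (x t) u) (at t within {0..\<tau>})"
      "(xh has_vector_derivative A t *v u) (at t within {0..\<tau>})"
      "(A has_vector_derivative A t ** conn u) (at t within {0..\<tau>})"
    if "(p has_vector_derivative roll_velocity (p t) u) (at t)" for t u
  proof -
    note d = has_vector_derivative_at_within[OF that, of "{0..\<tau>}"]
    show "(x has_vector_derivative frame_comb (x t) u) (at t within {0..\<tau>})"
      "(xh has_vector_derivative A t *v u) (at t within {0..\<tau>})"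
      "(A has_vector_derivative A t ** conn u) (at t within {0..\<tau>})"
      using bounded_linear.has_vector_derivative[OF bounded_linear_fst d]
        bounded_linear.has_vector_derivative[OF bounded_linear_compose[OF bounded_linear_fst bounded_linear_snd] d]
        bounded_linear.has_vector_derivative[OF bounded_linear_compose[OF bounded_linear_snd bounded_linear_snd] d]
      by (simp_all add: x_def[abs_def] xh_def[abs_def] A_def[abs_def] o_def roll_velocity_def)
  qed
  have "AE t in lborel. t \<in> {0..\<tau>} \<longrightarrow>
           (\<exists>v. (x has_vector_derivative v) (at t within {0..\<tau>}) \<and>
                (xh has_vector_derivative q t v) (at t within {0..\<tau>}))"
  proof (rule AE_finite_exception[OF F])
    fix t assume t: "t \<in> {0<..<\<tau>} - F"
    obtain u where u: "(p has_vector_derivative roll_velocity (p t) u) (at t)"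
      using der[THEN bspec, OF t] by (rule exE)
    have "q t (frame_comb (x t) u) = A t *v u"
      unfolding q_def by (rule matrix_isom_apply[OF xS]) (use t in auto)
    then show "\<exists>v. (x has_vector_derivative v) (at t within {0..\<tau>}) \<and>
        (xh has_vector_derivative q t v) (at t within {0..\<tau>})"
      using vel(1,2)[OF u] by (intro exI[of _ "frame_comb (x t) u"]) simp
  qed
  moreover have "parallel_along SE3 se3_metric se3_frame \<tau> x Z \<longleftrightarrow>
      parallel_along UNIV euclidean_metric euclidean_frame \<tau> xh (\<lambda>t. q t (Z t))"
    if Z: "\<forall>t\<in>{0..\<tau>}. Z t \<in> tangent_space SE3 (x t)" for Z
  proof -
    define z where "z t = frame_inv (x t) (Z t)" for t
    have Zz: "frame_comb (x t) (z t) = Z t" if t: "t \<in> {0..\<tau>}" for t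
    proof -
      obtain u where "Z t = frame_comb (x t) u"
        using Z[THEN bspec, OF t] unfolding tangent_space_SE3[OF xS[OF t]] by (rule rangeE)
      then show ?thesis by (simp add: z_def frame_inv_comb[OF xS[OF t]])
    qed
    have fc: "frame_coords se3_frame (x t) (Z t) = z t" if t: "t \<in> {0..\<tau>}" for t
      using frame_coords_se3[OF xS[OF t], of "z t"] by (simp only: Zz[OF t])
    have qZ: "q t (Z t) = A t *v z t" if t: "t \<in> {0..\<tau>}" for t
      using matrix_isom_apply[OF xS[OF t], of "A t" "z t"] by (simp only: Zz[OF t] q_def)
    have zA: "z t = transpose (A t) *v q t (Z t)" if t: "t \<in> {0..\<tau>}" for t
      by (simp add: qZ[OF t] matrix_cancel(2)[OF AT[OF t]])
    \<comment> \<open>\<open>Z\<close>, its coordinates \<open>z\<close> and the image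
      \<open>A z\<close> arise from one another by products with absolutely continuous factors;
      \<open>transpose (A t)\<close> serves as the inverse of \<open>A t\<close>.\<close>
    have ac: "abs_continuous_on {0..\<tau>} Z \<longleftrightarrow> abs_continuous_on {0..\<tau>} (\<lambda>t. q t (Z t))"
    proof
      assume acZ: "abs_continuous_on {0..\<tau>} Z"
      have acz: "abs_continuous_on {0..\<tau>} z"
        unfolding z_def[abs_def] frame_inv_def
        by (intro abs_continuous_on_add abs_continuous_on_linear[OF mvr] abs_continuous_on_linear[OF bl_vee]
            abs_continuous_on_bilinear[OF bounded_bilinear_matrix_mult]
            abs_continuous_on_bilinear[OF bounded_bilinear_matrix_vector_mult] acCT
            abs_continuous_on_linear[OF bounded_linear_fst acZ] abs_continuous_on_linear[OF bounded_linear_snd acZ])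
      show "abs_continuous_on {0..\<tau>} (\<lambda>t. q t (Z t))"
        by (rule abs_continuous_on_cong[OF abs_continuous_on_bilinear[OF bounded_bilinear_matrix_vector_mult acA acz]])
          (rule qZ[symmetric])
    next
      assume acq: "abs_continuous_on {0..\<tau>} (\<lambda>t. q t (Z t))"
      have acz: "abs_continuous_on {0..\<tau>} z"
        by (rule abs_continuous_on_cong[OF abs_continuous_on_bilinear[OF bounded_bilinear_matrix_vector_mult acAT acq]])
          (rule zA[symmetric])
      have "abs_continuous_on {0..\<tau>} (\<lambda>t. frame_comb (x t) (z t))"
        unfolding frame_comb_def
        by (intro abs_continuous_on_Pair abs_continuous_on_bilinear[OF bounded_bilinear_matrix_mult]
            abs_continuous_on_bilinear[OF bounded_bilinear_matrix_vector_mult] acC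
            abs_continuous_on_linear[OF bl_om] abs_continuous_on_linear[OF mvr] acz)
      then show "abs_continuous_on {0..\<tau>} Z"
        by (rule abs_continuous_on_cong) (rule Zz)
    qed
    have cov: "has_covariant_derivative SE3 se3_metric se3_frame x Z 0 t {0..\<tau>} \<longleftrightarrow>
        has_covariant_derivative UNIV euclidean_metric euclidean_frame xh (\<lambda>t. q t (Z t)) 0 t {0..\<tau>}"
      if t': "t \<in> {0<..<\<tau>} - F" for t
    proof -
      have t: "t \<in> {0..\<tau>}" using t' by auto
      obtain u where u: "(p has_vector_derivative roll_velocity (p t) u) (at t)"
        using der[THEN bspec, OF t'] by (rule exE)
      note v = vel[OF u]
      have eq1: "has_covariant_derivative SE3 se3_metric se3_frame x Z 0 t {0..\<tau>} \<longleftrightarrow>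
          (z has_vector_derivative - (conn u *v z t)) (at t within {0..\<tau>})"
      proof
        assume "has_covariant_derivative SE3 se3_metric se3_frame x Z 0 t {0..\<tau>}"
        then obtain w where w: "(x has_vector_derivative frame_comb (x t) w) (at t within {0..\<tau>})"
          and d: "((\<lambda>s. frame_coords se3_frame (x s) (Z s)) has_vector_derivative
            - (conn w *v frame_coords se3_frame (x t) (Z t))) (at t within {0..\<tau>})"
          unfolding has_covariant_derivative_SE3[where x = x and t = t, OF xS[OF t]] by (elim exE conjE)
        \<comment> \<open>The covariant derivative only asserts that some velocity \<open>w\<close>
          exists. Uniqueness of derivatives and independence of the frame identify it with the
          control \<open>u\<close>.\<close>
        have "frame_comb (x t) w = frame_comb (x t) u"
          by (rule vector_derivative_unique_within[OF at_within_Icc_nontrivial[OF \<tau> t] w v(1)])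
        then have wu: "w = u" by (simp add: frame_comb_eq_iff[OF xS[OF t]])
        have "(z has_vector_derivative - (conn w *v frame_coords se3_frame (x t) (Z t))) (at t within {0..\<tau>})"
          by (rule has_vector_derivative_transform[OF t _ d]) (rule fc[symmetric])
        then show "(z has_vector_derivative - (conn u *v z t)) (at t within {0..\<tau>})"
          by (simp only: wu fc[OF t])
      next
        assume d: "(z has_vector_derivative - (conn u *v z t)) (at t within {0..\<tau>})"
        have "((\<lambda>s. frame_coords se3_frame (x s) (Z s)) has_vector_derivative - (conn u *v z t)) (at t within {0..\<tau>})"
          by (rule has_vector_derivative_transform[OF t _ d]) (rule fc)
        then show "has_covariant_derivative SE3 se3_metric se3_frame x Z 0 t {0..\<tau>}"
          unfolding has_covariant_derivative_SE3[where x = x and t = t, OF xS[OF t]] fc[OF t]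
          using v(1) by (intro exI[of _ u] conjI)
      qed
      have eq2: "(z has_vector_derivative - (conn u *v z t)) (at t within {0..\<tau>}) \<longleftrightarrow>
          ((\<lambda>t. q t (Z t)) has_vector_derivative 0) (at t within {0..\<tau>})"
      proof
        assume d: "(z has_vector_derivative - (conn u *v z t)) (at t within {0..\<tau>})"
        have "((\<lambda>s. A s *v z s) has_vector_derivative
            A t *v - (conn u *v z t) + (A t ** conn u) *v z t) (at t within {0..\<tau>})"
          by (rule bounded_bilinear.has_vector_derivative[OF bounded_bilinear_matrix_vector_mult v(3) d])
        then have "((\<lambda>s. A s *v z s) has_vector_derivative 0) (at t within {0..\<tau>})"
          by (simp add: mv_simps matrix_vector_mul_assoc)
        then show "((\<lambda>t. q t (Z t)) has_vector_derivative 0) (at t within {0..\<tau>})"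
          by (rule has_vector_derivative_transform[OF t, rotated]) (rule qZ)
      next
        assume d: "((\<lambda>t. q t (Z t)) has_vector_derivative 0) (at t within {0..\<tau>})"
        have "((\<lambda>s. transpose (A s) *v q s (Z s)) has_vector_derivative
            transpose (A t) *v 0 + transpose (A t ** conn u) *v q t (Z t)) (at t within {0..\<tau>})"
          by (rule bounded_bilinear.has_vector_derivative[OF bounded_bilinear_matrix_vector_mult
                bounded_linear.has_vector_derivative[OF bounded_linear_transpose v(3)] d])
        moreover have "transpose (A t) *v 0 + transpose (A t ** conn u) *v q t (Z t) = - (conn u *v z t)"
          unfolding zA[OF t]
          by (simp add: matrix_transpose_mul transpose_conn mv_simps matrix_vector_mul_assoc mm_simps)
        ultimately have "((\<lambda>s. transpose (A s) *v q s (Z s)) has_vector_derivative - (conn u *v z t)) (at t within {0..\<tau>})"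
          by (simp only:)
        then show "(z has_vector_derivative - (conn u *v z t)) (at t within {0..\<tau>})"
          by (rule has_vector_derivative_transform[OF t, rotated]) (rule zA)
      qed
      show ?thesis
        unfolding eq1 eq2 has_covariant_derivative_euclidean using v(2) by iprover
    qed
    show ?thesis
      unfolding parallel_along_def ac by (intro conj_cong refl AE_Icc_iff[OF F] cov)
  qed
  moreover have "(\<lambda>t. config_of (p t)) ` {0..\<tau>} \<subseteq> Q"
    using config_of_in_Q[OF pQ] by (rule image_subsetI)
  moreover have "abs_continuous_on {0..\<tau>} (Q_coords \<circ> (\<lambda>t. config_of (p t)))"
    by (rule abs_continuous_on_cong[OF acp]) (simp add: Q_coords_config_of[OF pQ])
  ultimately show ?thesis
    unfolding intrinsic_rolling_def Let_def
    by (simp add: config_of_def case_prod_unfold x_def[abs_def] xh_def[abs_def] q_def[abs_def] A_def)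
qed

section \<open>Reachability and concatenation\<close>

definition reach ::
    "model_config \<Rightarrow> model_config \<Rightarrow> bool" where
  "reach p0 p1 \<longleftrightarrow> (\<exists>\<tau> p. model_rolling \<tau> p \<and> p 0 = p0 \<and> p \<tau> = p1)"

lemma model_rolling_in_model: "model_rolling \<tau> p \<Longrightarrow> t \<in> {0..\<tau>} \<Longrightarrow> p t \<in> Q_model"
  unfolding model_rolling_def by (elim conjE) (rule image_subset_iff[THEN iffD1, THEN bspec])

lemma model_rolling_leaf_map:
  assumes "model_rolling \<tau> p" "t \<in> {0..\<tau>}"
  shows "leaf_map (p t) = leaf_map (p 0)"
proof -
  have \<tau>: "\<tau> > 0" using assms(1) by (simp add: model_rolling_def)
  then have 0: "0 \<in> {0..\<tau>}" by simp
  show ?thesis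
    using intrinsic_rolling_leaf_map[OF model_rolling_intrinsic[OF assms(1)] \<tau> assms(2)]
    by (simp only: Q_coords_config_of[OF model_rolling_in_model[OF assms]]
        Q_coords_config_of[OF model_rolling_in_model[OF assms(1) 0]])
qed

lemma reach_in_model: "reach p0 p1 \<Longrightarrow> p0 \<in> Q_model \<and> p1 \<in> Q_model"
proof -
  assume "reach p0 p1"
  then obtain \<tau> p where p: "model_rolling \<tau> p" "p 0 = p0" "p \<tau> = p1" unfolding reach_def by (elim exE conjE)
  have "\<tau> > 0" using p(1) by (simp add: model_rolling_def)
  then show ?thesis
    using model_rolling_in_model[OF p(1), of 0] model_rolling_in_model[OF p(1), of \<tau>] p(2,3) by simp
qed

lemma reach_leaf_map: "reach p0 p1 \<Longrightarrow> leaf_map p1 = leaf_map p0"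
proof -
  assume "reach p0 p1"
  then obtain \<tau> p where p: "model_rolling \<tau> p" "p 0 = p0" "p \<tau> = p1" unfolding reach_def by (elim exE conjE)
  have "\<tau> > 0" using p(1) by (simp add: model_rolling_def)
  then show ?thesis using model_rolling_leaf_map[OF p(1), of \<tau>] p(2,3) by simp
qed

lemma has_vector_derivative_shift:
  assumes "(f has_vector_derivative v) (at (t - c))"
  shows "((\<lambda>t. f (t - c)) has_vector_derivative v) (at t)"
proof -
  have "((\<lambda>t. t - c) has_vector_derivative 1) (at t)"
    by (auto intro!: derivative_eq_intros)
  from vector_diff_chain_at[OF this assms] show ?thesis by (simp add: o_def)
qed

lemma reach_trans:
  assumes "reach p0 p1" "reach p1 p2"
  shows "reach p0 p2"
proof -
  obtain \<sigma> f where f: "model_rolling \<sigma> f" "f 0 = p0" "f \<sigma> = p1"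
    using assms(1) unfolding reach_def by (elim exE conjE)
  obtain \<tau> g where g: "model_rolling \<tau> g" "g 0 = p1" "g \<tau> = p2"
    using assms(2) unfolding reach_def by (elim exE conjE)
  have \<sigma>: "\<sigma> > 0" and \<tau>: "\<tau> > 0" using f(1) g(1) by (simp_all add: model_rolling_def)
  obtain L1 where L1: "\<forall>s\<in>{0..\<sigma>}. \<forall>t\<in>{0..\<sigma>}. norm (f t - f s) \<le> L1 * \<bar>t - s\<bar>"
    using f(1) unfolding model_rolling_def by (elim conjE exE)
  obtain L2 where L2: "\<forall>s\<in>{0..\<tau>}. \<forall>t\<in>{0..\<tau>}. norm (g t - g s) \<le> L2 * \<bar>t - s\<bar>"
    using g(1) unfolding model_rolling_def by (elim conjE exE)
  obtain F where F: "finite F"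
    "\<forall>t\<in>{0<..<\<sigma>} - F. \<exists>u. (f has_vector_derivative roll_velocity (f t) u) (at t)"
    using f(1) unfolding model_rolling_def by (elim conjE exE)
  obtain G where G: "finite G"
    "\<forall>t\<in>{0<..<\<tau>} - G. \<exists>u. (g has_vector_derivative roll_velocity (g t) u) (at t)"
    using g(1) unfolding model_rolling_def by (elim conjE exE)
  define h where "h t = (if t \<le> \<sigma> then f t else g (t - \<sigma>))" for t
  have h2: "h t = g (t - \<sigma>)" if "t \<ge> \<sigma>" for t
    using that f(3) g(2) by (cases "t = \<sigma>") (auto simp: h_def)
  have "model_rolling (\<sigma> + \<tau>) h"
    unfolding model_rolling_def
  proof (intro conjI)
    show "\<sigma> + \<tau> > 0" using \<sigma> \<tau> by simp
    show "h ` {0..\<sigma> + \<tau>} \<subseteq> Q_model"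
    proof (rule image_subsetI)
      fix t assume "t \<in> {0..\<sigma> + \<tau>}"
      then show "h t \<in> Q_model"
        using model_rolling_in_model[OF f(1), of t] model_rolling_in_model[OF g(1), of "t - \<sigma>"]
        by (cases "t \<le> \<sigma>") (simp_all add: h_def)
    qed
    define L where "L = \<bar>L1\<bar> + \<bar>L2\<bar>"
    have 1: "norm (h t - h s) \<le> L * (t - s)" if "0 \<le> s" "s \<le> t" "t \<le> \<sigma>" for s t
    proof -
      have "norm (f t - f s) \<le> L1 * \<bar>t - s\<bar>"
        by (rule L1[THEN bspec, THEN bspec]) (use that in auto)
      then have "norm (h t - h s) \<le> L1 * (t - s)" using that by (simp add: h_def)
      also have "\<dots> \<le> L * (t - s)" using that by (intro mult_right_mono) (auto simp: L_def)
      finally show ?thesis .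
    qed
    have 2: "norm (h t - h s) \<le> L * (t - s)" if "\<sigma> \<le> s" "s \<le> t" "t \<le> \<sigma> + \<tau>" for s t
    proof -
      have "norm (g (t - \<sigma>) - g (s - \<sigma>)) \<le> L2 * \<bar>(t - \<sigma>) - (s - \<sigma>)\<bar>"
        by (rule L2[THEN bspec, THEN bspec]) (use that in auto)
      then have "norm (h t - h s) \<le> L2 * (t - s)" using that by (simp add: h2)
      also have "\<dots> \<le> L * (t - s)" using that by (intro mult_right_mono) (auto simp: L_def)
      finally show ?thesis .
    qed
    have 3: "norm (h t - h s) \<le> L * (t - s)" if st: "0 \<le> s" "s \<le> t" "t \<le> \<sigma> + \<tau>" for s t
    proof (cases "t \<le> \<sigma> \<or> \<sigma> \<le> s")
      case True
      then show ?thesis using 1[of s t] 2[of s t] st by auto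
    next
      case False
      \<comment> \<open>An interval that straddles the junction is split at
        \<open>\<sigma>\<close>.\<close>
      have "norm (h t - h s) \<le> norm (h t - h \<sigma>) + norm (h \<sigma> - h s)"
        using norm_triangle_ineq[of "h t - h \<sigma>" "h \<sigma> - h s"] by simp
      also have "\<dots> \<le> L * (t - \<sigma>) + L * (\<sigma> - s)"
        using 1[of s \<sigma>] 2[of \<sigma> t] st False by (intro add_mono) auto
      finally show ?thesis by (simp add: algebra_simps)
    qed
    show "\<exists>L. \<forall>s\<in>{0..\<sigma> + \<tau>}. \<forall>t\<in>{0..\<sigma> + \<tau>}. norm (h t - h s) \<le> L * \<bar>t - s\<bar>"
    proof (intro exI[of _ L] ballI)
      fix s t assume "s \<in> {0..\<sigma> + \<tau>}" "t \<in> {0..\<sigma> + \<tau>}"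
      then show "norm (h t - h s) \<le> L * \<bar>t - s\<bar>"
        using 3[of s t] 3[of t s] by (cases "s \<le> t") (auto simp: norm_minus_commute abs_minus_commute)
    qed
    show "\<exists>F. finite F \<and> (\<forall>t\<in>{0<..<\<sigma> + \<tau>} - F. \<exists>u. (h has_vector_derivative roll_velocity (h t) u) (at t))"
    \<comment> \<open>The junction joins the exceptional set because the controls on its two sides
      may differ.\<close>
    proof (intro exI[of _ "insert \<sigma> (F \<union> (\<lambda>t. t + \<sigma>) ` G)"] conjI ballI)
      show "finite (insert \<sigma> (F \<union> (\<lambda>t. t + \<sigma>) ` G))" using F(1) G(1) by simp
      fix t assume t: "t \<in> {0<..<\<sigma> + \<tau>} - insert \<sigma> (F \<union> (\<lambda>t. t + \<sigma>) ` G)"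
      show "\<exists>u. (h has_vector_derivative roll_velocity (h t) u) (at t)"
      proof (cases "t < \<sigma>")
        case True
        then have tF: "t \<in> {0<..<\<sigma>} - F" using t by auto
        obtain u where u: "(f has_vector_derivative roll_velocity (f t) u) (at t)"
          using F(2)[THEN bspec, OF tF] by (rule exE)
        have "(h has_vector_derivative roll_velocity (f t) u) (at t)"
          by (rule has_vector_derivative_transform_within_open[OF u, of "{..<\<sigma>}"]) (use True in \<open>auto simp: h_def\<close>)
        then show ?thesis using True by (intro exI[of _ u]) (simp add: h_def)
      next
        case False
        then have s: "\<sigma> < t" using t by auto
        have "t - \<sigma> \<notin> G"
        proof
          assume "t - \<sigma> \<in> G"
          then have "(t - \<sigma>) + \<sigma> \<in> (\<lambda>t. t + \<sigma>) ` G" by (rule imageI)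
          then show False using t by simp
        qed
        then have tG: "t - \<sigma> \<in> {0<..<\<tau>} - G" using t s by auto
        obtain u where u: "(g has_vector_derivative roll_velocity (g (t - \<sigma>)) u) (at (t - \<sigma>))"
          using G(2)[THEN bspec, OF tG] by (rule exE)
        have "(h has_vector_derivative roll_velocity (g (t - \<sigma>)) u) (at t)"
          by (rule has_vector_derivative_transform_within_open[OF has_vector_derivative_shift[OF u], of "{\<sigma><..}"])
            (use s in \<open>auto simp: h_def\<close>)
        then show ?thesis using s by (intro exI[of _ u]) (simp add: h_def)
      qed
    qed
  qed
  moreover have "h 0 = p0" "h (\<sigma> + \<tau>) = p2"
    using \<sigma> \<tau> f(2) g(3) by (simp_all add: h_def h2)
  ultimately show ?thesis unfolding reach_def by (intro exI[of _ "\<sigma> + \<tau>"] exI[of _ h] conjI)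
qed

lemma bounded_linear_roll_velocity: "bounded_linear (\<lambda>p. roll_velocity p u)"
  unfolding linear_conv_bounded_linear[symmetric]
  by (rule linearI) (simp_all add: roll_velocity_def mv_simps mm_simps
      linear_add[OF linear_frame_comb_point] linear_scale[OF linear_frame_comb_point])

text \<open>For a fixed control the velocity is linear in the configuration, hence continuous along
  the curve and bounded on a compact interval; the mean value inequality gives the Lipschitz
  constant.\<close>

lemma reach_segment:
  assumes \<tau>: "\<tau> > 0" and p: "\<And>t. p t \<in> Q_model"
    and d: "\<And>t. (p has_vector_derivative roll_velocity (p t) u) (at t)"
  shows "reach (p 0) (p \<tau>)"
proof -
  have "continuous_on {0..\<tau>} p"
    by (rule continuous_at_imp_continuous_on) (use has_vector_derivative_continuous[OF d] in blast)
  then have "continuous_on {0..\<tau>} (\<lambda>t. roll_velocity (p t) u)"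
    by (rule bounded_linear.continuous_on[OF bounded_linear_roll_velocity])
  then have "bounded ((\<lambda>t. roll_velocity (p t) u) ` {0..\<tau>})"
    by (intro compact_imp_bounded compact_continuous_image) simp_all
  then obtain B where B: "B > 0" "\<forall>t\<in>{0..\<tau>}. norm (roll_velocity (p t) u) \<le> B"
    unfolding bounded_pos by (elim exE conjE) auto
  have lip: "norm (p t - p s) \<le> B * norm (t - s)" if "s \<in> {0..\<tau>}" "t \<in> {0..\<tau>}" for s t
  proof (rule differentiable_bound)
    show "convex {0..\<tau>}" by simp
    show "(p has_derivative (\<lambda>h. h *\<^sub>R roll_velocity (p t) u)) (at t within {0..\<tau>})" for t
      using has_vector_derivative_at_within[OF d] by (simp add: has_vector_derivative_def)
    show "onorm (\<lambda>h. h *\<^sub>R roll_velocity (p t) u) \<le> B" if "t \<in> {0..\<tau>}" for t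
    proof (rule onorm_bound)
      show "norm (h *\<^sub>R roll_velocity (p t) u) \<le> B * norm h" for h
        using mult_left_mono[OF B(2)[THEN bspec, OF that] abs_ge_zero, of h] by (simp add: mult.commute)
    qed (use B(1) in simp)
  qed (use that in auto)
  have "model_rolling \<tau> p"
    unfolding model_rolling_def
  proof (intro conjI)
    show "\<exists>L. \<forall>s\<in>{0..\<tau>}. \<forall>t\<in>{0..\<tau>}. norm (p t - p s) \<le> L * \<bar>t - s\<bar>"
      using lip by (intro exI[of _ B]) simp
    show "\<exists>F. finite F \<and> (\<forall>t\<in>{0<..<\<tau>} - F. \<exists>u. (p has_vector_derivative roll_velocity (p t) u) (at t))"
      by (intro exI[of _ "{}"] conjI ballI exI[of _ u] d) simp
  qed (use \<tau> p in auto)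
  then show ?thesis unfolding reach_def by (intro exI[of _ \<tau>] exI[of _ p]) simp
qed

section \<open>Elementary motions: translations and turns about an axis\<close>

lemma Q_model_iff: "((C, r), xh, A) \<in> Q_model \<longleftrightarrow> rotation_matrix C \<and> rotation_matrix A"
  by (simp add: Q_model_def SE3_iff)

lemma emb_proj_single:
  "transpose emb1 *v (emb1 *v a) = a" "transpose emb2 *v (emb2 *v b) = b"
  "transpose emb2 *v (emb1 *v a) = 0" "transpose emb1 *v (emb2 *v b) = 0"
  by (simp_all add: matrix_vector_mul_assoc mv_simps)

text \<open>A purely translational control has connection matrix zero, so the isometry stays put.
  The value of \<open>xh'\<close> is left open: the second invariant and later displacements take
  care of it.\<close>

lemma reach_translation:
  assumes "((C, r), xh, A) \<in> Q_model"
  shows "\<exists>xh'. reach ((C, r), xh, A) ((C, r + w), xh', A)"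
proof -
  define u where "u = emb2 *v (transpose C *v w)"
  define p where "p t = ((C, r + t *\<^sub>R w), xh + t *\<^sub>R (A *v u), A)" for t :: real
  have CC: "C *v (transpose C *v w) = w"
    using assms by (simp add: Q_model_iff rotation_matrix_def orthogonal_matrix_def matrix_cancel(2))
  have "gam 0 = 0" "om 0 = 0" by (simp_all add: gam_def linear_0[OF linear_om] vec_eq_iff forall_3)
  then have cu: "conn u = 0" by (simp add: conn_def u_def emb_proj_single blk_def mm_simps)
  have "(p has_vector_derivative ((0, w), A *v u, 0)) (at t)" for t
    unfolding p_def by (auto intro!: derivative_eq_intros has_vector_derivative_Pair)
  moreover have "roll_velocity (p t) u = ((0, w), A *v u, 0)" for t
    by (simp add: roll_velocity_def p_def frame_comb_def cu mm_simps)
      (simp add: u_def emb_proj_single CC linear_0[OF linear_om] mm_simps)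
  ultimately have d: "(p has_vector_derivative roll_velocity (p t) u) (at t)" for t
    by (simp only:)
  have "reach (p 0) (p 1)"
  proof (rule reach_segment[OF zero_less_one _ d])
    show "p t \<in> Q_model" for t using assms by (simp add: p_def Q_model_iff)
  qed
  then show ?thesis by (intro exI[of _ "xh + A *v u"]) (simp add: p_def)
qed

definition hat :: "real^3 \<Rightarrow> real^3^3" where
  "hat n = vector [vector [0, - n $ 3, n $ 2], vector [n $ 3, 0, - n $ 1], vector [- n $ 2, n $ 1, 0]]"

lemma unit_vector_3: "norm n = 1 \<longleftrightarrow> n $ 1 * n $ 1 + n $ 2 * n $ 2 + n $ 3 * n $ 3 = 1" for n :: "real^3"
  by (simp add: norm_eq_1 inner_vec_def sum_3)

lemma rotation_axis_hat:
  assumes "norm n = 1"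
  shows "rotation_axis (hat n)"
proof
  show "transpose (hat n) = - hat n"
    by (simp add: hat_def vec_eq_iff forall_3 transpose_def)
  have "hat n ** (hat n ** hat n) = - ((n $ 1 * n $ 1 + n $ 2 * n $ 2 + n $ 3 * n $ 3) *\<^sub>R hat n)"
    by (simp add: hat_def vec_eq_iff forall_3 matrix_matrix_mult_def sum_3 algebra_simps)
  then show "hat n ** (hat n ** hat n) = - hat n"
    using assms by (simp only: unit_vector_3 scaleR_one)
qed

lemma om_sqrt2: "om (sqrt 2 *\<^sub>R n) =
    vector [vector [0, n $ 1, n $ 2], vector [- n $ 1, 0, n $ 3], vector [- n $ 2, - n $ 3, 0]]"
  by (simp add: om_def vec_eq_iff forall_3)

lemma rotation_axis_om:
  assumes "norm n = 1"
  shows "rotation_axis (om (sqrt 2 *\<^sub>R n))"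
proof
  show "transpose (om (sqrt 2 *\<^sub>R n)) = - om (sqrt 2 *\<^sub>R n)" by (rule transpose_om)
  have "om (sqrt 2 *\<^sub>R n) ** (om (sqrt 2 *\<^sub>R n) ** om (sqrt 2 *\<^sub>R n)) =
      - ((n $ 1 * n $ 1 + n $ 2 * n $ 2 + n $ 3 * n $ 3) *\<^sub>R om (sqrt 2 *\<^sub>R n))"
    by (simp add: om_sqrt2 vec_eq_iff forall_3 matrix_matrix_mult_def sum_3 algebra_simps)
  then show "om (sqrt 2 *\<^sub>R n) ** (om (sqrt 2 *\<^sub>R n) ** om (sqrt 2 *\<^sub>R n)) = - om (sqrt 2 *\<^sub>R n)"
    using assms by (simp only: unit_vector_3 scaleR_one)
qed

text \<open>With \<open>N = hat n\<close> both sides are \<open>1 + 2 N^2\<close>. The negative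
  angle is the form in which the rotational block will meet it, at \<open>- \<theta> / 2\<close> for
  \<open>\<theta> = 2 * pi\<close>.\<close>

lemma rot_hat_pi:
  assumes "norm n = 1"
  shows "rot (hat n) (- pi) = half_turn n"
proof -
  have n1: "n $ 1 * n $ 1 + n $ 2 * n $ 2 + n $ 3 * n $ 3 = 1"
    using assms by (simp add: unit_vector_3)
  show ?thesis
    by (simp add: rot_def half_turn_def hat_def vec_eq_iff forall_3 matrix_matrix_mult_def sum_3
        mat_def) (intro conjI; use n1 in algebra)
qed

text \<open>\<open>om (sqrt 2 *\<^sub>R n)\<close> is the cross product matrix of
  \<open>(- n_3, n_2, - n_1)\<close>, which is therefore the actual axis of the turn of
  \<open>C\<close> in body coordinates.\<close>

lemma rot_om_pi:
  assumes "norm n = 1"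
  shows "rot (om (sqrt 2 *\<^sub>R n)) pi = half_turn (vector [- n $ 3, n $ 2, - n $ 1])"
proof -
  have n1: "n $ 1 * n $ 1 + n $ 2 * n $ 2 + n $ 3 * n $ 3 = 1"
    using assms by (simp add: unit_vector_3)
  show ?thesis
    by (simp add: rot_def half_turn_def om_sqrt2 vec_eq_iff forall_3 matrix_matrix_mult_def sum_3
        mat_def) (intro conjI; use n1 in algebra)
qed

text \<open>The factor \<open>- 1/2\<close> here, against unit speed for
  \<open>om (sqrt 2 *\<^sub>R n)\<close> in the other block, is the two-to-one ratio of the turning
  angles.\<close>

lemma gam_sqrt2: "gam (sqrt 2 *\<^sub>R n) = (- 1/2) *\<^sub>R hat n"
  by (simp add: gam_def hat_def vec_eq_iff forall_3)

lemma hat_axis: "hat n *v n = 0"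
  by (simp add: hat_def vec_eq_iff forall_3 matrix_vector_mult_def sum_3)

lemma rot_fixes_kernel: "N *v a = 0 \<Longrightarrow> rot N t *v a = a"
  by (simp add: rot_def mv_simps flip: matrix_vector_mul_assoc)

lemma blk_has_vector_derivative:
  assumes "(f has_vector_derivative f') (at t)" "(g has_vector_derivative g') (at t)"
  shows "((\<lambda>t. blk (f t) (g t)) has_vector_derivative blk f' g') (at t)"
  unfolding blk_def
  by (intro has_vector_derivative_add
      bounded_linear.has_vector_derivative[OF bounded_bilinear.bounded_linear_right[OF bounded_bilinear_matrix_mult]]
      bounded_linear.has_vector_derivative[OF bounded_bilinear.bounded_linear_left[OF bounded_bilinear_matrix_mult]] assms)

text \<open>A constant angular velocity about the axis \<open>n\<close> turns \<open>C\<close> by the angle \<open>\<theta>\<close>, but the rotational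
  block of \<open>A\<close> only by half of that angle.\<close>

lemma reach_rotation:
  assumes m: "((C, r), xh, A) \<in> Q_model" and n: "norm n = 1" and \<theta>: "\<theta> > 0"
  shows "reach ((C, r), xh, A)
    ((C ** rot (om (sqrt 2 *\<^sub>R n)) \<theta>, r), xh + \<theta> *\<^sub>R (A *v (emb1 *v (sqrt 2 *\<^sub>R n))),
     A ** blk (rot (hat n) (- (\<theta> / 2))) (rot (om (sqrt 2 *\<^sub>R n)) \<theta>))"
proof -
  \<comment> \<open>\<open>sqrt 2\<close> undoes the normalization of the frame, so that
    \<open>om a\<close> generates a turn of unit speed.\<close>
  define a where "a = sqrt 2 *\<^sub>R n"
  define u where "u = emb1 *v a"
  define p where "p t = ((C ** rot (om a) t, r), xh + t *\<^sub>R (A *v u),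
      A ** blk (rot (hat n) (- (t / 2))) (rot (om a) t))" for t :: real
  interpret N: rotation_axis "om a" unfolding a_def by (rule rotation_axis_om[OF n])
  interpret M: rotation_axis "hat n" by (rule rotation_axis_hat[OF n])
  note mr = bounded_linear.has_vector_derivative[OF bounded_bilinear.bounded_linear_right[OF bounded_bilinear_matrix_mult]]
  have dN: "((\<lambda>t. rot (om a) t) has_vector_derivative rot (om a) t ** om a) (at t)" for t
    using N.rot_derivative[of 1 t UNIV] by simp
  have dM: "((\<lambda>t. rot (hat n) (- (t / 2))) has_vector_derivative rot (hat n) (- (t / 2)) ** ((- 1/2) *\<^sub>R hat n)) (at t)" for t
    using M.rot_derivative[of "- 1/2" t UNIV] by simp
  have d: "(p has_vector_derivative ((C ** (rot (om a) t ** om a), 0), A *v u,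
      A ** blk (rot (hat n) (- (t / 2)) ** ((- 1/2) *\<^sub>R hat n)) (rot (om a) t ** om a))) (at t)" for t
    unfolding p_def
    by (intro has_vector_derivative_Pair mr dN blk_has_vector_derivative dM has_vector_derivative_const)
      (auto intro!: derivative_eq_intros)
  have "hat n *v a = 0" by (simp add: a_def mv_simps hat_axis)
  \<comment> \<open>\<open>u\<close> has no translational part and lies on the axis of the turning
    rotational block. Hence \<open>A u\<close> is constant although \<open>A\<close> moves, and
    \<open>xh\<close> runs along a straight line.\<close>
  then have fix_u: "blk (rot (hat n) s) h *v u = u" for s h
    by (simp add: u_def blk_apply emb_proj_single mv_simps rot_fixes_kernel)
  have cu: "conn u = blk ((- 1/2) *\<^sub>R hat n) (om a)"
    by (simp add: conn_def u_def emb_proj_single a_def gam_sqrt2)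
  have v: "roll_velocity (p t) u = ((C ** (rot (om a) t ** om a), 0), A *v u,
      A ** blk (rot (hat n) (- (t / 2)) ** ((- 1/2) *\<^sub>R hat n)) (rot (om a) t ** om a))" for t
  proof -
    have "A ** blk (rot (hat n) (- (t / 2))) (rot (om a) t) *v u = A *v u"
      by (simp add: fix_u flip: matrix_vector_mul_assoc)
    moreover have "A ** blk (rot (hat n) (- (t / 2))) (rot (om a) t) ** conn u =
        A ** blk (rot (hat n) (- (t / 2)) ** ((- 1/2) *\<^sub>R hat n)) (rot (om a) t ** om a)"
      unfolding cu by (simp only: blk_mult flip: matrix_mul_assoc)
    moreover have "frame_comb (C ** rot (om a) t, r) u = (C ** (rot (om a) t ** om a), 0)"
      by (simp add: frame_comb_def u_def emb_proj_single matrix_mul_assoc mv_simps)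
    ultimately show ?thesis by (simp add: roll_velocity_def p_def)
  qed
  have rb: "rotation_matrix (blk (rot (hat n) (- (t / 2))) (rot (om a) t))" for t
  proof -
    \<comment> \<open>The block matrix is the square of its half-angle version, which settles the
      sign of its determinant.\<close>
    have "blk (rot (hat n) (- (t / 2))) (rot (om a) t) =
        blk (rot (hat n) (- (t / 2) / 2)) (rot (om a) (t / 2)) ** blk (rot (hat n) (- (t / 2) / 2)) (rot (om a) (t / 2))"
      unfolding blk_mult using M.rot_square[of "- (t / 2)"] N.rot_square[of t] by simp
    then show ?thesis
      using det_orthogonal_square[OF orthogonal_blk[OF M.orthogonal_rot N.orthogonal_rot]]
        orthogonal_blk[OF M.orthogonal_rot N.orthogonal_rot]
      by (metis rotation_matrix_def)
  qed
  have "reach (p 0) (p \<theta>)"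
  proof (rule reach_segment[OF \<theta>])
    show "p t \<in> Q_model" for t
      using m rb[of t] N.orthogonal_rot N.det_rot
      by (simp add: p_def Q_model_iff rotation_matrix_mult rotation_matrix_def[of "rot (om a) t"])
    show "(p has_vector_derivative roll_velocity (p t) u) (at t)" for t
      unfolding v by (rule d)
  qed
  then show ?thesis by (simp add: p_def u_def a_def blk_one)
qed

text \<open>The summands are \<open>v / 2\<close> plus and minus a vector orthogonal to
  \<open>v\<close> whose length is given by Pythagoras. Turns about an axis displace by vectors of
  one fixed length, and this yields the shorter ones.\<close>

lemma sum_of_two_of_norm:
  fixes v :: "'a::euclidean_space"
  assumes "DIM('a) \<ge> 2" "norm v \<le> 2 * \<rho>" "\<rho> > 0"
  obtains a b where "norm a = \<rho>" "norm b = \<rho>" "v = a + b"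
proof -
  obtain y where y: "y \<noteq> 0" "orthogonal v y"
    using orthogonal_to_vector_exists[OF assms(1)] by blast
  define h where "h = (sqrt (\<rho>\<^sup>2 - (norm v)\<^sup>2 / 4) / norm y) *\<^sub>R y"
  have "(norm v)\<^sup>2 \<le> (2 * \<rho>)\<^sup>2" using assms(2) by (rule power_mono) simp
  then have nn: "\<rho>\<^sup>2 - (norm v)\<^sup>2 / 4 \<ge> 0" by (simp add: power_mult_distrib)
  have nh: "(norm h)\<^sup>2 = \<rho>\<^sup>2 - (norm v)\<^sup>2 / 4"
    using y(1) nn by (simp add: h_def power_mult_distrib power_divide)
  have vh: "v \<bullet> h = 0" using y(2) by (simp add: h_def orthogonal_def)
  have 1: "norm ((1/2) *\<^sub>R v + s *\<^sub>R h) = \<rho>" if "s * s = 1" for s :: real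
  proof -
    have "(norm ((1/2) *\<^sub>R v + s *\<^sub>R h))\<^sup>2 = (norm v)\<^sup>2 / 4 + (s * s) * (norm h)\<^sup>2"
      by (simp add: power2_norm_eq_inner inner_add_left inner_add_right vh inner_commute[of h v])
    also have "\<dots> = \<rho>\<^sup>2" by (simp add: that nh)
    finally show ?thesis using assms(3) by (simp add: power2_eq_iff_nonneg)
  qed
  show thesis
  proof (rule that)
    show "norm ((1/2) *\<^sub>R v + 1 *\<^sub>R h) = \<rho>" "norm ((1/2) *\<^sub>R v + (-1) *\<^sub>R h) = \<rho>"
      by (rule 1, simp)+
    show "v = ((1/2) *\<^sub>R v + 1 *\<^sub>R h) + ((1/2) *\<^sub>R v + (-1) *\<^sub>R h)"
      by (simp flip: scaleR_left_distrib)
  qed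
qed

text \<open>Turning by \<open>4\<pi>\<close> restores \<open>C\<close> and \<open>A\<close> and displaces \<open>xh\<close> by a vector of fixed length and arbitrary
  rotational direction.\<close>

lemma reach_displacement:
  assumes m: "((C, r), xh, A) \<in> Q_model"
  shows "reach ((C, r), xh, A) ((C, r), xh + A *v (emb1 *v v), A)"
proof -
  \<comment> \<open>Quantifying over \<open>xh\<close> lets displacements be performed one after
    another, so that \<open>R\<close> is closed under addition.\<close>
  define R where "R v \<longleftrightarrow> (\<forall>xh. reach ((C, r), xh, A) ((C, r), xh + A *v (emb1 *v v), A))" for v
  have m': "((C, r), xh, A) \<in> Q_model" for xh using m by (simp add: Q_model_iff)
  have add: "R (v + w)" if "R v" "R w" for v w
    unfolding R_def
  proof
    fix xh
    have "reach ((C, r), xh, A) ((C, r), xh + A *v (emb1 *v v), A)"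
      "reach ((C, r), xh + A *v (emb1 *v v), A) ((C, r), xh + A *v (emb1 *v v) + A *v (emb1 *v w), A)"
      by (fact that(1)[unfolded R_def, THEN spec] that(2)[unfolded R_def, THEN spec])+
    then have "reach ((C, r), xh, A) ((C, r), xh + A *v (emb1 *v v) + A *v (emb1 *v w), A)"
      by (rule reach_trans)
    then show "reach ((C, r), xh, A) ((C, r), xh + A *v (emb1 *v (v + w)), A)"
      by (simp add: mv_simps add.assoc)
  qed
  \<comment> \<open>The angle \<open>4 * pi\<close> times the length \<open>sqrt 2\<close> of the
    control.\<close>
  define \<rho> where "\<rho> = 4 * pi * sqrt 2"
  have \<rho>: "\<rho> > 0" by (simp add: \<rho>_def)
  have 1: "R v" if "norm v = \<rho>" for v
    unfolding R_def
  proof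
    fix xh
    define n where "n = (1 / \<rho>) *\<^sub>R v"
    have "norm n = 1" using that \<rho> by (simp add: n_def)
    then interpret M: rotation_axis "hat n" by (rule rotation_axis_hat)
    have "rot (hat n) (- (4 * pi / 2)) = mat 1"
      using M.transpose_rot[of "2 * pi"] by (simp add: tr_simps)
    moreover have "(4 * pi) *\<^sub>R (A *v (emb1 *v (sqrt 2 *\<^sub>R n))) = A *v (emb1 *v v)"
    proof -
      have "v = (4 * pi) *\<^sub>R (sqrt 2 *\<^sub>R n)" using \<rho> by (simp add: n_def \<rho>_def)
      then show ?thesis by (simp add: mv_simps)
    qed
    ultimately show "reach ((C, r), xh, A) ((C, r), xh + A *v (emb1 *v v), A)"
      using reach_rotation[OF m'[of xh] \<open>norm n = 1\<close>, of "4 * pi"] by (simp add: blk_one)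
  qed
  have 2: "R v" if "norm v \<le> 2 * \<rho>" for v
  proof -
    have "DIM(real^3) \<ge> 2" by simp
    from sum_of_two_of_norm[OF this that \<rho>] obtain a b where "norm a = \<rho>" "norm b = \<rho>" "v = a + b" .
    then show ?thesis using add[OF 1 1] by simp
  qed
  \<comment> \<open>A long \<open>v\<close> is cut into \<open>Suc N\<close> equal pieces of length
    at most \<open>2 * \<rho>\<close>; \<open>Suc\<close> guards against a division by zero.\<close>
  obtain N where N: "norm v / (2 * \<rho>) \<le> real N" using real_arch_simple by blast
  define w where "w = (1 / real (Suc N)) *\<^sub>R v"
  have "norm v \<le> real N * (2 * \<rho>)" using N \<rho> by (simp add: field_simps)
  also have "\<dots> \<le> real (Suc N) * (2 * \<rho>)" using \<rho> by (intro mult_right_mono) auto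
  finally have "norm w \<le> 2 * \<rho>" by (simp add: w_def field_simps)
  then have "R (real k *\<^sub>R w)" for k
  proof (induction k)
    case 0
    show ?case using 2[of 0] \<rho> by simp
  next
    case (Suc k)
    then show ?case using add[OF Suc.IH[OF Suc.prems] 2[OF Suc.prems]] by (simp add: algebra_simps)
  qed
  from this[of "Suc N"] have "R v" by (simp add: w_def del: of_nat_Suc)
  then show ?thesis by (simp add: R_def)
qed

lemma reach_rotational_block:
  assumes m: "((C, r), xh, A) \<in> Q_model" and g: "rotation_matrix g"
  shows "reach ((C, r), xh, A) ((C, r), xh, A ** blk g (mat 1))"
  using g
proof (rule rotation_half_turn_induct)
  show "reach ((C, r), xh, A) ((C, r), xh, A ** blk (mat 1) (mat 1))"
    using reach_displacement[OF m, of 0] by (simp add: blk_one mv_simps)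
next
  fix g :: "real^3^3" and n :: "real^3"
  assume n: "norm n = 1" and R: "reach ((C, r), xh, A) ((C, r), xh, A ** blk g (mat 1))"
  define B where "B = A ** blk g (mat 1)"
  define B' where "B' = B ** blk (half_turn n) (mat 1)"
  define w where "w = (2 * pi) *\<^sub>R (sqrt 2 *\<^sub>R n)"
  have mB: "((C, r), xh, B) \<in> Q_model" using reach_in_model[OF R] by (simp add: B_def)
  have "reach ((C, r), xh, B) ((C, r), xh + (2 * pi) *\<^sub>R (B *v (emb1 *v (sqrt 2 *\<^sub>R n))), B')"
    using reach_rotation[OF mB n, of "2 * pi"] by (simp add: rot_hat_pi[OF n] B'_def)
  then have 1: "reach ((C, r), xh, B) ((C, r), xh + B *v (emb1 *v w), B')"
    by (simp add: w_def mv_simps)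
  have "((C, r), xh + B *v (emb1 *v w), B') \<in> Q_model" using reach_in_model[OF 1] by simp
  from reach_displacement[OF this, of "- w"]
  have 2: "reach ((C, r), xh + B *v (emb1 *v w), B') ((C, r), xh + B *v (emb1 *v w) + B' *v (emb1 *v (- w)), B')" .
  \<comment> \<open>A half-turn fixes its axis, so \<open>w\<close> is displaced alike by
    \<open>B\<close> and \<open>B'\<close>, and the displacement by \<open>- w\<close> taken with
    the new \<open>B'\<close> undoes the one that came with the turn.\<close>
  have "half_turn n *v w = w" by (simp add: w_def mv_simps half_turn_apply_axis[OF n])
  then have "B' *v (emb1 *v (- w)) = - (B *v (emb1 *v w))"
    by (simp add: B'_def blk_apply emb_proj_single mv_simps flip: matrix_vector_mul_assoc)
  then have "reach ((C, r), xh, B) ((C, r), xh, B')" using reach_trans[OF 1 2] by simp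
  from reach_trans[OF R[folded B_def] this]
  show "reach ((C, r), xh, A) ((C, r), xh, A ** blk (g ** half_turn n) (mat 1))"
    unfolding B'_def B_def matrix_mul_assoc[symmetric] blk_mult matrix_mul_lid .
qed

text \<open>Only the attitude is aimed at; \<open>xh'\<close> and \<open>A'\<close> come out as they
  may and are corrected afterwards by motions that keep \<open>C\<close>.\<close>

lemma reach_rotational_part:
  assumes m: "((C, r), xh, A) \<in> Q_model" and D: "rotation_matrix D"
  shows "\<exists>xh' A'. reach ((C, r), xh, A) ((C ** D, r), xh', A')"
  using D
proof (rule rotation_half_turn_induct)
  show "\<exists>xh' A'. reach ((C, r), xh, A) ((C ** mat 1, r), xh', A')"
    using reach_displacement[OF m, of 0] by auto
next
  fix D :: "real^3^3" and n :: "real^3"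
  assume n: "norm n = 1" and "\<exists>xh' A'. reach ((C, r), xh, A) ((C ** D, r), xh', A')"
  then obtain xh' A' where R: "reach ((C, r), xh, A) ((C ** D, r), xh', A')" by (elim exE)
  \<comment> \<open>The vector whose actual axis of turn is \<open>n\<close>: the map to
    \<open>(- n_3, n_2, - n_1)\<close> is its own inverse.\<close>
  define k :: "real^3" where "k = vector [- n $ 3, n $ 2, - n $ 1]"
  have k: "norm k = 1" using n by (simp add: unit_vector_3 k_def)
  have "vector [- k $ 3, k $ 2, - k $ 1] = n" by (simp add: k_def vec_eq_iff forall_3)
  then have "rot (om (sqrt 2 *\<^sub>R k)) pi = half_turn n" using rot_om_pi[OF k] by simp
  from reach_trans[OF R reach_rotation[OF conjunct2[OF reach_in_model[OF R]] k pi_gt_zero], unfolded this]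
  show "\<exists>xh' A'. reach ((C, r), xh, A) ((C ** (D ** half_turn n), r), xh', A')"
    unfolding matrix_mul_assoc by (intro exI)
qed

section \<open>Rotations among block matrices\<close>

lemma det_blk_half_turn:
  assumes "norm n = 1"
  shows "det (blk (half_turn n) (mat 1)) = 1"
proof -
  interpret M: rotation_axis "hat n" by (rule rotation_axis_hat[OF assms])
  have "blk (half_turn n) (mat 1) =
      blk (rot (hat n) (- pi / 2)) (mat 1) ** blk (rot (hat n) (- pi / 2)) (mat 1)"
    by (simp add: blk_mult M.rot_mult flip: rot_hat_pi[OF assms])
  then show ?thesis
    by (simp add: det_orthogonal_square orthogonal_blk M.orthogonal_rot orthogonal_matrix_id)
qed

lemma det_blk_rotation:
  assumes "rotation_matrix g"
  shows "det (blk g (mat 1)) = 1"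
  using assms
proof (rule rotation_half_turn_induct)
  fix g :: "real^3^3" and n :: "real^3"
  assume "norm n = 1" "det (blk g (mat 1)) = 1"
  then show "det (blk (g ** half_turn n) (mat 1)) = 1"
    using blk_mult[of g "mat 1" "half_turn n" "mat 1"] det_mul[of "blk g (mat 1)" "blk (half_turn n) (mat 1)"]
      det_blk_half_turn by simp
qed (simp add: blk_one)

text \<open>In dimension three negation changes the sign of the determinant. An improper
  \<open>g\<close> would make \<open>- g\<close> proper, and the block matrix would have the
  determinant of the diagonal matrix with three entries \<open>-1\<close> and three entries
  \<open>1\<close>.\<close>

lemma rotation_of_blk:
  assumes g: "orthogonal_matrix g" and "det (blk g (mat 1)) = 1"
  shows "rotation_matrix g"
proof (rule ccontr)
  assume "\<not> rotation_matrix g"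
  then have "det g = -1" using g det_orthogonal_matrix[of g] by (auto simp: rotation_matrix_def)
  then have "rotation_matrix (- g)"
    using g by (simp add: rotation_matrix_def orthogonal_matrix tr_simps mm_simps det_3)
  then have "det (blk (- g) (mat 1)) = 1" by (rule det_blk_rotation)
  moreover have "blk g (mat 1) = blk (- mat 1) (mat 1) ** blk (- g) (mat 1)"
    by (simp add: blk_mult mm_simps)
  moreover have "det (blk (- mat 1) (mat 1)) = -1"
  proof -
    let ?B = "blk (- mat 1) (mat 1)"
    have B: "?B = - (emb1 ** transpose emb1) + emb2 ** transpose emb2"
      by (simp add: blk_def mm_simps)
    have "\<forall>i j. i \<noteq> j \<longrightarrow> ?B $ i $ j = 0"
      unfolding B forall_6 by (simp add: matrix_matrix_mult_def transpose_def sum_3 emb1_def emb2_def)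
    then have "det ?B = (\<Prod>i\<in>UNIV. ?B $ i $ i)" by (intro det_diagonal) simp
    also have "\<dots> = -1"
      unfolding B prod_6 by (simp add: matrix_matrix_mult_def transpose_def sum_3 emb1_def emb2_def)
    finally show ?thesis .
  qed
  ultimately show False using assms(2) by (simp add: det_mul)
qed

text \<open>A rotation that fixes the translational subspace pointwise preserves its orthogonal
  complement, so only the rotational block is free.\<close>

lemma fixes_emb2_blk:
  assumes D: "rotation_matrix D" and fix_emb2: "D ** emb2 = emb2"
  obtains g where "rotation_matrix g" "D = blk g (mat 1)"
proof -
  have o: "transpose D ** D = mat 1"
    using D by (simp add: rotation_matrix_def orthogonal_matrix)
  \<comment> \<open>The inverse fixes the subspace as well; transposed, this says that
    \<open>D\<close> does not mix the complement into it.\<close>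
  have "transpose D ** emb2 = emb2"
    using matrix_cancel(1)[OF o, of emb2] by (simp add: fix_emb2)
  then have "transpose (transpose D ** emb2) = transpose emb2" by (simp only:)
  then have t: "transpose emb2 ** D = transpose emb2"
    by (simp only: matrix_transpose_mul transpose_transpose)
  define g where "g = transpose emb1 ** (D ** emb1)"
  have e1: "emb1 ** (transpose emb1 ** X) = X - emb2 ** (transpose emb2 ** X)" for X :: "real^'n^6"
  proof -
    have "(emb1 ** transpose emb1 + emb2 ** transpose emb2) ** X = X" by (simp add: emb_complete)
    then show ?thesis by (simp only: mm_simps(1) matrix_mul_assoc eq_diff_eq)
  qed
  have e2D: "transpose emb2 ** (D ** X) = transpose emb2 ** X" for X :: "real^'n^6"
    by (simp add: matrix_mul_assoc t)
  have z12: "transpose emb2 ** (emb1 ** X) = 0" for X :: "real^'n^3"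
    by (simp add: matrix_mul_assoc mm_simps)
  have De2: "D ** (emb2 ** X) = emb2 ** X" for X :: "real^'n^3"
    by (simp add: matrix_mul_assoc fix_emb2)
  have "blk g (mat 1) = emb1 ** (transpose emb1 ** (D ** (emb1 ** transpose emb1))) + emb2 ** transpose emb2"
    by (simp add: blk_def g_def matrix_mul_assoc)
  also have "\<dots> = D ** (emb1 ** transpose emb1) + emb2 ** transpose emb2"
    by (simp add: e1 e2D z12 mm_simps)
  also have "\<dots> = D ** (emb1 ** transpose emb1 + emb2 ** transpose emb2)"
    by (simp add: mm_simps De2)
  finally have Dg: "D = blk g (mat 1)" by (simp add: emb_complete)
  have "transpose g ** g = transpose emb1 ** (transpose D ** (emb1 ** (transpose emb1 ** (D ** emb1))))"
    by (simp add: g_def tr_simps matrix_mul_assoc)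
  also have "\<dots> = mat 1"
    by (simp add: e1 e2D mm_simps matrix_cancel(1)[OF o])
  finally have "orthogonal_matrix g" by (simp add: orthogonal_matrix)
  moreover have "det (blk g (mat 1)) = 1" using D by (simp add: rotation_matrix_def Dg)
  ultimately have "rotation_matrix g" by (rule rotation_of_blk)
  then show thesis using Dg by (rule that)
qed

text \<open>The order of the motions matters: \<open>C\<close>, then \<open>r\<close>, then the
  rotational block, then \<open>xh\<close>, each leaving what was already adjusted untouched. What
  they cannot change is supplied by the invariants: the last three columns of \<open>A\<close>, and
  the part of \<open>xh\<close> along these columns.\<close>

lemma leaf_map_imp_reach:
  assumes p0: "p0 \<in> Q_model" and p1: "p1 \<in> Q_model" and eq: "leaf_map p0 = leaf_map p1"
  shows "reach p0 p1"
proof -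
  obtain C0 r0 xh0 A0 where p0': "p0 = ((C0, r0), xh0, A0)" by (cases p0) auto
  obtain C r xh A where p1': "p1 = ((C, r), xh, A)" by (cases p1) auto
  have rot: "rotation_matrix C0" "rotation_matrix A0" "rotation_matrix C" "rotation_matrix A"
    using p0 p1 by (simp_all add: p0' p1' Q_model_iff)
  have o: "transpose C ** C = mat 1" "C0 ** transpose C0 = mat 1" "transpose A ** A = mat 1" "A ** transpose A = mat 1"
    using rot by (simp_all add: rotation_matrix_def orthogonal_matrix_def)
  have "rotation_matrix (transpose C0 ** C)"
    using rot by (intro rotation_matrix_mult) (simp_all add: rotation_matrix_def det_transpose)
  from reach_rotational_part[OF p0[unfolded p0'] this]
  obtain xh1 A1 where "reach p0 ((C0 ** (transpose C0 ** C), r0), xh1, A1)" unfolding p0' by (elim exE)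
  then have R1: "reach p0 ((C, r0), xh1, A1)" by (simp add: matrix_cancel(1)[OF o(2)])
  obtain xh2 where "reach ((C, r0), xh1, A1) ((C, r0 + (r - r0)), xh2, A1)"
    using reach_translation[OF conjunct2[OF reach_in_model[OF R1]], of "r - r0"] by (elim exE)
  then have R2: "reach p0 ((C, r), xh2, A1)" using reach_trans[OF R1] by simp
  have rA1: "rotation_matrix A1" using reach_in_model[OF R2] by (simp add: Q_model_iff)
  then have oA1: "transpose A1 ** A1 = mat 1" "A1 ** transpose A1 = mat 1"
    by (simp_all add: rotation_matrix_def orthogonal_matrix_def)
  have "leaf_map ((C, r), xh2, A1) = leaf_map ((C, r), xh, A)"
    using reach_leaf_map[OF R2] eq p1' by simp
  then have W: "A1 ** (emb2 ** transpose C) = A ** (emb2 ** transpose C)" by (simp add: leaf_map_def)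
  have "A1 ** emb2 = (A1 ** (emb2 ** transpose C)) ** C"
    by (simp add: matrix_mul_assoc[symmetric] o)
  also have "\<dots> = A ** emb2" unfolding W by (simp add: matrix_mul_assoc[symmetric] o)
  finally have "A1 ** emb2 = A ** emb2" .
  then have "(transpose A1 ** A) ** emb2 = transpose A1 ** (A1 ** emb2)"
    by (simp only: matrix_mul_assoc[symmetric])
  then have fe: "(transpose A1 ** A) ** emb2 = emb2" by (simp only: matrix_cancel(1)[OF oA1(1)])
  have fr: "rotation_matrix (transpose A1 ** A)"
    using rA1 rot by (intro rotation_matrix_mult) (simp_all add: rotation_matrix_def det_transpose)
  obtain g where g: "rotation_matrix g" "transpose A1 ** A = blk g (mat 1)"
    by (fact fixes_emb2_blk[OF fr fe])
  have "reach ((C, r), xh2, A1) ((C, r), xh2, A1 ** blk g (mat 1))"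
    by (rule reach_rotational_block[OF conjunct2[OF reach_in_model[OF R2]] g(1)])
  moreover have "A1 ** blk g (mat 1) = A"
    by (simp add: g(2)[symmetric] matrix_cancel(1)[OF oA1(2)])
  ultimately have R3: "reach p0 ((C, r), xh2, A)" using reach_trans[OF R2] by simp
  have "leaf_map ((C, r), xh2, A) = leaf_map ((C, r), xh, A)"
    using reach_leaf_map[OF R3] eq p1' by simp
  then have "transpose (A ** (emb2 ** transpose C)) *v xh2 = transpose (A ** (emb2 ** transpose C)) *v xh"
    by (simp add: leaf_map_def)
  then have "C *v (transpose emb2 *v (transpose A *v (xh - xh2))) = 0"
    by (simp add: tr_simps mv_simps matrix_vector_mul_assoc matrix_mul_assoc)
  then have "transpose C *v (C *v (transpose emb2 *v (transpose A *v (xh - xh2)))) = 0"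
    by (simp add: mv_simps)
  then have z: "transpose emb2 *v (transpose A *v (xh - xh2)) = 0"
    by (simp only: matrix_cancel(2)[OF o(1)])
  \<comment> \<open>By the second invariant the gap \<open>xh - xh2\<close> has no component along
    the last three columns of \<open>A\<close>, so it is a displacement of the available
    kind.\<close>
  have "A *v (emb1 *v (transpose emb1 *v (transpose A *v (xh - xh2)))) = A *v (transpose A *v (xh - xh2))"
    using emb_complete_vec[of "transpose A *v (xh - xh2)"]
    unfolding z bounded_bilinear.zero_right[OF bounded_bilinear_matrix_vector_mult] by simp
  also have "\<dots> = xh - xh2" by (rule matrix_cancel(2)[OF o(4)])
  finally have "reach ((C, r), xh2, A) ((C, r), xh2 + (xh - xh2), A)"
    using reach_displacement[OF conjunct2[OF reach_in_model[OF R3]], of "transpose emb1 *v (transpose A *v (xh - xh2))"]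
    by simp
  then show ?thesis using reach_trans[OF R3] by (simp add: p1')
qed

text \<open>Arbitrary absolutely continuous rollings cannot leave a level set of the invariants, and
  rollings with piecewise constant controls already fill it.\<close>

lemma orbit_eq:
  assumes q0: "q0 \<in> Q"
  shows "orbit q0 = {q1 \<in> Q. leaf_map (Q_coords q1) = leaf_map (Q_coords q0)}"
proof (intro equalityI subsetI)
  fix q1 assume "q1 \<in> orbit q0"
  then obtain \<tau> \<gamma> where g: "\<tau> > 0" "intrinsic_rolling \<tau> \<gamma>" "\<gamma> 0 = q0" "\<gamma> \<tau> = q1"
    unfolding orbit_def by (elim CollectE exE conjE)
  have t: "\<tau> \<in> {0..\<tau>}" using g(1) by simp
  have "\<gamma> ` {0..\<tau>} \<subseteq> Q" using g(2) unfolding intrinsic_rolling_def Let_def by (elim conjE)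
  then have "q1 \<in> Q" using imageI[OF t, of \<gamma>] g(4) by auto
  then show "q1 \<in> {q1 \<in> Q. leaf_map (Q_coords q1) = leaf_map (Q_coords q0)}"
    using intrinsic_rolling_leaf_map[OF g(2,1) t] by (simp add: g(3,4))
next
  fix q1 assume q1: "q1 \<in> {q1 \<in> Q. leaf_map (Q_coords q1) = leaf_map (Q_coords q0)}"
  have "reach (Q_coords q0) (Q_coords q1)"
    by (rule leaf_map_imp_reach) (use q0 q1 Q_coords_in_model in auto)
  then obtain \<tau> p where p: "model_rolling \<tau> p" "p 0 = Q_coords q0" "p \<tau> = Q_coords q1"
    unfolding reach_def by (elim exE conjE)
  have "\<tau> > 0" using p(1) by (simp add: model_rolling_def)
  moreover have "config_of (p 0) = q0" "config_of (p \<tau>) = q1"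
    using p(2,3) q0 q1 config_of_Q_coords by auto
  ultimately show "q1 \<in> orbit q0"
    unfolding orbit_def using model_rolling_intrinsic[OF p(1)] by (intro CollectI exI conjI)
qed

section \<open>Leaves in the trivialization\<close>

lemma Q_coords_orbit:
  assumes "q0 \<in> Q"
  shows "Q_coords ` orbit q0 = {p \<in> Q_model. leaf_map p = leaf_map (Q_coords q0)}"
proof (intro equalityI subsetI)
  fix p assume "p \<in> Q_coords ` orbit q0"
  then obtain q1 where "p = Q_coords q1" "q1 \<in> orbit q0" by (rule imageE)
  then show "p \<in> {p \<in> Q_model. leaf_map p = leaf_map (Q_coords q0)}"
    using Q_coords_in_model by (simp add: orbit_eq[OF assms])
next
  fix p assume p: "p \<in> {p \<in> Q_model. leaf_map p = leaf_map (Q_coords q0)}"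
  then have "config_of p \<in> orbit q0"
    by (simp add: orbit_eq[OF assms] config_of_in_Q Q_coords_config_of)
  from imageI[OF this, of Q_coords] show "p \<in> Q_coords ` orbit q0"
    using p by (simp add: Q_coords_config_of)
qed

text \<open>Rolling curves are themselves paths inside the level set.\<close>

lemma connected_leaf: "connected {p \<in> Q_model. leaf_map p = c}"
  unfolding connected_iff_connected_component
proof (intro ballI)
  fix p0 p1 assume p: "p0 \<in> {p \<in> Q_model. leaf_map p = c}" "p1 \<in> {p \<in> Q_model. leaf_map p = c}"
  have "reach p0 p1" by (rule leaf_map_imp_reach) (use p in auto)
  then obtain \<tau> f where f: "model_rolling \<tau> f" "f 0 = p0" "f \<tau> = p1"
    unfolding reach_def by (elim exE conjE)
  have \<tau>: "\<tau> > 0" using f(1) by (simp add: model_rolling_def)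
  obtain L where L: "\<forall>s\<in>{0..\<tau>}. \<forall>t\<in>{0..\<tau>}. norm (f t - f s) \<le> L * \<bar>t - s\<bar>"
    using f(1) unfolding model_rolling_def by (elim conjE exE)
  have "abs_continuous_on {0..\<tau>} f"
    by (rule abs_continuous_on_lipschitz) (rule L[THEN bspec, THEN bspec])
  then have "connected (f ` {0..\<tau>})"
    by (intro connected_continuous_image abs_continuous_on_imp_continuous_on) simp_all
  moreover have "f ` {0..\<tau>} \<subseteq> {p \<in> Q_model. leaf_map p = c}"
  proof (rule image_subsetI)
    fix t assume "t \<in> {0..\<tau>}"
    then show "f t \<in> {p \<in> Q_model. leaf_map p = c}"
      using model_rolling_in_model[OF f(1)] model_rolling_leaf_map[OF f(1)] p(1) f(2) by simp
  qed
  moreover have "p0 \<in> f ` {0..\<tau>}" "p1 \<in> f ` {0..\<tau>}"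
    using \<tau> f(2,3) imageI[of 0 "{0..\<tau>}" f] imageI[of \<tau> "{0..\<tau>}" f] by simp_all
  ultimately show "connected_component {p \<in> Q_model. leaf_map p = c} p0 p1"
    unfolding connected_component_def by (intro exI conjI)
qed

section \<open>Flat charts\<close>

text \<open>A smooth left inverse on an open set of the ambient space delivers everything at once:
  injectivity of the derivative by the chain rule, continuity of the inverse by restriction, and
  openness of the image as the trace on \<open>N\<close> of an open preimage.\<close>

lemma local_parametrization_inverse:
  fixes \<phi> :: "'m::euclidean_space \<Rightarrow> 'a::euclidean_space"
  assumes U: "open U" "smooth_on U \<phi>" and V: "open V" "smooth_on V \<psi>"
    and \<phi>: "\<And>u. u \<in> U \<Longrightarrow> \<phi> u \<in> N \<inter> V" "\<And>u. u \<in> U \<Longrightarrow> \<psi> (\<phi> u) = u"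
    and \<psi>: "\<And>p. p \<in> N \<inter> V \<Longrightarrow> \<psi> p \<in> U \<Longrightarrow> \<phi> (\<psi> p) = p"
  shows "local_parametrization (top_of_set N) U \<phi>"
  unfolding local_parametrization_def
proof (intro conjI ballI U)
  fix u assume u: "u \<in> U"
  note d\<phi> = smooth_on_derivative[OF U(2) u]
  have "\<phi> u \<in> V" using \<phi>(1)[OF u] by simp
  note d\<psi> = smooth_on_derivative[OF V(2) this]
  have "((\<lambda>x. \<psi> (\<phi> x)) has_derivative
      (\<lambda>v. frechet_derivative \<psi> (at (\<phi> u)) (frechet_derivative \<phi> (at u) v))) (at u)"
    by (rule has_derivative_compose[OF d\<phi> d\<psi>])
  moreover have "((\<lambda>x. \<psi> (\<phi> x)) has_derivative (\<lambda>v. v)) (at u)"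
    by (rule has_derivative_transform_within_open[OF has_derivative_ident U(1) u]) (simp add: \<phi>(2))
  ultimately have eq: "(\<lambda>v. frechet_derivative \<psi> (at (\<phi> u)) (frechet_derivative \<phi> (at u) v)) = (\<lambda>v. v)"
    by (rule has_derivative_unique)
  show "inj (frechet_derivative \<phi> (at u))"
    by (rule inj_on_inverseI) (rule fun_cong[OF eq])
next
  have c\<psi>: "continuous_on V \<psi>" and c\<phi>: "continuous_on U \<phi>"
    using V(2) U(2) by (auto intro: smooth_on_imp_continuous_on)
  have im: "\<phi> ` U = N \<inter> (V \<inter> \<psi> -` U)"
  proof (intro equalityI subsetI)
    fix p assume "p \<in> \<phi> ` U"
    then obtain u where "u \<in> U" "p = \<phi> u" by (elim imageE)
    then show "p \<in> N \<inter> (V \<inter> \<psi> -` U)" using \<phi>[of u] by simp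
  next
    fix p assume p: "p \<in> N \<inter> (V \<inter> \<psi> -` U)"
    then have "\<phi> (\<psi> p) = p" "\<psi> p \<in> U" using \<psi>[of p] by simp_all
    then show "p \<in> \<phi> ` U" using imageI[of "\<psi> p" U \<phi>] by simp
  qed
  have "open (V \<inter> \<psi> -` U)"
    by (rule continuous_open_preimage[OF c\<psi> V(1) U(1)])
  then show "openin (top_of_set N) (\<phi> ` U)"
    unfolding im by (rule openin_open_Int)
  have sub: "subtopology (top_of_set N) (\<phi> ` U) = top_of_set (\<phi> ` U)"
    unfolding subtopology_subtopology using im by (simp add: Int_absorb1)
  have "continuous_on (\<phi> ` U) \<psi>"
    by (rule continuous_on_subset[OF c\<psi>]) (use \<phi>(1) in auto)
  then have "homeomorphic_maps (top_of_set U) (top_of_set (\<phi> ` U)) \<phi> \<psi>"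
    unfolding homeomorphic_maps_def using c\<phi> \<phi>(2) by (auto simp: continuous_map_in_subtopology)
  then show "homeomorphic_map (top_of_set U) (subtopology (top_of_set N) (\<phi> ` U)) \<phi>"
    unfolding sub by (rule homeomorphic_maps_imp_map)
qed

lemma immersed_structure_top_of_set:
  fixes N :: "'a::euclidean_space set"
  assumes "\<And>p. p \<in> N \<Longrightarrow> \<exists>(U :: 'm::euclidean_space set) \<phi>. local_parametrization (top_of_set N) U \<phi> \<and> p \<in> \<phi> ` U"
  shows "immersed_structure TYPE('m) (top_of_set N)"
proof -
  have "second_countable (euclidean :: 'a topology)"
  proof -
    obtain \<B> :: "'a set set" where "countable \<B>" "topological_basis \<B>" using ex_countable_basis by (elim exE conjE)
    then show ?thesis
      unfolding second_countable_def
    proof (intro exI[of _ \<B>] conjI ballI allI impI)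
      show "openin euclidean B" if "B \<in> \<B>" for B
        using topological_basis_open[OF \<open>topological_basis \<B>\<close> that] by simp
      show "\<exists>B\<in>\<B>. x \<in> B \<and> B \<subseteq> U" if "openin euclidean U \<and> x \<in> U" for U x
      proof -
        have "open U" "x \<in> U" using that by simp_all
        then obtain B where "B \<in> \<B>" "x \<in> B" "B \<subseteq> U"
          by (rule topological_basisE[OF \<open>topological_basis \<B>\<close>])
        then show ?thesis by (intro bexI conjI)
      qed
    qed
  qed
  moreover have "Hausdorff_space (top_of_set N)" by (simp add: Hausdorff_space_subtopology)
  ultimately show ?thesis
    unfolding immersed_structure_def using assms by (auto intro: second_countable_subtopology)
qed

text \<open>The first coordinate runs along the level sets of \<open>F\<close>, the second across
  them. \<open>F_\<phi>\<close> and \<open>F_\<psi>\<close> say that \<open>F\<close> ignores the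
  first and separates the second, so a level set meets the chart in at most one slice. The chart
  fills the whole coordinate space, which makes room for boxes of any size.\<close>

locale flat_chart =
  fixes N :: "'e::euclidean_space set" and F :: "'e \<Rightarrow> 'f" and V :: "'e set"
    and \<phi> :: "'a::euclidean_space \<times> 'b::euclidean_space \<Rightarrow> 'e" and \<psi> :: "'e \<Rightarrow> 'a \<times> 'b"
  assumes open_V: "open V" and smooth_\<phi>: "smooth_on UNIV \<phi>" and smooth_\<psi>: "smooth_on V \<psi>"
    and \<phi>_in: "\<And>z. \<phi> z \<in> N \<inter> V" and \<psi>\<phi>: "\<And>z. \<psi> (\<phi> z) = z"
    and \<phi>\<psi>: "\<And>p. p \<in> N \<inter> V \<Longrightarrow> \<phi> (\<psi> p) = p"
    and F_\<phi>: "\<And>a a' c. F (\<phi> (a, c)) = F (\<phi> (a', c))"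
    and F_\<psi>: "\<And>p p'. p \<in> N \<inter> V \<Longrightarrow> p' \<in> N \<inter> V \<Longrightarrow> F p = F p' \<Longrightarrow> snd (\<psi> p) = snd (\<psi> p')"
begin

lemma F_\<phi>_eq: "F (\<phi> (a, c)) = F (\<phi> (a', c')) \<Longrightarrow> c = c'"
  using F_\<psi>[OF \<phi>_in[of "(a, c)"] \<phi>_in[of "(a', c')"]] by (simp add: \<psi>\<phi>)

text \<open>\<open>L\<close> identifies the prescribed model space with the product type in which
  the chart is written.\<close>

lemma parametrization:
  fixes L :: "'m::euclidean_space \<Rightarrow> 'a \<times> 'b"
  assumes L: "linear L" "linear L'" "\<And>x. L' (L x) = x" "\<And>y. L (L' y) = y" and U: "open U"
  shows "local_parametrization (top_of_set N) U (\<lambda>x. \<phi> (L x))"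
proof (rule local_parametrization_inverse[OF U _ open_V])
  have bl: "bounded_linear L" "bounded_linear L'" using L by (simp_all add: linear_conv_bounded_linear)
  show "smooth_on U (\<lambda>x. \<phi> (L x))"
    by (rule smooth_on_compose[OF U open_UNIV _ smooth_\<phi> smooth_on_bounded_linear[OF U bl(1)]]) simp
  show "smooth_on V (\<lambda>p. L' (\<psi> p))"
    by (rule smooth_on_linear_compose[OF open_V bl(2) smooth_\<psi>])
qed (simp_all add: \<phi>_in[simplified] \<psi>\<phi> \<phi>\<psi> L)

text \<open>Freezing the transversal coordinate at that of \<open>p\<close> covers the entire part
  of the level set inside \<open>V\<close>.\<close>

lemma leaf_parametrization:
  fixes L :: "'m::euclidean_space \<Rightarrow> 'a"
  assumes L: "linear L" "linear L'" "\<And>x. L' (L x) = x" "\<And>y. L (L' y) = y"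
    and p: "p \<in> N \<inter> V"
  shows "local_parametrization (top_of_set {q \<in> N. F q = F p}) UNIV (\<lambda>x. \<phi> (L x, snd (\<psi> p)))"
    "p \<in> range (\<lambda>x. \<phi> (L x, snd (\<psi> p)))"
proof -
  let ?c = "snd (\<psi> p)"
  have bl: "bounded_linear L" "bounded_linear L'" using L by (simp_all add: linear_conv_bounded_linear)
  have p': "p = \<phi> (fst (\<psi> p), ?c)" using \<phi>\<psi>[OF p] by simp
  have Fp: "F (\<phi> (a, ?c)) = F p" for a
    using F_\<phi>[of a ?c "fst (\<psi> p)"] p' by (simp only:)
  show "local_parametrization (top_of_set {q \<in> N. F q = F p}) UNIV (\<lambda>x. \<phi> (L x, ?c))"
  proof (rule local_parametrization_inverse[OF open_UNIV _ open_V])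
    have "smooth_on UNIV (\<lambda>x. (L x, ?c))"
      by (intro smooth_on_Pair smooth_on_const smooth_on_bounded_linear bl(1) open_UNIV)
    then show "smooth_on UNIV (\<lambda>x. \<phi> (L x, ?c))"
      by (rule smooth_on_compose[OF open_UNIV open_UNIV _ smooth_\<phi>, rotated]) simp
    show "smooth_on V (\<lambda>q. L' (fst (\<psi> q)))"
      by (intro smooth_on_linear_compose[OF open_V bl(2)] smooth_on_fst open_V smooth_\<psi>)
    show "\<phi> (L u, ?c) \<in> {q \<in> N. F q = F p} \<inter> V" for u
      using \<phi>_in[of "(L u, ?c)"] Fp by simp
    show "\<phi> (L (L' (fst (\<psi> q))), ?c) = q" if q: "q \<in> {q \<in> N. F q = F p} \<inter> V" for q
    proof -
      have q': "q \<in> N \<inter> V" and Fq: "F q = F p" using q by auto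
      have "?c = snd (\<psi> q)" using F_\<psi>[OF p q'] Fq by simp
      then show ?thesis using \<phi>\<psi>[OF q'] by (simp add: L)
    qed
  qed (simp add: \<psi>\<phi> L)
  show "p \<in> range (\<lambda>x. \<phi> (L x, ?c))"
    by (rule range_eqI[of _ _ "L' (fst (\<psi> p))"]) (simp add: L \<phi>\<psi>[OF p])
qed

lemma foliation_box:
  fixes L :: "'l::euclidean_space \<Rightarrow> 'a" and M :: "'t::euclidean_space \<Rightarrow> 'b"
  assumes L: "linear L" "linear L'" "\<And>x. L' (L x) = x" "\<And>y. L (L' y) = y"
    and M: "linear M" "linear M'" "\<And>x. M' (M x) = x" "\<And>y. M (M' y) = y"
    and p: "p \<in> N \<inter> V"
    and leaf: "\<And>A. A \<in> \<F> \<Longrightarrow> \<exists>v. A = {q \<in> N. F q = v}"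
  shows "\<exists>(a::'l) b (c::'t) d \<kappa>.
        local_parametrization (top_of_set N) (box a b \<times> box c d) \<kappa> \<and>
        p \<in> \<kappa> ` (box a b \<times> box c d) \<and>
        (\<forall>A\<in>\<F>. \<exists>K. countable K \<and> K \<subseteq> box c d \<and>
           A \<inter> \<kappa> ` (box a b \<times> box c d) = \<kappa> ` (box a b \<times> K))"
proof -
  define \<alpha> where "\<alpha> = L' (fst (\<psi> p))"
  define \<gamma> where "\<gamma> = M' (snd (\<psi> p))"
  define \<kappa> where "\<kappa> = (\<lambda>x. \<phi> (L (fst x), M (snd x)))"
  \<comment> \<open>As the chart is defined everywhere, any box about the coordinates of
    \<open>p\<close> would do.\<close>
  let ?a = "\<alpha> - One" and ?b = "\<alpha> + One" and ?c = "\<gamma> - One" and ?d = "\<gamma> + One"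
  have lin: "linear (\<lambda>x. (L (fst x), M (snd x)))" "linear (\<lambda>x. (L' (fst x), M' (snd x)))"
    by (rule linearI; simp add: linear_add[OF L(1)] linear_add[OF M(1)] linear_scale[OF L(1)] linear_scale[OF M(1)]
        linear_add[OF L(2)] linear_add[OF M(2)] linear_scale[OF L(2)] linear_scale[OF M(2)])+
  have "local_parametrization (top_of_set N) (box ?a ?b \<times> box ?c ?d) \<kappa>"
    unfolding \<kappa>_def by (rule parametrization[OF lin]) (simp_all add: L M open_Times open_box)
  moreover have "p \<in> \<kappa> ` (box ?a ?b \<times> box ?c ?d)"
  proof (rule image_eqI)
    show "p = \<kappa> (\<alpha>, \<gamma>)" by (simp add: \<kappa>_def \<alpha>_def \<gamma>_def L M \<phi>\<psi>[OF p])
    show "(\<alpha>, \<gamma>) \<in> box ?a ?b \<times> box ?c ?d" by (simp add: mem_box algebra_simps)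
  qed
  moreover have K: "\<exists>K. countable K \<and> K \<subseteq> box ?c ?d \<and>
      A \<inter> \<kappa> ` (box ?a ?b \<times> box ?c ?d) = \<kappa> ` (box ?a ?b \<times> K)" if A: "A \<in> \<F>" for A
  proof -
    obtain v where v: "A = {q \<in> N. F q = v}" using leaf[OF A] by (elim exE)
    \<comment> \<open>The transversal coordinates of the slices in \<open>A\<close>; since
      \<open>F\<close> separates them, \<open>K\<close> has at most one element.\<close>
    define K where "K = {k \<in> box ?c ?d. F (\<kappa> (\<alpha>, k)) = v}"
    have uniq: "k = k'" if "k \<in> K" "k' \<in> K" for k k'
    proof -
      have "F (\<kappa> (\<alpha>, k)) = F (\<kappa> (\<alpha>, k'))" using that by (simp add: K_def)
      then have "M k = M k'" unfolding \<kappa>_def fst_conv snd_conv by (rule F_\<phi>_eq)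
      then have "M' (M k) = M' (M k')" by simp
      then show ?thesis by (simp add: M)
    qed
    have "countable K"
    proof (cases "K = {}")
      case False
      then obtain k where "k \<in> K" by auto
      then have "K \<subseteq> {k}" using uniq by auto
      then show ?thesis by (rule countable_subset) simp
    qed simp
    moreover have "A \<inter> \<kappa> ` (box ?a ?b \<times> box ?c ?d) = \<kappa> ` (box ?a ?b \<times> K)"
    proof (intro equalityI subsetI)
      fix q assume q: "q \<in> A \<inter> \<kappa> ` (box ?a ?b \<times> box ?c ?d)"
      then obtain x k where xk: "q = \<kappa> (x, k)" "x \<in> box ?a ?b" "k \<in> box ?c ?d" by auto
      have "F (\<kappa> (\<alpha>, k)) = F q" unfolding xk(1) \<kappa>_def fst_conv snd_conv by (rule F_\<phi>)
      then have "k \<in> K" using q v xk(3) by (simp add: K_def)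
      then show "q \<in> \<kappa> ` (box ?a ?b \<times> K)" using xk(1,2) by (intro image_eqI[of _ _ "(x, k)"]) simp_all
    next
      fix q assume "q \<in> \<kappa> ` (box ?a ?b \<times> K)"
      then obtain x k where xk: "q = \<kappa> (x, k)" "x \<in> box ?a ?b" "k \<in> K" by auto
      have "F q = F (\<kappa> (\<alpha>, k))" unfolding xk(1) \<kappa>_def fst_conv snd_conv by (rule F_\<phi>)
      then have "F q = v" using xk(3) by (simp add: K_def)
      moreover have "q \<in> N" using \<phi>_in[of "(L x, M k)"] by (simp add: xk(1) \<kappa>_def)
      moreover have "q \<in> \<kappa> ` (box ?a ?b \<times> box ?c ?d)"
        using xk by (intro image_eqI[of _ _ "(x, k)"]) (simp_all add: K_def)
      ultimately show "q \<in> A \<inter> \<kappa> ` (box ?a ?b \<times> box ?c ?d)" by (simp add: v)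
    qed
    ultimately show ?thesis by (intro exI[of _ K]) (auto simp: K_def)
  qed
  ultimately show ?thesis
    by (intro exI[of _ ?a] exI[of _ ?b] exI[of _ ?c] exI[of _ ?d] exI[of _ \<kappa>] conjI ballI K)
qed

end

text \<open>The skew matrix with block rows \<open>(0, E)\<close> and \<open>(- E^T, om S)\<close>.
  The vanishing block is the Lie algebra of the rotations that fix \<open>emb2\<close>, which a
  three-frame cannot see; the other 9 + 3 parameters match the dimension 12 of the Stiefel
  manifold.\<close>

definition stiefel_skew :: "real^3^3 \<Rightarrow> real^3 \<Rightarrow> real^6^6" where
  "stiefel_skew E S = emb1 ** (E ** transpose emb2) - emb2 ** (transpose E ** transpose emb1) +
     emb2 ** (om S ** transpose emb2)"

lemma transpose_stiefel_skew: "transpose (stiefel_skew E S) = - stiefel_skew E S"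
  by (simp add: stiefel_skew_def tr_simps transpose_om mm_simps matrix_mul_assoc)

lemma emb_cancel:
  "transpose emb1 ** (emb1 ** X) = X" "transpose emb2 ** (emb2 ** X) = X"
  "transpose emb1 ** (emb2 ** X) = 0" "transpose emb2 ** (emb1 ** X) = 0" for X :: "real^'n^3"
  by (simp_all add: matrix_mul_assoc mm_simps)

lemma emb_decompose: "emb1 ** (transpose emb1 ** X) + emb2 ** (transpose emb2 ** X) = X" for X :: "real^'n^6"
proof -
  have "(emb1 ** transpose emb1 + emb2 ** transpose emb2) ** X = X" by (simp add: emb_complete)
  then show ?thesis by (simp only: mm_simps(1) matrix_mul_assoc)
qed

lemma emb_eq_iff:
  fixes X Z :: "real^'n^6"
  shows "X = Z \<longleftrightarrow> transpose emb1 ** X = transpose emb1 ** Z \<and> transpose emb2 ** X = transpose emb2 ** Z"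
proof
  assume "transpose emb1 ** X = transpose emb1 ** Z \<and> transpose emb2 ** X = transpose emb2 ** Z"
  then have "emb1 ** (transpose emb1 ** X) + emb2 ** (transpose emb2 ** X) =
      emb1 ** (transpose emb1 ** Z) + emb2 ** (transpose emb2 ** Z)" by simp
  then show "X = Z" by (simp only: emb_decompose)
qed simp

text \<open>The block equations below read \<open>X\<^sub>1 = E X\<^sub>2\<close> and \<open>(1 + E\<^sup>T E - S) X\<^sub>2 = 2\<close> for \<open>X = W + (0, 1)\<close>;
  they determine \<open>E\<close> and \<open>S\<close> rationally from the frame \<open>W\<close>.\<close>

lemma cay_stiefel_skew_iff:
  fixes W :: "real^3^6"
  defines "Y \<equiv> transpose emb2 ** W + mat 1"
  shows "cay (stiefel_skew E S) ** emb2 = W \<longleftrightarrow>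
    transpose emb1 ** W = E ** Y \<and> (mat 1 + transpose E ** E - om S) ** Y = 2 *\<^sub>R mat 1"
proof -
  let ?M = "stiefel_skew E S" and ?K = "matrix_inv (mat 1 - stiefel_skew E S)"
  note K = matrix_inv_mult[OF det_one_minus_skew[OF transpose_stiefel_skew[of E S]]]
  \<comment> \<open>Moving \<open>1 - M\<close> to the other side removes the inverse; the resulting
    linear equation then splits into its two blocks.\<close>
  have "cay ?M ** emb2 = W \<longleftrightarrow> 2 *\<^sub>R (?K ** emb2) = W + emb2"
    by (simp add: cay_def mm_simps diff_eq_eq)
  also have "\<dots> \<longleftrightarrow> (mat 1 - ?M) ** (W + emb2) = 2 *\<^sub>R emb2"
  proof
    assume "2 *\<^sub>R (?K ** emb2) = W + emb2"
    then have "(mat 1 - ?M) ** (W + emb2) = (mat 1 - ?M) ** (2 *\<^sub>R (?K ** emb2))" by simp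
    also have "\<dots> = 2 *\<^sub>R emb2" by (simp only: mm_simps(8) matrix_cancel(1)[OF K(1)])
    finally show "(mat 1 - ?M) ** (W + emb2) = 2 *\<^sub>R emb2" .
  next
    assume "(mat 1 - ?M) ** (W + emb2) = 2 *\<^sub>R emb2"
    then have "?K ** ((mat 1 - ?M) ** (W + emb2)) = ?K ** (2 *\<^sub>R emb2)" by simp
    then show "2 *\<^sub>R (?K ** emb2) = W + emb2" by (simp only: mm_simps(8) matrix_cancel(1)[OF K(2)])
  qed
  also have "\<dots> \<longleftrightarrow> transpose emb1 ** W - E ** Y = 0 \<and>
      Y - (om S ** Y - transpose E ** (transpose emb1 ** W)) = 2 *\<^sub>R mat 1"
  proof -
    have "transpose emb1 ** ((mat 1 - ?M) ** (W + emb2)) = transpose emb1 ** W - E ** Y"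
      by (simp add: stiefel_skew_def Y_def mm_simps matrix_mul_assoc[symmetric] emb_cancel)
    moreover have "transpose emb2 ** ((mat 1 - ?M) ** (W + emb2)) =
        Y - (om S ** Y - transpose E ** (transpose emb1 ** W))"
      by (simp add: stiefel_skew_def Y_def mm_simps matrix_mul_assoc[symmetric] emb_cancel)
    moreover have "transpose emb1 ** (2 *\<^sub>R emb2) = 0" "transpose emb2 ** (2 *\<^sub>R emb2) = 2 *\<^sub>R mat 1"
      by (simp_all add: mm_simps(8))
    ultimately show ?thesis by (simp only: emb_eq_iff[of "(mat 1 - ?M) ** (W + emb2)"])
  qed
  also have "\<dots> \<longleftrightarrow> transpose emb1 ** W = E ** Y \<and>
      Y - (om S ** Y - transpose E ** (E ** Y)) = 2 *\<^sub>R mat 1"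
    by auto
  also have "Y - (om S ** Y - transpose E ** (E ** Y)) = (mat 1 + transpose E ** E - om S) ** Y"
    by (simp add: mm_simps matrix_mul_assoc)
  finally show ?thesis by auto
qed

definition stiefel_E :: "real^3^6 \<Rightarrow> real^3^3" where
  "stiefel_E W = (transpose emb1 ** W) ** matrix_inv (transpose emb2 ** W + mat 1)"

definition stiefel_S :: "real^3^6 \<Rightarrow> real^3" where
  "stiefel_S W = vee (mat 1 + transpose (stiefel_E W) ** stiefel_E W - 2 *\<^sub>R matrix_inv (transpose emb2 ** W + mat 1))"

text \<open>The second block equation exhibits \<open>(1 + E^T E - om S) / 2\<close> as the inverse
  of \<open>Y\<close>. Once this inverse is known, both parameters can be read off.\<close>

lemma stiefel_chart:
  defines "W E S \<equiv> cay (stiefel_skew E S) ** emb2"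
  shows "det (transpose emb2 ** W E S + mat 1) \<noteq> 0" "stiefel_E (W E S) = E" "stiefel_S (W E S) = S"
proof -
  define Y where "Y = transpose emb2 ** W E S + mat 1"
  have eq: "transpose emb1 ** W E S = E ** Y" "(mat 1 + transpose E ** E - om S) ** Y = 2 *\<^sub>R mat 1"
    using cay_stiefel_skew_iff[of E S "W E S"] by (simp_all add: W_def Y_def)
  have "((1/2) *\<^sub>R (mat 1 + transpose E ** E - om S)) ** Y = mat 1"
    using eq(2) by (simp add: mm_simps(7))
  then have Yr: "Y ** ((1/2) *\<^sub>R (mat 1 + transpose E ** E - om S)) = mat 1"
    using matrix_left_right_inverse by blast
  note Y = matrix_inv_unique[OF Yr]
  show "det (transpose emb2 ** W E S + mat 1) \<noteq> 0" using Y(1) by (simp add: Y_def)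
  show E: "stiefel_E (W E S) = E"
    unfolding stiefel_E_def eq(1) Y_def[symmetric]
    by (simp only: matrix_mul_assoc[symmetric] matrix_inv_mult(1)[OF Y(1)] matrix_mul_rid)
  show "stiefel_S (W E S) = S"
    unfolding stiefel_S_def E Y_def[symmetric] Y(2) by (simp add: vee_om)
qed

text \<open>\<open>S\<close> is recovered as a vector, so \<open>1 + E^T E - 2 Y^-1\<close> has to
  be skew; this is where orthonormality of the columns of \<open>W\<close> is used.\<close>

lemma stiefel_chart_surj:
  assumes W: "transpose W ** W = mat 1" and d: "det (transpose emb2 ** W + mat 1) \<noteq> 0"
  shows "cay (stiefel_skew (stiefel_E W) (stiefel_S W)) ** emb2 = W"
proof -
  define Y where "Y = transpose emb2 ** W + mat 1"
  define I where "I = matrix_inv Y"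
  define E where "E = stiefel_E W"
  have Y: "Y ** I = mat 1" "I ** Y = mat 1"
    using matrix_inv_mult[OF d] by (simp_all add: Y_def I_def)
  have YT: "transpose I ** transpose Y = mat 1"
    using arg_cong[OF Y(1), of transpose] by (simp add: tr_simps)
  have EI: "E = (transpose emb1 ** W) ** I" by (simp add: E_def stiefel_E_def I_def Y_def)
  have EY: "transpose emb1 ** W = E ** Y"
    unfolding EI by (simp only: matrix_mul_assoc[symmetric] Y matrix_mul_rid)
  have "transpose W ** (emb1 ** (transpose emb1 ** W) + emb2 ** (transpose emb2 ** W)) = mat 1"
    by (simp only: emb_decompose W)
  then have WW: "transpose (transpose emb1 ** W) ** (transpose emb1 ** W) +
      transpose (transpose emb2 ** W) ** (transpose emb2 ** W) = mat 1"
    by (simp add: mm_simps tr_simps matrix_mul_assoc)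
  have "transpose emb2 ** W = Y - mat 1" by (simp add: Y_def)
  then have "transpose (E ** Y) ** (E ** Y) + (transpose Y - mat 1) ** (Y - mat 1) = mat 1"
    using WW by (simp add: EY tr_simps)
  \<comment> \<open>Orthonormality of \<open>W\<close> expressed by \<open>Y\<close>. Multiplication
    by the inverses on both sides determines the symmetric part of \<open>I\<close>.\<close>
  then have sum: "Y + transpose Y = transpose Y ** ((mat 1 + transpose E ** E) ** Y)"
    by (simp add: mm_simps tr_simps matrix_mul_assoc algebra_simps)
  have "I + transpose I = transpose I ** ((Y + transpose Y) ** I)"
    by (simp add: mm_simps Y matrix_cancel(1)[OF YT] add.commute)
  also have "\<dots> = transpose I ** (transpose Y ** ((mat 1 + transpose E ** E) ** (Y ** I)))"
    unfolding sum by (simp only: matrix_mul_assoc)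
  also have "\<dots> = mat 1 + transpose E ** E"
    by (simp only: matrix_cancel(1)[OF YT] Y matrix_mul_rid)
  finally have II: "I + transpose I = mat 1 + transpose E ** E" .
  define N where "N = mat 1 + transpose E ** E - 2 *\<^sub>R I"
  have "N = transpose I - I" by (simp add: N_def II[symmetric] scaleR_2)
  then have "transpose N = - N" by (simp add: tr_simps)
  then have S: "om (stiefel_S W) = N"
    by (simp add: stiefel_S_def N_def E_def I_def Y_def om_vee)
  have "(mat 1 + transpose E ** E - N) ** Y = 2 *\<^sub>R mat 1"
    by (simp add: N_def mm_simps(7) Y)
  then show ?thesis
    unfolding cay_stiefel_skew_iff Y_def[symmetric] E_def[symmetric] S using EY by iprover
qed

section \<open>Coordinates on the configuration space\<close>

type_synonym leaf_coords = "((real^3) \<times> (real^3)) \<times> ((real^3) \<times> (real^3))"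
type_synonym transversal_coords = "(real^3) \<times> ((real^3^3) \<times> (real^3))"

text \<open>The middle factor moves the last three columns and is transversal; the last one fixes
  \<open>emb2\<close> and so moves along the leaf. \<open>B0\<close> carries the centre of the
  chart.\<close>

definition chart_rotation :: "real^6^6 \<Rightarrow> leaf_coords \<times> transversal_coords \<Rightarrow> real^6^6" where
  "chart_rotation B0 z = B0 ** (cay (stiefel_skew (fst (snd (snd z))) (snd (snd (snd z)))) **
     blk (cay (om (fst (snd (fst z))))) (mat 1))"

text \<open>Leaf coordinates: attitude, \<open>r\<close>, rotational block, rotational component of
  \<open>xh\<close>. Transversal ones: the second invariant and the pair \<open>(E, S)\<close>. The
  translational component of \<open>xh\<close> is not free: by the second invariant it is the value
  of that invariant plus \<open>r\<close>.\<close>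

definition chart :: "real^3^3 \<Rightarrow> real^6^6 \<Rightarrow> leaf_coords \<times> transversal_coords \<Rightarrow>
    model_config" where
  "chart C0 B0 z = ((C0 ** cay (om (fst (fst (fst z)))), snd (fst (fst z))),
     chart_rotation B0 z *v (emb1 *v snd (snd (fst z)) + emb2 *v (fst (snd z) + snd (fst (fst z)))),
     chart_rotation B0 z ** blk (mat 1) (C0 ** cay (om (fst (fst (fst z))))))"

definition frame_part :: "real^6^6 \<Rightarrow> model_config \<Rightarrow> real^3^6" where
  "frame_part B0 p = transpose B0 ** fst (leaf_map p)"

text \<open>The isometry in the frame whose translational vectors \<open>C k\<close> are replaced by
  the constant \<open>(0, k)\<close>. Its last three columns are the first invariant.\<close>

definition body_rotation :: "model_config \<Rightarrow> real^6^6" where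
  "body_rotation p = snd (snd p) ** blk (mat 1) (transpose (fst (fst p)))"

text \<open>On \<open>Q_model\<close>, stripping off the Stiefel factor leaves a rotation that fixes
  \<open>emb2\<close>; this is its only free block.\<close>

definition block_part :: "real^6^6 \<Rightarrow> model_config \<Rightarrow> real^3^3" where
  "block_part B0 p = transpose emb1 ** ((transpose (cay (stiefel_skew (stiefel_E (frame_part B0 p)) (stiefel_S (frame_part B0 p)))) **
     (transpose B0 ** body_rotation p)) ** emb1)"

definition chart_inv :: "real^3^3 \<Rightarrow> real^6^6 \<Rightarrow> model_config \<Rightarrow>
    leaf_coords \<times> transversal_coords" where
  "chart_inv C0 B0 p = (((vee (cay_inv (transpose C0 ** fst (fst p))), snd (fst p)),
      (vee (cay_inv (block_part B0 p)), transpose emb1 *v (transpose (body_rotation p) *v fst (snd p)))),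
     (snd (leaf_map p), (stiefel_E (frame_part B0 p), stiefel_S (frame_part B0 p))))"

text \<open>Kept apart from \<open>chart_dom\<close>, whose further condition involves
  \<open>block_part\<close>: openness of the latter set rests on continuity of
  \<open>block_part\<close> on this one.\<close>

definition chart_dom1 :: "real^3^3 \<Rightarrow> real^6^6 \<Rightarrow> model_config set" where
  "chart_dom1 C0 B0 = {p. det (transpose C0 ** fst (fst p) + mat 1) \<noteq> 0 \<and>
     det (transpose emb2 ** frame_part B0 p + mat 1) \<noteq> 0}"

definition chart_dom :: "real^3^3 \<Rightarrow> real^6^6 \<Rightarrow> model_config set" where
  "chart_dom C0 B0 = {p \<in> chart_dom1 C0 B0. det (block_part B0 p + mat 1) \<noteq> 0}"

lemmas bounded_linear_om = linear_om[unfolded linear_conv_bounded_linear]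
lemmas bounded_linear_vee = linear_vee[unfolded linear_conv_bounded_linear]

lemma smooth_on_blk:
  "open U \<Longrightarrow> smooth_on U f \<Longrightarrow> smooth_on U g \<Longrightarrow> smooth_on U (\<lambda>x. blk (f x) (g x))"
  unfolding blk_def by (intro smooth_intros)

lemma smooth_on_stiefel_skew:
  "open U \<Longrightarrow> smooth_on U f \<Longrightarrow> smooth_on U g \<Longrightarrow> smooth_on U (\<lambda>x. stiefel_skew (f x) (g x))"
  unfolding stiefel_skew_def by (intro smooth_intros smooth_on_linear_compose[OF _ bounded_linear_om])

lemma smooth_leaf_map: "open U \<Longrightarrow> smooth_on U (\<lambda>p. fst (leaf_map p))" "open U \<Longrightarrow> smooth_on U (\<lambda>p. snd (leaf_map p))"
  unfolding leaf_map_def case_prod_unfold fst_conv snd_conv by (intro smooth_intros; assumption)+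

lemma smooth_chart: "smooth_on UNIV (chart C0 B0)"
proof -
  have U: "open (UNIV :: (leaf_coords \<times> transversal_coords) set)" by simp
  have c: "smooth_on UNIV (\<lambda>z. cay (om (f z)))" if "smooth_on UNIV f"
    for f :: "leaf_coords \<times> transversal_coords \<Rightarrow> real^3"
    by (intro smooth_on_cay[OF U] smooth_on_linear_compose[OF U bounded_linear_om] that transpose_om)
  have r: "smooth_on UNIV (chart_rotation B0)"
    unfolding chart_rotation_def
    by (intro smooth_on_matrix_mult smooth_on_blk smooth_on_cay[OF U] smooth_on_stiefel_skew c
        smooth_on_const smooth_on_fst smooth_on_snd smooth_on_id U transpose_stiefel_skew)
  show ?thesis
    unfolding chart_def
    by (intro smooth_on_Pair smooth_on_matrix_mult smooth_on_matrix_vector_mult smooth_on_add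
        smooth_on_blk c r smooth_on_const smooth_on_fst smooth_on_snd smooth_on_id U)
qed

lemma smooth_frame_part: "open U \<Longrightarrow> smooth_on U (frame_part B0)"
  unfolding frame_part_def by (intro smooth_intros smooth_leaf_map)

lemma open_chart_dom1: "open (chart_dom1 C0 B0)"
proof -
  have U: "open (UNIV :: model_config set)" by simp
  have "smooth_on UNIV (\<lambda>p :: model_config. det (transpose C0 ** fst (fst p) + mat 1))"
    "smooth_on UNIV (\<lambda>p. det (transpose emb2 ** frame_part B0 p + mat 1))"
    by (intro smooth_on_det smooth_intros smooth_frame_part U)+
  note c = this[THEN smooth_on_imp_continuous_on]
  show ?thesis
    unfolding chart_dom1_def by (intro open_Collect_conj open_Collect_neq continuous_on_const c)
qed

lemma smooth_stiefel:
  assumes "open U" "U \<subseteq> chart_dom1 C0 B0"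
  shows "smooth_on U (\<lambda>p. stiefel_E (frame_part B0 p))" "smooth_on U (\<lambda>p. stiefel_S (frame_part B0 p))"
proof -
  have i: "smooth_on U (\<lambda>p. matrix_inv (transpose emb2 ** frame_part B0 p + mat 1))"
    using assms(2) by (intro smooth_on_matrix_inv smooth_intros smooth_frame_part assms(1)) (auto simp: chart_dom1_def)
  show E: "smooth_on U (\<lambda>p. stiefel_E (frame_part B0 p))"
    unfolding stiefel_E_def by (intro smooth_on_matrix_mult i smooth_on_const smooth_frame_part assms(1))
  show "smooth_on U (\<lambda>p. stiefel_S (frame_part B0 p))"
    unfolding stiefel_S_def
    by (intro smooth_on_linear_compose[OF _ bounded_linear_vee] smooth_on_diff smooth_on_add smooth_on_scaleR
        smooth_on_matrix_mult smooth_on_transpose i E smooth_on_const assms(1))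
qed

lemma smooth_body_rotation: "open U \<Longrightarrow> smooth_on U body_rotation"
  unfolding body_rotation_def
  by (intro smooth_on_matrix_mult smooth_on_blk smooth_on_const smooth_on_transpose smooth_on_fst smooth_on_snd smooth_on_id)

lemma smooth_block_part:
  assumes "open U" "U \<subseteq> chart_dom1 C0 B0"
  shows "smooth_on U (block_part B0)"
  unfolding block_part_def
  by (intro smooth_on_matrix_mult smooth_on_const smooth_on_transpose smooth_on_cay smooth_on_stiefel_skew
      smooth_stiefel[OF assms] smooth_body_rotation assms(1) transpose_stiefel_skew)

lemma open_chart_dom: "open (chart_dom C0 B0)"
proof -
  have "smooth_on (chart_dom1 C0 B0) (\<lambda>p. det (block_part B0 p + mat 1))"
    by (intro smooth_on_det smooth_on_add smooth_on_const smooth_block_part[OF _ subset_refl] open_chart_dom1)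
  then have "continuous_on (chart_dom1 C0 B0) (\<lambda>p. det (block_part B0 p + mat 1))"
    by (rule smooth_on_imp_continuous_on)
  moreover have "open (- {0::real})" by (simp add: open_Compl)
  ultimately have "open (chart_dom1 C0 B0 \<inter> (\<lambda>p. det (block_part B0 p + mat 1)) -` (- {0}))"
    by (rule continuous_open_preimage[OF _ open_chart_dom1])
  moreover have "chart_dom1 C0 B0 \<inter> (\<lambda>p. det (block_part B0 p + mat 1)) -` (- {0}) = chart_dom C0 B0"
    by (auto simp: chart_dom_def)
  ultimately show ?thesis by simp
qed

lemma smooth_chart_inv: "smooth_on (chart_dom C0 B0) (chart_inv C0 B0)"
proof -
  note o = open_chart_dom[of C0 B0]
  have s: "chart_dom C0 B0 \<subseteq> chart_dom1 C0 B0" by (auto simp: chart_dom_def)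
  have c: "smooth_on (chart_dom C0 B0) (\<lambda>p. cay_inv (transpose C0 ** fst (fst p)))"
    by (intro smooth_on_cay_inv smooth_on_matrix_mult smooth_on_const smooth_on_fst smooth_on_id o)
      (auto simp: chart_dom_def chart_dom1_def)
  have b: "smooth_on (chart_dom C0 B0) (\<lambda>p. cay_inv (block_part B0 p))"
    by (intro smooth_on_cay_inv smooth_block_part[OF o s] o) (auto simp: chart_dom_def)
  show ?thesis
    unfolding chart_inv_def
    by (intro smooth_on_Pair smooth_on_linear_compose[OF _ bounded_linear_vee] c b smooth_on_matrix_vector_mult
        smooth_on_transpose smooth_body_rotation smooth_leaf_map smooth_stiefel[OF o s] smooth_on_const
        smooth_on_fst smooth_on_snd smooth_on_id o)
qed

section \<open>The chart and its inverse\<close>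

lemma skew_vee_cay_inv:
  fixes R :: "real^3^3"
  assumes "orthogonal_matrix R" "det (R + mat 1) \<noteq> 0"
  shows "cay (om (vee (cay_inv R))) = R"
  using cay_inv_orthogonal[OF assms] by (simp add: om_vee)

lemma rotation_cay: "transpose M = - M \<Longrightarrow> rotation_matrix (cay M)" for M :: "real^'n^'n"
  using cay_skew(1,2)[of M] by (simp only: rotation_matrix_def simp_thms)

lemma transpose_cay_mult:
  fixes M :: "real^'n^'n"
  shows "transpose M = - M \<Longrightarrow> transpose (cay M) ** cay M = mat 1"
    "transpose M = - M \<Longrightarrow> cay M ** transpose (cay M) = mat 1"
  using cay_skew(1)[of M] by (simp_all add: orthogonal_matrix_def)

lemma vee_cay_inv_cay: "vee (cay_inv (cay (om a))) = a"
  by (simp add: cay_skew(4) transpose_om vee_om)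

lemma blk_emb: "blk g h ** emb1 = emb1 ** g" "blk g h ** emb2 = emb2 ** h"
  by (simp_all add: blk_def mm_simps matrix_mul_assoc[symmetric])

lemma rotation_blk_fst:
  assumes "rotation_matrix g"
  shows "rotation_matrix (blk g (mat 1))"
  using assms det_blk_rotation[OF assms] orthogonal_blk[of g "mat 1"]
  by (simp add: rotation_matrix_def orthogonal_matrix_id)

lemma rotation_blk_snd:
  assumes "rotation_matrix h"
  shows "rotation_matrix (blk (mat 1) h)"
proof -
  have "det (blk (mat 1) h) = 1"
    using assms
  proof (rule rotation_half_turn_induct)
    fix h :: "real^3^3" and n :: "real^3"
    assume n: "norm n = 1" and h: "det (blk (mat 1) h) = 1"
    interpret M: rotation_axis "hat n" by (rule rotation_axis_hat[OF n])
    have "half_turn n = rot (hat n) (- pi / 2) ** rot (hat n) (- pi / 2)"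
      by (simp add: M.rot_mult flip: rot_hat_pi[OF n])
    then have "blk (mat 1) (half_turn n) =
        blk (mat 1) (rot (hat n) (- pi / 2)) ** blk (mat 1) (rot (hat n) (- pi / 2))"
      by (simp add: blk_mult)
    then have "det (blk (mat 1) (half_turn n)) = 1"
      by (simp add: det_orthogonal_square orthogonal_blk M.orthogonal_rot orthogonal_matrix_id)
    then show "det (blk (mat 1) (h ** half_turn n)) = 1"
      using blk_mult[of "mat 1" h "mat 1" "half_turn n"] det_mul[of "blk (mat 1) h" "blk (mat 1) (half_turn n)"] h
      by simp
  qed (simp add: blk_one)
  then show ?thesis
    using assms orthogonal_blk[of "mat 1" h] by (simp add: rotation_matrix_def orthogonal_matrix_id)
qed

lemma leaf_map_body:
  assumes "p \<in> Q_model"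
  shows "fst (leaf_map p) = body_rotation p ** emb2"
    "snd (leaf_map p) = transpose emb2 *v (transpose (body_rotation p) *v fst (snd p)) - snd (fst p)"
proof -
  obtain x xh A where p: "p = (x, xh, A)" by (cases p)
  have 1: "body_rotation p ** emb2 = A ** (emb2 ** transpose (fst x))"
    by (simp add: body_rotation_def p blk_emb flip: matrix_mul_assoc)
  then show "fst (leaf_map p) = body_rotation p ** emb2" by (simp add: leaf_map_def p)
  have "transpose emb2 *v (transpose (body_rotation p) *v xh) = transpose (body_rotation p ** emb2) *v xh"
    by (simp add: matrix_transpose_mul matrix_vector_mul_assoc)
  then show "snd (leaf_map p) = transpose emb2 *v (transpose (body_rotation p) *v fst (snd p)) - snd (fst p)"
    unfolding 1 by (simp add: leaf_map_def p)
qed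

lemma chart_props:
  assumes C0: "rotation_matrix C0" and B0: "rotation_matrix B0"
  shows "chart C0 B0 z \<in> Q_model" "body_rotation (chart C0 B0 z) = chart_rotation B0 z"
    "frame_part B0 (chart C0 B0 z) = cay (stiefel_skew (fst (snd (snd z))) (snd (snd (snd z)))) ** emb2"
    "snd (leaf_map (chart C0 B0 z)) = fst (snd z)"
    "fst (leaf_map (chart C0 B0 z)) = B0 ** (cay (stiefel_skew (fst (snd (snd z))) (snd (snd (snd z)))) ** emb2)"
    "transpose (chart_rotation B0 z) ** chart_rotation B0 z = mat 1"
proof -
  let ?C = "C0 ** cay (om (fst (fst (fst z))))"
  let ?M = "stiefel_skew (fst (snd (snd z))) (snd (snd (snd z)))"
  have C: "rotation_matrix ?C"
    by (intro rotation_matrix_mult C0 rotation_cay transpose_om)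
  have R: "rotation_matrix (chart_rotation B0 z)"
    unfolding chart_rotation_def
    by (intro rotation_matrix_mult B0 rotation_cay rotation_blk_fst transpose_stiefel_skew transpose_om)
  show Q: "chart C0 B0 z \<in> Q_model"
    unfolding chart_def Q_model_iff by (intro conjI C rotation_matrix_mult R rotation_blk_snd)
  have CC: "?C ** transpose ?C = mat 1" using C by (simp add: rotation_matrix_def orthogonal_matrix_def)
  show b: "body_rotation (chart C0 B0 z) = chart_rotation B0 z"
    unfolding body_rotation_def chart_def fst_conv snd_conv matrix_mul_assoc[symmetric, of "chart_rotation B0 z"] blk_mult CC
    by (simp add: blk_one)
  have "chart_rotation B0 z ** emb2 = B0 ** (cay ?M ** emb2)"
    by (simp add: chart_rotation_def blk_emb flip: matrix_mul_assoc)
  then show l: "fst (leaf_map (chart C0 B0 z)) = B0 ** (cay ?M ** emb2)"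
    by (simp add: leaf_map_body[OF Q] b)
  have "transpose B0 ** B0 = mat 1" using B0 by (simp add: rotation_matrix_def orthogonal_matrix)
  then show "frame_part B0 (chart C0 B0 z) = cay ?M ** emb2"
    unfolding frame_part_def l by (rule matrix_cancel)
  show RR: "transpose (chart_rotation B0 z) ** chart_rotation B0 z = mat 1"
    using R by (simp add: rotation_matrix_def orthogonal_matrix)
  show "snd (leaf_map (chart C0 B0 z)) = fst (snd z)"
    unfolding leaf_map_body(2)[OF Q] b by (simp add: chart_def matrix_cancel(2)[OF RR] emb_proj)
qed

lemma chart_inv_chart:
  assumes C0: "rotation_matrix C0" and B0: "rotation_matrix B0"
  shows "chart C0 B0 z \<in> chart_dom C0 B0" "chart_inv C0 B0 (chart C0 B0 z) = z"
proof -
  note p = chart_props[OF C0 B0, of z]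
  let ?M = "stiefel_skew (fst (snd (snd z))) (snd (snd (snd z)))"
  have o: "transpose C0 ** C0 = mat 1" "transpose B0 ** B0 = mat 1"
    using C0 B0 by (simp_all add: rotation_matrix_def orthogonal_matrix)
  have c: "transpose C0 ** fst (fst (chart C0 B0 z)) = cay (om (fst (fst (fst z))))"
    by (simp add: chart_def matrix_cancel(1)[OF o(1)])
  have g: "block_part B0 (chart C0 B0 z) = cay (om (fst (snd (fst z))))"
  proof -
    have "transpose (cay ?M) ** (transpose B0 ** chart_rotation B0 z) = blk (cay (om (fst (snd (fst z))))) (mat 1)"
      unfolding chart_rotation_def
      by (simp only: matrix_cancel(1)[OF o(2)] matrix_cancel(1)[OF transpose_cay_mult(1)[OF transpose_stiefel_skew]])
    then show ?thesis
      unfolding block_part_def p stiefel_chart by (simp add: blk_emb emb_cancel)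
  qed
  show "chart C0 B0 z \<in> chart_dom C0 B0"
    unfolding chart_dom_def chart_dom1_def mem_Collect_eq c g p(3)
    by (intro conjI cay_skew(3) transpose_om stiefel_chart(1))
  have "transpose emb1 *v (transpose (chart_rotation B0 z) *v fst (snd (chart C0 B0 z))) = snd (snd (fst z))"
    by (simp add: chart_def matrix_cancel(2)[OF p(6)] emb_proj)
  then show "chart_inv C0 B0 (chart C0 B0 z) = z"
    unfolding chart_inv_def c g p(2,3,4) stiefel_chart vee_cay_inv_cay by (simp add: chart_def)
qed

lemma chart_chart_inv:
  assumes C0: "rotation_matrix C0" and B0: "rotation_matrix B0" and p: "p \<in> Q_model \<inter> chart_dom C0 B0"
  shows "chart C0 B0 (chart_inv C0 B0 p) = p"
proof -
  obtain C r xh A where pc: "p = ((C, r), xh, A)" by (cases p) auto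
  have pQ: "p \<in> Q_model" and rC: "rotation_matrix C" and rA: "rotation_matrix A"
    using p by (simp_all add: pc Q_model_iff)
  let ?B = "body_rotation p" and ?W = "frame_part B0 p" and ?g = "block_part B0 p"
  let ?M = "stiefel_skew (stiefel_E (frame_part B0 p)) (stiefel_S (frame_part B0 p))"
  have d: "det (transpose C0 ** C + mat 1) \<noteq> 0" "det (transpose emb2 ** ?W + mat 1) \<noteq> 0" "det (?g + mat 1) \<noteq> 0"
    using p by (auto simp: chart_dom_def chart_dom1_def pc)
  have tr: "rotation_matrix (transpose X)" if "rotation_matrix X" for X :: "real^'k^'k"
    using that by (simp add: rotation_matrix_def det_transpose)
  have o: "C0 ** transpose C0 = mat 1" "B0 ** transpose B0 = mat 1" "transpose C ** C = mat 1"
    using C0 B0 rC by (simp_all add: rotation_matrix_def orthogonal_matrix_def)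
  have rB: "rotation_matrix ?B"
    unfolding body_rotation_def pc fst_conv snd_conv by (intro rotation_matrix_mult rA rotation_blk_snd tr rC)
  have oB: "transpose ?B ** ?B = mat 1" "?B ** transpose ?B = mat 1"
    using rB by (simp_all add: rotation_matrix_def orthogonal_matrix_def)
  have "orthogonal_matrix (transpose C0 ** C)"
    using rotation_matrix_mult[OF tr[OF C0] rC] by (simp add: rotation_matrix_def)
  then have "C0 ** cay (om (vee (cay_inv (transpose C0 ** C)))) = C0 ** (transpose C0 ** C)"
    by (simp only: skew_vee_cay_inv[OF _ d(1)])
  then have cC: "C0 ** cay (om (vee (cay_inv (transpose C0 ** C)))) = C"
    by (simp only: matrix_cancel(1)[OF o(1)])
  have W: "?W = (transpose B0 ** ?B) ** emb2"
    by (simp add: frame_part_def leaf_map_body[OF pQ] matrix_mul_assoc)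
  have rBB: "rotation_matrix (transpose B0 ** ?B)" by (intro rotation_matrix_mult tr B0 rB)
  then have oBB: "transpose (transpose B0 ** ?B) ** (transpose B0 ** ?B) = mat 1"
    by (simp only: rotation_matrix_def orthogonal_matrix)
  have "transpose ?W ** ?W = transpose emb2 ** (transpose (transpose B0 ** ?B) ** ((transpose B0 ** ?B) ** emb2))"
    unfolding W matrix_transpose_mul[of _ emb2] by (simp only: matrix_mul_assoc)
  then have WW: "transpose ?W ** ?W = mat 1" by (simp only: matrix_cancel(1)[OF oBB] emb_mult)
  have MW: "cay ?M ** emb2 = ?W" by (rule stiefel_chart_surj[OF WW d(2)])
  \<comment> \<open>The relative rotation without its Stiefel factor. That factor already reproduces
    the last three columns, so \<open>D\<close> fixes \<open>emb2\<close> and is a block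
    rotation.\<close>
  define D where "D = transpose (cay ?M) ** (transpose B0 ** ?B)"
  have rD: "rotation_matrix D"
    unfolding D_def by (intro rotation_matrix_mult[OF tr[OF rotation_cay] rBB] transpose_stiefel_skew)
  have "D ** emb2 = transpose (cay ?M) ** ?W" by (simp only: D_def W matrix_mul_assoc)
  also have "\<dots> = transpose (cay ?M) ** (cay ?M ** emb2)" by (simp only: MW)
  also have "\<dots> = emb2"
    by (rule matrix_cancel(1)[OF transpose_cay_mult(1)[OF transpose_stiefel_skew]])
  finally have De: "D ** emb2 = emb2" .
  obtain g where g: "rotation_matrix g" "D = blk g (mat 1)"
    by (fact fixes_emb2_blk[OF rD De])
  have gg: "?g = g" unfolding block_part_def D_def[symmetric] g(2) blk_emb emb_cancel ..
  then have cg: "cay (om (vee (cay_inv ?g))) = g"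
    using g(1) d(3) by (simp add: skew_vee_cay_inv rotation_matrix_def)
  have "cay ?M ** D = transpose B0 ** ?B"
    unfolding D_def by (rule matrix_cancel(1)[OF transpose_cay_mult(2)[OF transpose_stiefel_skew]])
  then have "B0 ** (cay ?M ** D) = ?B" by (simp only: matrix_cancel(1)[OF o(2)])
  then have R: "chart_rotation B0 (chart_inv C0 B0 p) = ?B"
    unfolding chart_rotation_def chart_inv_def fst_conv snd_conv cg g(2) .
  have xh: "emb1 *v (transpose emb1 *v (transpose ?B *v xh)) + emb2 *v (snd (leaf_map p) + r) = transpose ?B *v xh"
    unfolding leaf_map_body(2)[OF pQ] by (simp add: pc emb_complete_vec)
  have A: "?B ** blk (mat 1) C = A"
    by (simp add: body_rotation_def pc blk_mult o blk_one flip: matrix_mul_assoc)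
  have e: "fst (fst (fst (chart_inv C0 B0 p))) = vee (cay_inv (transpose C0 ** C))"
    "snd (fst (fst (chart_inv C0 B0 p))) = r"
    "snd (snd (fst (chart_inv C0 B0 p))) = transpose emb1 *v (transpose ?B *v xh)"
    "fst (snd (chart_inv C0 B0 p)) = snd (leaf_map p)"
    by (simp_all add: chart_inv_def pc)
  show ?thesis
    unfolding chart_def R e cC xh A matrix_cancel(2)[OF oB(2)] by (rule pc[symmetric])
qed

lemma flat_chart_leaf_map:
  assumes C0: "rotation_matrix C0" and B0: "rotation_matrix B0"
  shows "flat_chart Q_model leaf_map (chart_dom C0 B0) (chart C0 B0) (chart_inv C0 B0)"
proof (rule flat_chart.intro)
  show "chart C0 B0 z \<in> Q_model \<inter> chart_dom C0 B0" for z
    by (intro IntI chart_props(1)[OF C0 B0] chart_inv_chart(1)[OF C0 B0])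
  show "leaf_map (chart C0 B0 (a, c)) = leaf_map (chart C0 B0 (a', c))" for a a' c
    using chart_props(4,5)[OF C0 B0, of "(a, c)"] chart_props(4,5)[OF C0 B0, of "(a', c)"]
    by (simp add: prod_eq_iff)
  \<comment> \<open>The transversal coordinates are computed from \<open>leaf_map p\<close>
    alone.\<close>
  show "snd (chart_inv C0 B0 p) = snd (chart_inv C0 B0 p')" if "leaf_map p = leaf_map p'" for p p'
    by (simp add: chart_inv_def frame_part_def that)
qed (rule open_chart_dom smooth_chart smooth_chart_inv chart_inv_chart(2)[OF C0 B0] chart_chart_inv[OF C0 B0], (assumption)?)+

text \<open>The chart is centred at \<open>p\<close>, where all Cayley parameters vanish. Membership
  in the domain then follows from the fact that the chart maps into it, without evaluating a
  determinant.\<close>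

lemma chart_at_point:
  assumes p: "p \<in> Q_model"
  shows "p \<in> Q_model \<inter> chart_dom (fst (fst p)) (body_rotation p)" "rotation_matrix (fst (fst p))"
    "rotation_matrix (body_rotation p)"
proof -
  obtain C r xh A where pc: "p = ((C, r), xh, A)" by (cases p) auto
  have rC: "rotation_matrix C" and rA: "rotation_matrix A" using p by (simp_all add: pc Q_model_iff)
  have o: "transpose C ** C = mat 1" using rC by (simp add: rotation_matrix_def orthogonal_matrix)
  have rB: "rotation_matrix (body_rotation p)"
    unfolding body_rotation_def pc fst_conv snd_conv
    using rC by (intro rotation_matrix_mult rA rotation_blk_snd) (simp add: rotation_matrix_def det_transpose)
  have oB: "body_rotation p ** transpose (body_rotation p) = mat 1"
    using rB by (simp add: rotation_matrix_def orthogonal_matrix_def)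
  have cay0: "cay (0 :: real^'n^'n) = mat 1"
    by (simp add: cay_def matrix_inv_unique(2)[of "mat 1" "mat 1"] scaleR_2)
  have om0: "om 0 = 0" by (rule linear_0[OF linear_om])
  have st0: "stiefel_skew 0 0 = 0" by (simp add: stiefel_skew_def om0 tr_simps mm_simps)
  let ?v = "transpose (body_rotation p) *v xh"
  \<comment> \<open>Zero for every Cayley parameter; the other entries are \<open>r\<close> and the
    two components of \<open>xh\<close> in the columns of \<open>body_rotation p\<close>, the
    translational one shifted by \<open>r\<close>.\<close>
  define z :: "leaf_coords \<times> transversal_coords" where
    "z = (((0, r), (0, transpose emb1 *v ?v)), (transpose emb2 *v ?v - r, (0, 0)))"
  have R: "chart_rotation (body_rotation p) z = body_rotation p"
    by (simp add: chart_rotation_def z_def om0 st0 cay0 blk_one)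
  have A: "body_rotation p ** blk (mat 1) C = A"
    by (simp add: body_rotation_def pc blk_mult o blk_one flip: matrix_mul_assoc)
  have "chart C (body_rotation p) z = p"
    unfolding chart_def R by (simp add: z_def om0 cay0 emb_complete_vec matrix_cancel(2)[OF oB] A pc[symmetric])
  then have "p \<in> chart_dom C (body_rotation p)"
    using chart_inv_chart(1)[OF rC rB, of z] by simp
  then show "p \<in> Q_model \<inter> chart_dom (fst (fst p)) (body_rotation p)" using p by (simp add: pc)
  show "rotation_matrix (fst (fst p))" "rotation_matrix (body_rotation p)" using rC rB by (simp_all add: pc)
qed

section \<open>The foliation by orbits\<close>

lemma linear_iso_exists:
  assumes "DIM('m::euclidean_space) = DIM('n::euclidean_space)"
  obtains L :: "'m::euclidean_space \<Rightarrow> 'n::euclidean_space" and L' where "linear L" "linear L'" "\<And>x. L' (L x) = x" "\<And>y. L (L' y) = y"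
  by (rule isomorphisms_UNIV_UNIV[OF assms]) (rule that)

lemma Q_model_embedded: "embedded_submanifold TYPE(real^27) Q_model"
  unfolding embedded_submanifold_def
proof (rule immersed_structure_top_of_set)
  fix p assume "p \<in> Q_model"
  note c = chart_at_point[OF this]
  interpret flat_chart Q_model leaf_map "chart_dom (fst (fst p)) (body_rotation p)"
    "chart (fst (fst p)) (body_rotation p)" "chart_inv (fst (fst p)) (body_rotation p)"
    by (rule flat_chart_leaf_map[OF c(2,3)])
  \<comment> \<open>Four triples along the leaf, and 3 + 9 + 3 across it.\<close>
  have dimL: "DIM(real^27) = DIM(leaf_coords \<times> transversal_coords)" by simp
  obtain L :: "real^27 \<Rightarrow> leaf_coords \<times> transversal_coords" and L'
    where L: "linear L" "linear L'" "\<And>x. L' (L x) = x" "\<And>y. L (L' y) = y"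
    by (fact linear_iso_exists[OF dimL])
  have "p \<in> (\<lambda>x. chart (fst (fst p)) (body_rotation p) (L x)) ` UNIV"
    by (rule image_eqI[of _ _ "L' (chart_inv (fst (fst p)) (body_rotation p) p)"]) (simp_all only: L \<phi>\<psi>[OF c(1)] UNIV_I)
  then show "\<exists>(U :: (real^27) set) \<phi>. local_parametrization (top_of_set Q_model) U \<phi> \<and> p \<in> \<phi> ` U"
    using parametrization[OF L open_UNIV] by (intro exI conjI)
qed

text \<open>As a level set of the invariants each leaf carries the subspace topology, so it is even
  embedded.\<close>

lemma leaf_immersed: "immersed_structure TYPE(real^12) (top_of_set {p \<in> Q_model. leaf_map p = v})"
proof (rule immersed_structure_top_of_set)
  fix p assume p: "p \<in> {p \<in> Q_model. leaf_map p = v}"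
  then have "p \<in> Q_model" and v: "v = leaf_map p" by simp_all
  note c = chart_at_point[OF this(1)]
  interpret flat_chart Q_model leaf_map "chart_dom (fst (fst p)) (body_rotation p)"
    "chart (fst (fst p)) (body_rotation p)" "chart_inv (fst (fst p)) (body_rotation p)"
    by (rule flat_chart_leaf_map[OF c(2,3)])
  have dimL: "DIM(real^12) = DIM(leaf_coords)" by simp
  obtain L :: "real^12 \<Rightarrow> leaf_coords" and L'
    where L: "linear L" "linear L'" "\<And>x. L' (L x) = x" "\<And>y. L (L' y) = y"
    by (fact linear_iso_exists[OF dimL])
  show "\<exists>(U :: (real^12) set) \<phi>. local_parametrization (top_of_set {p \<in> Q_model. leaf_map p = v}) U \<phi> \<and> p \<in> \<phi> ` U"
    unfolding v using leaf_parametrization[OF L c(1)] by (intro exI conjI)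
qed

lemma orbit_connected_immersed:
  assumes "q0 \<in> Q"
  shows "connected_immersed_submanifold TYPE(real^12) Q_model (Q_coords ` orbit q0)"
  unfolding connected_immersed_submanifold_def Q_coords_orbit[OF assms]
proof (intro conjI exI)
  show "connected_space (top_of_set {p \<in> Q_model. leaf_map p = leaf_map (Q_coords q0)})"
    by (simp add: connected_space_subtopology connected_leaf)
qed (auto simp: leaf_immersed)

lemma orbit_leaf:
  assumes "A \<in> {Q_coords ` orbit q0 | q0. q0 \<in> Q}"
  shows "\<exists>v. A = {p \<in> Q_model. leaf_map p = v}"
proof -
  obtain q0 where "q0 \<in> Q" "A = Q_coords ` orbit q0" using assms by auto
  then show ?thesis using Q_coords_orbit by (intro exI[of _ "leaf_map (Q_coords q0)"]) simp
qed

lemma orbit_foliation: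
  "foliation TYPE(real^12) TYPE(real^15) Q_model {Q_coords ` orbit q0 | q0. q0 \<in> Q}"
  unfolding foliation_def
proof (intro conjI ballI)
  show "partition_on Q_model {Q_coords ` orbit q0 | q0. q0 \<in> Q}"
  proof (rule partition_onI)
    show "\<Union> {Q_coords ` orbit q0 | q0. q0 \<in> Q} = Q_model"
    proof (intro equalityI subsetI)
      fix p assume p: "p \<in> Q_model"
      then have "config_of p \<in> Q" "Q_coords (config_of p) = p"
        by (rule config_of_in_Q, rule Q_coords_config_of)
      then have "p \<in> Q_coords ` orbit (config_of p)" using p by (simp add: Q_coords_orbit)
      then show "p \<in> \<Union> {Q_coords ` orbit q0 | q0. q0 \<in> Q}" using \<open>config_of p \<in> Q\<close> by blast
    next
      fix p assume "p \<in> \<Union> {Q_coords ` orbit q0 | q0. q0 \<in> Q}"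
      then obtain q0 where "q0 \<in> Q" "p \<in> Q_coords ` orbit q0" by blast
      then show "p \<in> Q_model" by (simp add: Q_coords_orbit)
    qed
  next
    fix A A' assume A: "A \<in> {Q_coords ` orbit q0 | q0. q0 \<in> Q}" "A' \<in> {Q_coords ` orbit q0 | q0. q0 \<in> Q}"
      and neq: "A \<noteq> A'"
    obtain v where v: "A = {p \<in> Q_model. leaf_map p = v}" using orbit_leaf[OF A(1)] by (elim exE)
    obtain v' where v': "A' = {p \<in> Q_model. leaf_map p = v'}" using orbit_leaf[OF A(2)] by (elim exE)
    have "v \<noteq> v'" using neq unfolding v v' by auto
    then show "disjnt A A'" unfolding v v' disjnt_def by auto
  next
    show "{} \<notin> {Q_coords ` orbit q0 | q0. q0 \<in> Q}"
    proof
      assume "{} \<in> {Q_coords ` orbit q0 | q0. q0 \<in> Q}"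
      then obtain q0 where "q0 \<in> Q" "{} = Q_coords ` orbit q0" by blast
      moreover from this have "Q_coords q0 \<in> Q_coords ` orbit q0"
        by (simp add: Q_coords_orbit[OF \<open>q0 \<in> Q\<close>] Q_coords_in_model)
      ultimately show False by simp
    qed
  qed
next
  fix A assume "A \<in> {Q_coords ` orbit q0 | q0. q0 \<in> Q}"
  then show "connected_immersed_submanifold TYPE(real^12) Q_model A"
    using orbit_connected_immersed by auto
next
  fix p assume "p \<in> Q_model"
  note c = chart_at_point[OF this]
  interpret flat_chart Q_model leaf_map "chart_dom (fst (fst p)) (body_rotation p)"
    "chart (fst (fst p)) (body_rotation p)" "chart_inv (fst (fst p)) (body_rotation p)"
    by (rule flat_chart_leaf_map[OF c(2,3)])
  have dimL: "DIM(real^12) = DIM(leaf_coords)" by simp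
  obtain L :: "real^12 \<Rightarrow> leaf_coords" and L'
    where L: "linear L" "linear L'" "\<And>x. L' (L x) = x" "\<And>y. L (L' y) = y"
    by (fact linear_iso_exists[OF dimL])
  have dimM: "DIM(real^15) = DIM(transversal_coords)" by simp
  obtain M :: "real^15 \<Rightarrow> transversal_coords" and M'
    where M: "linear M" "linear M'" "\<And>x. M' (M x) = x" "\<And>y. M (M' y) = y"
    by (fact linear_iso_exists[OF dimM])
  show "\<exists>(a::real^12) b (c::real^15) d \<phi>.
        local_parametrization (top_of_set Q_model) (box a b \<times> box c d) \<phi> \<and>
        p \<in> \<phi> ` (box a b \<times> box c d) \<and>
        (\<forall>A\<in>{Q_coords ` orbit q0 | q0. q0 \<in> Q}. \<exists>K. countable K \<and> K \<subseteq> box c d \<and>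
           A \<inter> \<phi> ` (box a b \<times> box c d) = \<phi> ` (box a b \<times> K))"
    by (rule foliation_box[OF L M c(1) orbit_leaf])
qed

text \<open>Two configurations with \<open>xh = 0\<close> that differ only in \<open>r\<close> have
  different second invariants, namely \<open>- r\<close>.\<close>

lemma not_controllable: "\<exists>q0\<in>Q. \<exists>q1\<in>Q. q1 \<notin> orbit q0"
proof -
  define p :: "real^3 \<Rightarrow> se3_ambient \<times> (real^6) \<times> (real^6^6)" where "p r = ((mat 1, r), 0, mat 1)" for r
  have pQ: "p r \<in> Q_model" for r
    by (simp add: p_def Q_model_iff rotation_matrix_def orthogonal_matrix_id)
  have "leaf_map (p (axis 1 1)) \<noteq> leaf_map (p 0)"
    by (simp add: p_def leaf_map_def mv_simps axis_eq_0_iff)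
  then have "config_of (p (axis 1 1)) \<notin> orbit (config_of (p 0))"
    by (simp add: orbit_eq[OF config_of_in_Q[OF pQ]] Q_coords_config_of[OF pQ])
  then show ?thesis
    using config_of_in_Q[OF pQ] by (intro bexI)
qed

theorem mainTheorem8:
  shows "embedded_submanifold TYPE(real^27) (Q_coords ` Q) \<and>
    (\<forall>q0\<in>Q. immersed_submanifold TYPE(real^12) (Q_coords ` Q) (Q_coords ` orbit q0)) \<and>
    foliation TYPE(real^12) TYPE(real^15) (Q_coords ` Q) {Q_coords ` orbit q0 | q0. q0 \<in> Q} \<and>
    (\<exists>q0\<in>Q. \<exists>q1\<in>Q. q1 \<notin> orbit q0)"
  unfolding Q_coords_image
proof (intro conjI ballI Q_model_embedded orbit_foliation not_controllable)
  fix q0 assume "q0 \<in> Q"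
  then show "immersed_submanifold TYPE(real^12) Q_model (Q_coords ` orbit q0)"
    using orbit_connected_immersed
    unfolding connected_immersed_submanifold_def immersed_submanifold_def by iprover
qed

end
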